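(* Let $X$ be a Banach space containing a subspace which has an unconditional basis and does not contain $\ell_\infty^n$ uniformly. Then $\ell_2$ embeds coarsely into $X$.
   Context: Here a subspace means a closed linear subspace, and an unconditional basis means an unconditional Schauder basis $\{e_i\}_{i\in\mathbb{N}}$ (so the subspace is infinite dimensional). A Banach space $W$ contains $\ell_\infty^n$ uniformly if there is a constant $\lambda<\infty$ such that for every $n\in\mathbb{N}$ there is an $n$-dimensional subspace $E_n\subset W$ and a linear isomorphism $T_n:E_n\to\ell_\infty^n$ with $\|T_n\|\,\|T_n^{-1}\|\le\lambda$. A mapping $f:A\to B$ between metric spaces $(A,d_A)$ and $(B,d_B)$ is called a coarse embedding if there exist functions $\rho_1,\rho_2:[0,\infty)\to[0,\infty)$ such that $\rho_1(d_A(x,y))\le d_B(f(x),f(y))\le\rho_2(d_A(x,y))$ for all $x,y\in A$, and $\lim_{r\to\infty}\rho_1(r)=\infty$. $A$ embeds coarsely into $B$ if there is a coarse embedding $A\to B$; Banach spaces carry their norm metrics. *)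

theory Defs
  imports "HOL-Analysis.Analysis"
begin

definition closed_subspace :: "'a::real_normed_vector set \<Rightarrow> bool" where
  "closed_subspace Y \<longleftrightarrow> subspace Y \<and> closed Y"

definition schauder_basis :: "'a::real_normed_vector set \<Rightarrow> (nat \<Rightarrow> 'a) \<Rightarrow> bool" where
  "schauder_basis Y e \<longleftrightarrow>
     range e \<subseteq> Y \<and> (\<forall>y\<in>Y. \<exists>!a :: nat \<Rightarrow> real. (\<lambda>i. a i *\<^sub>R e i) sums y)"

(* summable_on is convergence of the net of finite partial sums, i.e. unconditional convergence *)
definition unconditional_basis :: "'a::real_normed_vector set \<Rightarrow> (nat \<Rightarrow> 'a) \<Rightarrow> bool" where
  "unconditional_basis Y e \<longleftrightarrow>
     schauder_basis Y e \<and>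
     (\<forall>y\<in>Y. \<forall>a :: nat \<Rightarrow> real.
        (\<lambda>i. a i *\<^sub>R e i) sums y \<longrightarrow> (\<lambda>i. a i *\<^sub>R e i) summable_on UNIV)"

(* The n-dimensional space of sequences supported in {..<n}, with the supremum norm of the
   bounded sequences (every function on the discrete space nat is continuous). *)
definition ell_inf :: "nat \<Rightarrow> (nat \<Rightarrow>\<^sub>C real) set" where
  "ell_inf n = {f. \<forall>i\<ge>n. apply_bcontfun f i = 0}"

definition linear_iso_betw ::
  "('a::real_vector \<Rightarrow> 'b::real_vector) \<Rightarrow> 'a set \<Rightarrow> 'b set \<Rightarrow> bool" where
  "linear_iso_betw T E F \<longleftrightarrow>
     bij_betw T E F \<and>
     (\<forall>x\<in>E. \<forall>y\<in>E. T (x + y) = T x + T y) \<and>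
     (\<forall>c. \<forall>x\<in>E. T (c *\<^sub>R x) = c *\<^sub>R T x)"

(* onorm relativised to a subspace. It is used only for finite-dimensional E, where the supremum
   is over a bounded set. *)
definition onorm_on :: "'a::real_normed_vector set \<Rightarrow> ('a \<Rightarrow> 'b::real_normed_vector) \<Rightarrow> real" where
  "onorm_on E T = (SUP x\<in>E. norm (T x) / norm x)"

definition contains_ell_inf_uniformly :: "'a::real_normed_vector set \<Rightarrow> bool" where
  "contains_ell_inf_uniformly W \<longleftrightarrow>
     (\<exists>K::real. \<forall>n. \<exists>E T.
        closed_subspace E \<and> E \<subseteq> W \<and> dim E = n \<and>
        linear_iso_betw T E (ell_inf n) \<and>
        onorm_on E T * onorm_on (ell_inf n) (inv_into E T) \<le> K)"

definition coarse_embedding :: "'a metric \<Rightarrow> 'b metric \<Rightarrow> ('a \<Rightarrow> 'b) \<Rightarrow> bool" where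
  "coarse_embedding A B f \<longleftrightarrow>
     f \<in> mspace A \<rightarrow> mspace B \<and>
     (\<exists>\<rho>\<^sub>1 \<rho>\<^sub>2 :: real \<Rightarrow> real.
        (\<forall>r\<ge>0. 0 \<le> \<rho>\<^sub>1 r \<and> 0 \<le> \<rho>\<^sub>2 r) \<and>
        (\<forall>x\<in>mspace A. \<forall>y\<in>mspace A.
           \<rho>\<^sub>1 (mdist A x y) \<le> mdist B (f x) (f y) \<and>
           mdist B (f x) (f y) \<le> \<rho>\<^sub>2 (mdist A x y)) \<and>
        filterlim \<rho>\<^sub>1 at_top at_top)"

definition embeds_coarsely :: "'a metric \<Rightarrow> 'b metric \<Rightarrow> bool" where
  "embeds_coarsely A B \<longleftrightarrow> (\<exists>f. coarse_embedding A B f)"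

definition ell2 :: "(nat \<Rightarrow> real) set" where
  "ell2 = {x. (\<lambda>i. (x i)\<^sup>2) summable_on UNIV}"

definition ell2_dist :: "(nat \<Rightarrow> real) \<Rightarrow> (nat \<Rightarrow> real) \<Rightarrow> real" where
  "ell2_dist x y = sqrt (\<Sum>\<^sub>\<infinity>i. (x i - y i)\<^sup>2)"

definition ell2_metric :: "(nat \<Rightarrow> real) metric" where
  "ell2_metric = metric (ell2, ell2_dist)"

lemma ell2_diff:
  assumes "x \<in> ell2" "y \<in> ell2"
  shows "summable (\<lambda>i. (x i - y i)\<^sup>2)"
proof (rule summable_comparison_test')
  show "summable (\<lambda>i. 2 * (x i)\<^sup>2 + 2 * (y i)\<^sup>2)"
    using assms by (intro summable_add summable_mult) (auto simp: ell2_def summable_on_UNIV_nonneg_real_iff)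
  fix i :: nat
  have "2 * (x i)\<^sup>2 + 2 * (y i)\<^sup>2 - (x i - y i)\<^sup>2 = (x i + y i)\<^sup>2"
    by (simp add: power2_eq_square algebra_simps)
  then show "norm ((x i - y i)\<^sup>2) \<le> 2 * (x i)\<^sup>2 + 2 * (y i)\<^sup>2"
    by (smt (verit) real_norm_def zero_le_power2)
qed

lemma ell2_dist_limit:
  assumes "x \<in> ell2" "y \<in> ell2"
  shows "(\<lambda>n. L2_set (\<lambda>i. x i - y i) {..<n}) \<longlonglongrightarrow> ell2_dist x y"
proof -
  have "(\<lambda>i. (x i - y i)\<^sup>2) summable_on UNIV"
    using ell2_diff[OF assms] by (simp add: summable_on_UNIV_nonneg_real_iff)
  then have "(\<lambda>i. (x i - y i)\<^sup>2) sums (\<Sum>\<^sub>\<infinity>i. (x i - y i)\<^sup>2)"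
    by (intro has_sum_imp_sums) simp
  then show ?thesis
    unfolding L2_set_def ell2_dist_def sums_def by (rule tendsto_real_sqrt)
qed

lemma Metric_space_ell2: "Metric_space ell2 ell2_dist"
proof
  show "0 \<le> ell2_dist x y" for x y
    by (simp add: ell2_dist_def infsum_nonneg)
  show "ell2_dist x y = ell2_dist y x" for x y
    by (simp add: ell2_dist_def power2_commute)
  show "ell2_dist x y = 0 \<longleftrightarrow> x = y" if "x \<in> ell2" "y \<in> ell2" for x y
  proof
    have summ: "(\<lambda>i. (x i - y i)\<^sup>2) summable_on UNIV"
      using ell2_diff[OF that] by (simp add: summable_on_UNIV_nonneg_real_iff)
    assume "ell2_dist x y = 0"
    then have "(\<Sum>\<^sub>\<infinity>i. (x i - y i)\<^sup>2) \<le> 0"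
      by (simp add: ell2_dist_def)
    then have "(x i - y i)\<^sup>2 = 0" for i
      using nonneg_infsum_le_0D[OF _ summ, of i] by simp
    then show "x = y" by auto
  qed (simp add: ell2_dist_def)
  show "ell2_dist x z \<le> ell2_dist x y + ell2_dist y z"
    if "x \<in> ell2" "y \<in> ell2" "z \<in> ell2" for x y z
  proof (rule LIMSEQ_le)
    show "(\<lambda>n. L2_set (\<lambda>i. x i - z i) {..<n}) \<longlonglongrightarrow> ell2_dist x z"
      using that by (intro ell2_dist_limit)
    show "(\<lambda>n. L2_set (\<lambda>i. x i - y i) {..<n} + L2_set (\<lambda>i. y i - z i) {..<n})
            \<longlonglongrightarrow> ell2_dist x y + ell2_dist y z"
      using that by (intro tendsto_add ell2_dist_limit)
    show "\<exists>N. \<forall>n\<ge>N. L2_set (\<lambda>i. x i - z i) {..<n}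
            \<le> L2_set (\<lambda>i. x i - y i) {..<n} + L2_set (\<lambda>i. y i - z i) {..<n}"
    proof (intro exI allI impI)
      fix n :: nat
      show "L2_set (\<lambda>i. x i - z i) {..<n}
            \<le> L2_set (\<lambda>i. x i - y i) {..<n} + L2_set (\<lambda>i. y i - z i) {..<n}"
        using L2_set_triangle_ineq[of "\<lambda>i. x i - y i" "\<lambda>i. y i - z i" "{..<n}"] by simp
    qed
  qed
qed

lemma mspace_ell2_metric [simp]: "mspace ell2_metric = ell2"
  unfolding ell2_metric_def by (rule Metric_space.mspace_metric[OF Metric_space_ell2])

lemma mdist_ell2_metric [simp]: "mdist ell2_metric = ell2_dist"
  unfolding ell2_metric_def by (rule Metric_space.mdist_metric[OF Metric_space_ell2])

end

theory Submission
  imports Defs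
begin

text \<open>Suppose that there are maps \<open>F\<^sub>l\<close> from \<open>\<ell>\<^sub>2\<close> into the unit ball of the
subspace, for \<open>l = 0, 1, 2, \<dots>\<close>, which use disjoint sets of basis vectors for different \<open>l\<close>,
such that points at distance at most \<open>l\<close> have images at distance at most \<open>2\<^sup>-\<^sup>l\<close>, while points
whose distance exceeds some \<open>D\<^sub>l\<close> have images at distance at least \<open>\<delta>\<close>, with \<open>\<delta> > 0\<close> the same
for all \<open>l\<close>.  Then \<open>G x = (\<Sum>l. F\<^sub>l x - F\<^sub>l 0)\<close> converges and is a coarse embedding: it moves
points at bounded distance by a bounded amount, and if \<open>x\<close> and \<open>y\<close> are further apart than
\<open>D\<^sub>0, \<dots>, D\<^sub>k\<^sub>-\<^sub>1\<close>, then \<open>G x - G y\<close> contains \<open>k\<close> disjoint pieces of norm at least \<open>\<delta>\<close>.  The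
absence of uniform copies of \<open>\<ell>\<^sub>\<infinity>\<^sup>n\<close> forces the norm of such a sum to infinity with \<open>k\<close>
(lemma \<open>coarse_embedding_from_layers\<close>).

Each \<open>F\<^sub>l\<close> is a composition of two maps.  The first one sends a point of \<open>\<ell>\<^sub>2\<close> to a probability
measure on \<open>\<nat>\<close>, close points to measures that are close in total variation, and distant points to
measures that are nearly disjoint (\<open>probability_layer\<close>).  It is an infinite product of
one-dimensional maps of the real line into the probability measures on \<open>\<int>\<close>; Hellinger
affinities multiply, which turns the coordinatewise behaviour into bounds in terms of the
\<open>\<ell>\<^sub>2\<close> distance.

The second map sends a probability measure \<open>h\<close> to a vector \<open>x\<close> of the unit ball that nearly
maximises the entropy \<open>\<Sum>i. h i * ln (x i)\<close>.  This is the map of Lozanovskii factorisation,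
which Odell and Schlumprecht use to show that unit spheres are uniformly homeomorphic.  Here
it has to be uniformly continuous (\<open>near_max_close\<close>) and to send nearly disjoint measures to
vectors that are uniformly apart (\<open>near_max_far\<close>).  Demanding separation only for nearly disjoint
measures keeps the geometry elementary: instead of a \<open>q\<close>-concave renorming, it suffices to measure
vectors by a convex, \<open>q\<close>-homogeneous functional \<open>Psi\<close> that is superadditive on disjoint vectors
and equivalent to the \<open>q\<close>-th power of the norm.  Approximate maximisers are enough, since the
allowed error can be chosen for each layer separately.

Two facts connect this with Banach spaces.  The expansion of a vector along an unconditional
basis is bounded, uniformly over all subsets of the index set and all changes of signs; this
follows from Baire's theorem (\<open>expansions_bounded\<close>) and makes the norm equivalent to a lattice
norm on finitely supported sequences.  Moreover, if \<open>n\<close> disjoint vectors of norm at least \<open>t\<close> had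
a sum of norm below \<open>2 * t\<close>, for every \<open>n\<close>, then they would span uniform copies of \<open>\<ell>\<^sub>\<infinity>\<^sup>n\<close>
(\<open>doubling_of_not_ell_inf\<close>); iterating the resulting doubling property gives a lower
\<open>q\<close>-estimate (\<open>lower_q_estimate\<close>), from which \<open>Psi\<close> is built.\<close>

section \<open>Finitely supported sequences\<close>

definition fin_supp :: "(nat \<Rightarrow> real) \<Rightarrow> bool" where
  "fin_supp x \<longleftrightarrow> finite {i. x i \<noteq> 0}"

definition restr :: "nat set \<Rightarrow> (nat \<Rightarrow> real) \<Rightarrow> nat \<Rightarrow> real" where
  "restr A x = (\<lambda>i. if i \<in> A then x i else 0)"

lemma fin_supp_mono: "fin_supp y \<Longrightarrow> (\<And>i. y i = 0 \<Longrightarrow> x i = 0) \<Longrightarrow> fin_supp x"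
  unfolding fin_supp_def by (erule rev_finite_subset) auto

lemma fin_supp_add [intro]: "fin_supp x \<Longrightarrow> fin_supp y \<Longrightarrow> fin_supp (\<lambda>i. x i + y i)"
  unfolding fin_supp_def
  by (rule finite_subset[of _ "{i. x i \<noteq> 0} \<union> {i. y i \<noteq> 0}"]) auto

lemma fin_supp_diff [intro]: "fin_supp x \<Longrightarrow> fin_supp y \<Longrightarrow> fin_supp (\<lambda>i. x i - y i)"
  unfolding fin_supp_def
  by (rule finite_subset[of _ "{i. x i \<noteq> 0} \<union> {i. y i \<noteq> 0}"]) auto

lemma fin_supp_scale [intro]: "fin_supp x \<Longrightarrow> fin_supp (\<lambda>i. c * x i)"
  by (erule fin_supp_mono) auto

lemma fin_supp_restr [intro]: "fin_supp x \<Longrightarrow> fin_supp (restr A x)"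
  by (erule fin_supp_mono) (auto simp: restr_def)

lemma fin_supp_0 [simp]: "fin_supp (\<lambda>i. 0)"
  by (simp add: fin_supp_def)

lemma finite_union_supp: "fin_supp x \<Longrightarrow> fin_supp y \<Longrightarrow> finite {i. x i \<noteq> 0 \<or> y i \<noteq> 0}"
  unfolding fin_supp_def
  by (rule finite_subset[of _ "{i. x i \<noteq> 0} \<union> {i. y i \<noteq> 0}"]) auto

lemma fin_supp_sum: "(\<And>k. k \<in> K \<Longrightarrow> fin_supp (f k)) \<Longrightarrow> fin_supp (\<lambda>i. \<Sum>k\<in>K. f k i)"
  by (induction K rule: infinite_finite_induct) auto

lemma restr_restr: "restr A (restr B x) = restr (A \<inter> B) x"
  by (auto simp: restr_def)

definition lin :: "(nat \<Rightarrow> 'a::real_normed_vector) \<Rightarrow> (nat \<Rightarrow> real) \<Rightarrow> 'a" where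
  "lin e b = (\<Sum>i | b i \<noteq> 0. b i *\<^sub>R e i)"

lemma lin_eq_sum:
  assumes "finite A" "\<And>i. i \<notin> A \<Longrightarrow> b i = 0"
  shows "lin e b = (\<Sum>i\<in>A. b i *\<^sub>R e i)"
  unfolding lin_def using assms by (intro sum.mono_neutral_left) auto

lemma lin_add:
  assumes "fin_supp b" "fin_supp c"
  shows "lin e (\<lambda>i. b i + c i) = lin e b + lin e c"
proof -
  let ?A = "{i. b i \<noteq> 0 \<or> c i \<noteq> 0}"
  have fin: "finite ?A" using assms by (rule finite_union_supp)
  have "lin e (\<lambda>i. b i + c i) = (\<Sum>i\<in>?A. (b i + c i) *\<^sub>R e i)" by (rule lin_eq_sum[OF fin]) auto
  also have "\<dots> = (\<Sum>i\<in>?A. b i *\<^sub>R e i) + (\<Sum>i\<in>?A. c i *\<^sub>R e i)"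
    by (simp add: scaleR_left_distrib sum.distrib)
  also have "(\<Sum>i\<in>?A. b i *\<^sub>R e i) = lin e b" by (rule lin_eq_sum[OF fin, symmetric]) auto
  also have "(\<Sum>i\<in>?A. c i *\<^sub>R e i) = lin e c" by (rule lin_eq_sum[OF fin, symmetric]) auto
  finally show ?thesis .
qed

lemma lin_scale: "lin e (\<lambda>i. r * b i) = r *\<^sub>R lin e b"
  by (cases "r = 0") (simp_all add: lin_def scaleR_sum_right)

lemma lin_diff:
  assumes "fin_supp b" "fin_supp c"
  shows "lin e (\<lambda>i. b i - c i) = lin e b - lin e c"
  using lin_add[OF assms(1) fin_supp_scale[OF assms(2)], of e "-1"] lin_scale[of e "-1" c] by simp

lemma lin_sum:
  assumes "\<And>k. k \<in> K \<Longrightarrow> fin_supp (b k)"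
  shows "lin e (\<lambda>i. \<Sum>k\<in>K. b k i) = (\<Sum>k\<in>K. lin e (b k))"
  using assms
proof (induction K rule: infinite_finite_induct)
  case (insert k K)
  then have "lin e (\<lambda>i. b k i + (\<Sum>k\<in>K. b k i)) = lin e (b k) + lin e (\<lambda>i. \<Sum>k\<in>K. b k i)"
    by (intro lin_add fin_supp_sum) auto
  then show ?case using insert by simp
qed (simp_all add: lin_def)

section \<open>Lattice norms with a lower q-estimate\<close>

lemma power_convex:
  fixes a b t :: real
  assumes "0 \<le> a" "0 \<le> b" "0 \<le> t" "t \<le> 1"
  shows "((1 - t) * a + t * b) ^ q \<le> (1 - t) * a ^ q + t * b ^ q"
proof -
  have "convex_on {0::real..} (\<lambda>x. x ^ q)"
    using convex_power_odd[of q] convex_power_even[of q] convex_on_subset by (cases "even q") auto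
  then show ?thesis
    using convex_onD[of "{0::real..}" "\<lambda>x. x^q" t a b] assms by simp
qed

locale lattice_norm =
  fixes N :: "(nat \<Rightarrow> real) \<Rightarrow> real"
  assumes triangle: "fin_supp x \<Longrightarrow> fin_supp y \<Longrightarrow> N (\<lambda>i. x i + y i) \<le> N x + N y"
    and scale: "fin_supp x \<Longrightarrow> N (\<lambda>i. c * x i) = \<bar>c\<bar> * N x"
    and mono: "fin_supp y \<Longrightarrow> (\<And>i. \<bar>x i\<bar> \<le> \<bar>y i\<bar>) \<Longrightarrow> N x \<le> N y"
    and unit_pos: "N (\<lambda>j. if j = i then 1 else 0) > 0"
begin

lemma zero [simp]: "N (\<lambda>i. 0) = 0"
  using scale[of "\<lambda>i. 0" 0] by simp

lemma nonneg [simp]: "fin_supp x \<Longrightarrow> 0 \<le> N x"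
  using mono[of x "\<lambda>i. 0"] by simp

lemma restr_le: "fin_supp x \<Longrightarrow> N (restr A x) \<le> N x"
  by (rule mono) (auto simp: restr_def)

lemma coord_le:
  assumes "fin_supp x"
  shows "\<bar>x i\<bar> * N (\<lambda>j. if j = i then 1 else 0) \<le> N x"
proof -
  have "\<bar>x i\<bar> * N (\<lambda>j. if j = i then 1 else 0) = N (\<lambda>j. x i * (if j = i then 1 else 0))"
    by (subst scale) (auto simp: fin_supp_def)
  also have "\<dots> \<le> N x"
    by (rule mono[OF assms]) auto
  finally show ?thesis .
qed

end

text \<open>The pieces of a vector are its restrictions to the fibres of a colouring \<open>c\<close> of the index set,
so that they are disjoint by construction.  The doubling property expresses quantitatively that
disjoint vectors never span a good copy of \<open>\<ell>\<^sub>\<infinity>\<^sup>M\<close>.\<close>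

locale lower_lattice_norm = lattice_norm N for N :: "(nat \<Rightarrow> real) \<Rightarrow> real" +
  fixes M :: nat
  assumes doubling: "fin_supp x \<Longrightarrow> 0 \<le> t \<Longrightarrow> (\<And>k. k < M \<Longrightarrow> t \<le> N (restr {i. (c :: nat \<Rightarrow> nat) i = k} x))
                      \<Longrightarrow> 2 * t \<le> N x"
begin

text \<open>The exponent is chosen such that \<open>2 * M \<le> 2 ^ q\<close>; then the dyadic series that bounds the sum of
the \<open>q\<close>-th powers of the norms of all pieces is dominated by \<open>\<Sum>j. M\<^sup>2 * 2\<^sup>-\<^sup>j = C\<close>.\<close>

definition q :: nat where "q = Suc M"
definition C :: real where "C = 2 * (real M)\<^sup>2"

lemma M_pos: "M > 0"
proof (rule ccontr)
  assume "\<not> M > 0"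
  then show False using doubling[of "\<lambda>_. 0" 1] by auto
qed

lemma C_pos: "C > 0"
  using M_pos by (simp add: C_def)

lemma q_pos: "q > 0" by (simp add: q_def)

text \<open>Iterated doubling: the \<open>M ^ Suc j\<close> pieces form \<open>M\<close> groups of \<open>M ^ j\<close> pieces each, and quotient and
remainder of the colour modulo \<open>M ^ j\<close> give the group and the place in it.\<close>

lemma many_pieces:
  assumes "fin_supp x" "0 \<le> t" "\<And>k. k < M ^ j \<Longrightarrow> t \<le> N (restr {i. c i = k} x)"
  shows "2 ^ j * t \<le> N x"
  using assms
proof (induction j arbitrary: x c)
  case 0
  then have "t \<le> N (restr {i. c i = 0} x)" by simp
  also have "\<dots> \<le> N x" using 0 by (intro restr_le)
  finally show ?case by simp
next
  case (Suc j)
  have "2 * (2 ^ j * t) \<le> N x"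
  proof (rule doubling[where c = "\<lambda>i. c i div M ^ j"])
    fix k assume k: "k < M"
    show "2 ^ j * t \<le> N (restr {i. c i div M ^ j = k} x)"
    proof (rule Suc.IH[where c = "\<lambda>i. c i mod M ^ j"])
      fix r assume r: "r < M ^ j"
      have "(c i mod M ^ j = r \<and> c i div M ^ j = k) \<longleftrightarrow> c i = k * M ^ j + r" for i
      proof
        assume "c i = k * M ^ j + r"
        then show "c i mod M ^ j = r \<and> c i div M ^ j = k"
          using r by (cases "M ^ j = 0") (auto simp del: power_eq_0_iff)
      next
        assume "c i mod M ^ j = r \<and> c i div M ^ j = k"
        then show "c i = k * M ^ j + r"
          using div_mult_mod_eq[of "c i" "M ^ j"] by metis
      qed
      then have eq: "{i. c i mod M ^ j = r} \<inter> {i. c i div M ^ j = k} = {i. c i = k * M ^ j + r}"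
        by auto
      have "k * M ^ j + r < Suc k * M ^ j" using r by simp
      also have "\<dots> \<le> M * M ^ j" using k by (intro mult_right_mono) auto
      finally have "k * M ^ j + r < M ^ Suc j" by simp
      from Suc.prems(3)[OF this]
      show "t \<le> N (restr {i. c i mod M ^ j = r} (restr {i. c i div M ^ j = k} x))"
        by (simp add: restr_restr eq)
    qed (use Suc.prems in auto)
  qed (use Suc.prems in auto)
  then show ?case by simp
qed

text \<open>With \<open>M ^ Suc j\<close> such pieces, \<open>j + 1\<close> doublings would raise the norm from \<open>2\<^sup>-\<^sup>j\<close> to \<open>2\<close>.\<close>

lemma count_pieces:
  fixes c :: "nat \<Rightarrow> nat"
  assumes x: "fin_supp x" "N x \<le> 1" and K: "finite K"
    and big: "\<And>k. k \<in> K \<Longrightarrow> (1/2) ^ j \<le> N (restr {i. c i = k} x)"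
  shows "card K < M ^ Suc j"
proof (rule ccontr)
  assume "\<not> ?thesis"
  then obtain K' where K': "K' \<subseteq> K" "card K' = M ^ Suc j"
    by (metis obtain_subset_with_card_n not_less)
  then have fin: "finite K'" using K finite_subset by blast
  then obtain h where h: "bij_betw h K' {..<M ^ Suc j}"
    using K' by (metis bij_betw_iff_card card_lessThan finite_lessThan)
  have "2 ^ Suc j * (1/2) ^ j \<le> N x"
  proof (rule many_pieces[where c = "\<lambda>i. if c i \<in> K' then h (c i) else M ^ Suc j"])
    fix k assume k: "k < M ^ Suc j"
    then obtain l where l: "l \<in> K'" "h l = k"
      using h by (metis bij_betw_imp_surj_on imageE lessThan_iff)
    have "(if c i \<in> K' then h (c i) else M ^ Suc j) = k \<longleftrightarrow> c i = l" for i
      using l h k by (auto simp: bij_betw_def inj_on_def)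
    then show "(1/2) ^ j \<le> N (restr {i. (if c i \<in> K' then h (c i) else M ^ Suc j) = k} x)"
      using big[of l] l K' by auto
  qed (use x in auto)
  also have "(2::real) ^ Suc j * (1/2) ^ j = 2" by (simp add: power_one_over)
  finally show False using x by simp
qed

text \<open>The pieces are sorted by size: those of norm between \<open>2\<^sup>-\<^sup>j\<^sup>-\<^sup>1\<close> and \<open>2\<^sup>-\<^sup>j\<close> number at most
\<open>M ^ (j + 2)\<close>, so that they contribute at most \<open>M\<^sup>2 * (M * 2\<^sup>-\<^sup>q)\<^sup>j\<close>.\<close>

lemma lower_q_estimate_normalised:
  fixes c :: "nat \<Rightarrow> nat"
  assumes x: "fin_supp x" "N x \<le> 1" and K: "finite K"
  shows "(\<Sum>k\<in>K. N (restr {i. c i = k} x) ^ q) \<le> C"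
proof -
  define a where "a k = N (restr {i. c i = k} x)" for k
  have a0: "0 \<le> a k" for k unfolding a_def using x by (intro nonneg) auto
  have a1: "a k \<le> 1" for k unfolding a_def using restr_le[OF x(1)] x(2) order_trans by blast
  define K' where "K' = {k \<in> K. a k > 0}"
  have finK': "finite K'" using K by (simp add: K'_def)
  \<comment> \<open>Each piece of positive norm gets the dyadic size class in which its norm lies.\<close>
  have "\<exists>j::nat. (1/2) ^ Suc j \<le> a k \<and> a k \<le> (1/2) ^ j" if "k \<in> K'" for k
  proof -
    have pos: "a k > 0" using that by (simp add: K'_def)
    obtain n where n: "(1/2::real) ^ n < a k"
      using real_arch_pow_inv[OF pos, of "1/2"] by auto
    define n0 where "n0 = (LEAST n. (1/2::real) ^ n \<le> a k)"
    have n0: "(1/2::real) ^ n0 \<le> a k" unfolding n0_def by (rule LeastI[of _ n]) (use n in simp)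
    show ?thesis
    proof (cases n0)
      case 0
      then have "a k = 1" using n0 a1[of k] by simp
      then show ?thesis by (intro exI[of _ 0]) auto
    next
      case (Suc j)
      then have "\<not> (1/2::real) ^ j \<le> a k"
        using not_less_Least[of j "\<lambda>n. (1/2::real) ^ n \<le> a k"] by (simp add: n0_def)
      then show ?thesis using n0 Suc by (intro exI[of _ j]) auto
    qed
  qed
  then obtain g :: "nat \<Rightarrow> nat" where g: "\<And>k. k \<in> K' \<Longrightarrow> (1/2) ^ Suc (g k) \<le> a k \<and> a k \<le> (1/2) ^ g k"
    by metis
  have "(\<Sum>k\<in>K. a k ^ q) = (\<Sum>k\<in>K'. a k ^ q)"
  proof (rule sum.mono_neutral_right)
    have "a k = 0" if "k \<in> K - K'" for k using that a0[of k] by (simp add: K'_def)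
    then show "\<forall>k\<in>K - K'. a k ^ q = 0" using q_pos by simp
  qed (auto simp: K'_def K)
  also have "\<dots> = (\<Sum>j\<in>g ` K'. \<Sum>k\<in>{k \<in> K'. g k = j}. a k ^ q)"
    by (rule sum.image_gen[OF finK'])
  also have "\<dots> \<le> (\<Sum>j\<in>g ` K'. (real M)\<^sup>2 * (1/2) ^ j)"
  proof (rule sum_mono)
    fix j assume "j \<in> g ` K'"
    have "card {k \<in> K'. g k = j} < M ^ Suc (Suc j)"
    proof (rule count_pieces[OF x])
      fix k assume "k \<in> {k \<in> K'. g k = j}"
      then show "(1/2) ^ Suc j \<le> N (restr {i. c i = k} x)" using g[of k] by (auto simp: a_def)
    qed (use finK' in auto)
    then have card: "real (card {k \<in> K'. g k = j}) \<le> real M ^ Suc (Suc j)"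
      by (metis less_imp_le of_nat_le_iff of_nat_power)
    have "(\<Sum>k\<in>{k \<in> K'. g k = j}. a k ^ q) \<le> (\<Sum>k\<in>{k \<in> K'. g k = j}. ((1/2) ^ j) ^ q)"
      using g a0 by (intro sum_mono power_mono) auto
    also have "\<dots> = real (card {k \<in> K'. g k = j}) * ((1/2) ^ j) ^ q" by simp
    also have "\<dots> \<le> real M ^ Suc (Suc j) * ((1/2) ^ j) ^ q"
      by (intro mult_right_mono card) auto
    also have "\<dots> = (real M)\<^sup>2 * (real M * (1/2) ^ q) ^ j"
      by (simp add: power_mult_distrib power2_eq_square power_mult[symmetric] mult.commute[of q j])
    also have "\<dots> \<le> (real M)\<^sup>2 * (1/2) ^ j"
    proof (intro mult_left_mono power_mono)
      have "real M \<le> 2 ^ M" using of_nat_less_two_power[of M, where 'a=real] by simp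
      then show "real M * (1/2) ^ q \<le> 1/2"
        by (simp add: q_def field_simps power_one_over)
    qed auto
    finally show "(\<Sum>k\<in>{k \<in> K'. g k = j}. a k ^ q) \<le> (real M)\<^sup>2 * (1/2) ^ j" .
  qed
  also have "\<dots> = (real M)\<^sup>2 * (\<Sum>j\<in>g ` K'. (1/2) ^ j)" by (simp add: sum_distrib_left)
  also have "\<dots> \<le> (real M)\<^sup>2 * (\<Sum>j. (1/2) ^ j)"
    by (intro mult_left_mono sum_le_suminf) (use finK' in auto)
  also have "(\<Sum>j. (1/2::real) ^ j) = 2" by (simp add: suminf_geometric)
  finally show ?thesis unfolding a_def C_def by (simp add: mult.commute)
qed

lemma lower_q_estimate:
  fixes c :: "nat \<Rightarrow> nat"
  assumes x: "fin_supp x" and K: "finite K"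
  shows "(\<Sum>k\<in>K. N (restr {i. c i = k} x) ^ q) \<le> C * N x ^ q"
proof (cases "N x = 0")
  case True
  have "N (restr A x) = 0" for A
    using restr_le[OF x, of A] nonneg[OF fin_supp_restr[OF x], of A] True by simp
  then show ?thesis using q_pos True by (simp add: zero_power)
next
  case False
  then have pos: "N x > 0" using nonneg[OF x] by simp
  define y where "y = (\<lambda>i. (1 / N x) * x i)"
  have y: "fin_supp y" unfolding y_def using x by (intro fin_supp_scale)
  have "N y \<le> 1" unfolding y_def by (subst scale[OF x]) (use pos in auto)
  note est = lower_q_estimate_normalised[OF y this K, of c]
  have eq: "N (restr A y) = N (restr A x) / N x" for A
  proof -
    have "restr A y = (\<lambda>i. (1 / N x) * restr A x i)" by (auto simp: restr_def y_def)
    then show ?thesis using scale[OF fin_supp_restr[OF x], of "1 / N x" A] pos by simp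
  qed
  have "(\<Sum>k\<in>K. N (restr {i. c i = k} x) ^ q) / N x ^ q \<le> C"
    using est by (simp add: eq power_divide sum_divide_distrib)
  then show ?thesis using pos by (simp add: divide_le_eq)
qed

text \<open>\<open>Psi\<close> is the smallest functional above \<open>\<lambda>x. N x ^ q\<close> that is superadditive on disjoint vectors.
It replaces an equivalent norm with lower \<open>q\<close>-estimate constant one.  Keeping the \<open>q\<close>-th power has
the advantage that its convexity is that of \<open>t \<mapsto> t\<^sup>q\<close>, with no appeal to the Minkowski inequality.\<close>

definition pieces :: "(nat \<Rightarrow> nat) \<Rightarrow> (nat \<Rightarrow> real) \<Rightarrow> real" where
  "pieces c x = (\<Sum>k\<in>c ` {i. x i \<noteq> 0}. N (restr {i. c i = k} x) ^ q)"

definition Psi :: "(nat \<Rightarrow> real) \<Rightarrow> real" where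
  "Psi x = (SUP c. pieces c x)"

lemma pieces_eq:
  assumes "fin_supp x" "finite K" "c ` {i. x i \<noteq> 0} \<subseteq> K"
  shows "pieces c x = (\<Sum>k\<in>K. N (restr {i. c i = k} x) ^ q)"
  unfolding pieces_def
proof (rule sum.mono_neutral_left)
  show "\<forall>k\<in>K - c ` {i. x i \<noteq> 0}. N (restr {i. c i = k} x) ^ q = 0"
  proof
    fix k assume "k \<in> K - c ` {i. x i \<noteq> 0}"
    then have "restr {i. c i = k} x = (\<lambda>i. 0)" by (auto simp: restr_def fun_eq_iff)
    then show "N (restr {i. c i = k} x) ^ q = 0" using q_pos by simp
  qed
qed (use assms in auto)

lemma pieces_le: "fin_supp x \<Longrightarrow> pieces c x \<le> C * N x ^ q"
  unfolding pieces_def by (rule lower_q_estimate) (auto simp: fin_supp_def)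

lemma bdd_pieces: "fin_supp x \<Longrightarrow> bdd_above (range (\<lambda>c. pieces c x))"
  by (rule bdd_aboveI[of _ "C * N x ^ q"]) (auto intro: pieces_le)

lemma pieces_le_Psi: "fin_supp x \<Longrightarrow> pieces c x \<le> Psi x"
  unfolding Psi_def by (intro cSUP_upper bdd_pieces) auto

lemma Psi_leI: "(\<And>c. pieces c x \<le> B) \<Longrightarrow> Psi x \<le> B"
  unfolding Psi_def by (rule cSUP_least) auto

lemma Psi_upper: "fin_supp x \<Longrightarrow> Psi x \<le> C * N x ^ q"
  by (intro Psi_leI pieces_le)

lemma sum_le_Psi:
  fixes c :: "nat \<Rightarrow> nat"
  assumes "fin_supp x" "finite K"
  shows "(\<Sum>k\<in>K. N (restr {i. c i = k} x) ^ q) \<le> Psi x"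
proof -
  have fin: "finite (K \<union> c ` {i. x i \<noteq> 0})" using assms by (auto simp: fin_supp_def)
  have "(\<Sum>k\<in>K. N (restr {i. c i = k} x) ^ q)
          \<le> (\<Sum>k\<in>K \<union> c ` {i. x i \<noteq> 0}. N (restr {i. c i = k} x) ^ q)"
    using fin assms by (intro sum_mono2) (auto intro!: zero_le_power nonneg fin_supp_restr)
  also have "\<dots> = pieces c x" using pieces_eq[OF assms(1) fin] by simp
  also have "\<dots> \<le> Psi x" by (rule pieces_le_Psi[OF assms(1)])
  finally show ?thesis .
qed

lemma Psi_lower: "fin_supp x \<Longrightarrow> N x ^ q \<le> Psi x"
  using sum_le_Psi[of x "{0}" "\<lambda>_. 0"] by (simp add: restr_def)

lemma Psi_nonneg: "fin_supp x \<Longrightarrow> 0 \<le> Psi x"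
  using Psi_lower[of x] by (metis nonneg order_trans zero_le_power)

lemma Psi_mono:
  assumes y: "fin_supp y" and le: "\<And>i. \<bar>x i\<bar> \<le> \<bar>y i\<bar>"
  shows "Psi x \<le> Psi y"
proof (rule Psi_leI)
  fix c
  have x: "fin_supp x" using y by (rule fin_supp_mono) (metis le abs_le_zero_iff abs_zero)
  have "pieces c x \<le> (\<Sum>k\<in>c ` {i. x i \<noteq> 0}. N (restr {i. c i = k} y) ^ q)"
    unfolding pieces_def using x y le
    by (intro sum_mono power_mono mono nonneg fin_supp_restr) (auto simp: restr_def)
  also have "\<dots> \<le> Psi y" by (rule sum_le_Psi[OF y]) (use x in \<open>auto simp: fin_supp_def\<close>)
  finally show "pieces c x \<le> Psi y" .
qed

lemma Psi_convex:
  assumes x: "fin_supp x" and y: "fin_supp y" and t: "0 \<le> t" "t \<le> 1"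
  shows "Psi (\<lambda>i. (1 - t) * x i + t * y i) \<le> (1 - t) * Psi x + t * Psi y"
proof (rule Psi_leI)
  fix c :: "nat \<Rightarrow> nat"
  let ?z = "\<lambda>i. (1 - t) * x i + t * y i"
  define K where "K = c ` ({i. x i \<noteq> 0} \<union> {i. y i \<noteq> 0})"
  have K: "finite K" using x y by (auto simp: K_def fin_supp_def)
  have z: "fin_supp ?z" using x y by auto
  have "pieces c ?z = (\<Sum>k\<in>K. N (restr {i. c i = k} ?z) ^ q)"
    by (rule pieces_eq[OF z K]) (auto simp: K_def)
  also have "\<dots> \<le> (\<Sum>k\<in>K. (1 - t) * N (restr {i. c i = k} x) ^ q + t * N (restr {i. c i = k} y) ^ q)"
  proof (rule sum_mono)
    fix k
    let ?A = "{i. c i = k}"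
    have "restr ?A ?z = (\<lambda>i. (1 - t) * restr ?A x i + t * restr ?A y i)"
      by (auto simp: restr_def)
    then have "N (restr ?A ?z) \<le> N (\<lambda>i. (1 - t) * restr ?A x i) + N (\<lambda>i. t * restr ?A y i)"
      using triangle[of "\<lambda>i. (1 - t) * restr ?A x i" "\<lambda>i. t * restr ?A y i"] x y by auto
    also have "\<dots> = (1 - t) * N (restr ?A x) + t * N (restr ?A y)"
      using x y t by (simp add: scale fin_supp_restr)
    finally have "N (restr ?A ?z) ^ q \<le> ((1 - t) * N (restr ?A x) + t * N (restr ?A y)) ^ q"
      using z by (intro power_mono nonneg fin_supp_restr)
    also have "\<dots> \<le> (1 - t) * N (restr ?A x) ^ q + t * N (restr ?A y) ^ q"
      using t x y by (intro power_convex nonneg fin_supp_restr)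
    finally show "N (restr ?A ?z) ^ q \<le> (1 - t) * N (restr ?A x) ^ q + t * N (restr ?A y) ^ q" .
  qed
  also have "\<dots> = (1 - t) * (\<Sum>k\<in>K. N (restr {i. c i = k} x) ^ q)
                    + t * (\<Sum>k\<in>K. N (restr {i. c i = k} y) ^ q)"
    by (simp add: sum.distrib sum_distrib_left)
  also have "\<dots> \<le> (1 - t) * Psi x + t * Psi y"
    using t x y K by (intro add_mono mult_left_mono sum_le_Psi) auto
  finally show "pieces c ?z \<le> (1 - t) * Psi x + t * Psi y" .
qed

lemma Psi_scale_le:
  assumes x: "fin_supp x"
  shows "Psi (\<lambda>i. a * x i) \<le> \<bar>a\<bar> ^ q * Psi x"
proof (rule Psi_leI)
  fix c
  have ax: "fin_supp (\<lambda>i. a * x i)" using x by auto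
  have "restr A (\<lambda>i. a * x i) = (\<lambda>i. a * restr A x i)" for A by (auto simp: restr_def)
  then have eq: "N (restr A (\<lambda>i. a * x i)) = \<bar>a\<bar> * N (restr A x)" for A
    using scale[OF fin_supp_restr[OF x]] by simp
  have "pieces c (\<lambda>i. a * x i)
          = \<bar>a\<bar> ^ q * (\<Sum>k\<in>c ` {i. a * x i \<noteq> 0}. N (restr {i. c i = k} x) ^ q)"
    unfolding pieces_def by (simp add: eq power_mult_distrib sum_distrib_left)
  also have "\<dots> \<le> \<bar>a\<bar> ^ q * Psi x"
    using ax x by (intro mult_left_mono sum_le_Psi) (auto simp: fin_supp_def)
  finally show "pieces c (\<lambda>i. a * x i) \<le> \<bar>a\<bar> ^ q * Psi x" .
qed

text \<open>Colourings of the two parts are combined to a colouring of \<open>x\<close> that uses even colours on \<open>A\<close> and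
odd colours off \<open>A\<close>.\<close>

lemma Psi_superadditive:
  assumes x: "fin_supp x"
  shows "Psi (restr A x) + Psi (restr (- A) x) \<le> Psi x"
proof -
  have *: "pieces c (restr A x) + pieces d (restr (- A) x) \<le> Psi x" for c d
  proof -
    let ?e = "\<lambda>i. if i \<in> A then 2 * c i else Suc (2 * d i)"
    define K where "K = c ` {i. restr A x i \<noteq> 0}"
    define L where "L = d ` {i. restr (- A) x i \<noteq> 0}"
    have fin: "finite K" "finite L"
      using fin_supp_restr[OF x] by (auto simp: K_def L_def fin_supp_def)
    have even: "restr {i. ?e i = 2 * k} x = restr {i. c i = k} (restr A x)" for k
      by (auto simp: restr_def fun_eq_iff) presburger+
    have odd: "restr {i. ?e i = Suc (2 * k)} x = restr {i. d i = k} (restr (- A) x)" for k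
      by (auto simp: restr_def fun_eq_iff) presburger+
    have "pieces c (restr A x) + pieces d (restr (- A) x)
       = (\<Sum>k\<in>K. N (restr {i. ?e i = 2 * k} x) ^ q) + (\<Sum>k\<in>L. N (restr {i. ?e i = Suc (2 * k)} x) ^ q)"
      unfolding pieces_def even odd K_def L_def ..
    also have "\<dots> = (\<Sum>k\<in>(\<lambda>k. 2 * k) ` K. N (restr {i. ?e i = k} x) ^ q)
                    + (\<Sum>k\<in>(\<lambda>k. Suc (2 * k)) ` L. N (restr {i. ?e i = k} x) ^ q)"
      by (subst (1 2) sum.reindex) (auto simp: inj_on_def)
    also have "\<dots> = (\<Sum>k\<in>(\<lambda>k. 2 * k) ` K \<union> (\<lambda>k. Suc (2 * k)) ` L. N (restr {i. ?e i = k} x) ^ q)"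
      using fin by (subst sum.union_disjoint) (auto, presburger)
    also have "\<dots> \<le> Psi x" using fin by (intro sum_le_Psi x) auto
    finally show ?thesis .
  qed
  have "Psi (restr A x) \<le> Psi x - pieces d (restr (- A) x)" for d
    by (rule Psi_leI) (use * in \<open>simp add: le_diff_eq\<close>)
  then have "Psi (restr (- A) x) \<le> Psi x - Psi (restr A x)"
    by (intro Psi_leI) (simp add: le_diff_eq add.commute)
  then show ?thesis by simp
qed

end

section \<open>From points of Hilbert space to probability measures\<close>

text \<open>As \<open>s\<close> runs from \<open>k\<close> to \<open>k + 1\<close>, the vector \<open>quarter s\<close> runs along a quarter of the unit circle
from the \<open>k\<close>-th to the \<open>(k + 1)\<close>-st unit vector of \<open>\<ell>\<^sub>2(\<int>)\<close>.  Its squares form a probability measure on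
two neighbouring integers, which moves smoothly with \<open>s\<close> in the Hellinger metric, is a point mass
for \<open>s = 0\<close>, and is disjoint from the one of \<open>t\<close> as soon as \<open>\<bar>s - t\<bar> \<ge> 2\<close>.\<close>

definition quarter :: "real \<Rightarrow> int \<Rightarrow> real" where
  "quarter s k = (if \<bar>s - of_int k\<bar> < 1 then cos (pi / 2 * (s - of_int k)) else 0)"

lemma quarter_nonneg: "0 \<le> quarter s k"
proof -
  have "0 \<le> cos (pi / 2 * (s - of_int k))" if "\<bar>s - of_int k\<bar> < 1"
  proof (rule cos_ge_zero)
    have "pi / 2 * \<bar>s - of_int k\<bar> \<le> pi / 2 * 1" using that by (intro mult_left_mono) auto
    then have "\<bar>pi / 2 * (s - of_int k)\<bar> \<le> pi / 2" by (simp add: abs_mult)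
    then show "- (pi / 2) \<le> pi / 2 * (s - of_int k)" "pi / 2 * (s - of_int k) \<le> pi / 2"
      by (simp_all only: abs_le_iff) linarith+
  qed
  then show ?thesis by (simp add: quarter_def)
qed

lemma quarter_0: "quarter 0 k = (if k = 0 then 1 else 0)"
proof -
  have "\<bar>real_of_int k\<bar> < 1 \<longleftrightarrow> k = 0" by linarith
  then show ?thesis by (simp add: quarter_def)
qed

lemma quarter_support: "quarter s k \<noteq> 0 \<Longrightarrow> k = \<lfloor>s\<rfloor> \<or> k = \<lfloor>s\<rfloor> + 1"
  unfolding quarter_def by (simp split: if_splits) linarith

lemma cos_lower: "1 - x\<^sup>2 / 2 \<le> cos (x::real)"
proof -
  have "cos x = 1 - 2 * (sin (x / 2))\<^sup>2"
    using cos_double_sin[of "x / 2"] by simp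
  moreover have "(sin (x / 2))\<^sup>2 \<le> (x / 2)\<^sup>2"
    by (rule abs_le_square_iff[THEN iffD1]) (rule abs_sin_x_le_abs_x)
  ultimately show ?thesis by (simp add: power2_eq_square)
qed

lemma cos_upper:
  fixes x :: real
  assumes "\<bar>x\<bar> \<le> 2"
  shows "cos x \<le> exp (- x\<^sup>2 / 4)"
proof -
  obtain t where t: "cos x = (\<Sum>m<4. cos_coeff m * x ^ m) + cos (t + 1/2 * real 4 * pi) / fact 4 * x ^ 4"
    using Maclaurin_cos_expansion[of x 4] by auto
  have "{..<4::nat} = {0, 1, 2, 3}" by auto
  then have "(\<Sum>m<4. cos_coeff m * x ^ m) = 1 - x\<^sup>2 / 2"
    by (simp add: cos_coeff_def)
  moreover have "cos (t + 1/2 * real 4 * pi) / fact 4 * x ^ 4 \<le> 1 / fact 4 * x ^ 4"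
    by (intro mult_right_mono divide_right_mono cos_le_one) auto
  moreover have "x ^ 4 \<le> 4 * x\<^sup>2"
  proof -
    have "x\<^sup>2 \<le> 2\<^sup>2" using assms by (intro abs_le_square_iff[THEN iffD1]) simp
    then have "x\<^sup>2 * x\<^sup>2 \<le> 4 * x\<^sup>2" by (intro mult_right_mono) auto
    then show ?thesis by (simp add: power2_eq_square eval_nat_numeral)
  qed
  ultimately have "cos x \<le> 1 - x\<^sup>2 / 4"
    using t by (simp add: fact_numeral) (use zero_le_power2[of x] in linarith)
  also have "\<dots> \<le> exp (- x\<^sup>2 / 4)"
    using exp_ge_add_one_self[of "- x\<^sup>2 / 4"] by simp
  finally show ?thesis .
qed

text \<open>The inner product of \<open>quarter s\<close> and \<open>quarter t\<close>, that is, the Hellinger affinity of the two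
measures on \<open>\<int>\<close>; the two indices suffice because \<open>quarter s\<close> vanishes elsewhere.\<close>

definition affinity :: "real \<Rightarrow> real \<Rightarrow> real" where
  "affinity s t = (\<Sum>k\<in>{\<lfloor>s\<rfloor>, \<lfloor>s\<rfloor> + 1}. quarter s k * quarter t k)"

lemma affinity_eq_sum:
  assumes "finite B" "\<lfloor>s\<rfloor> \<in> B" "\<lfloor>s\<rfloor> + 1 \<in> B"
  shows "(\<Sum>k\<in>B. quarter s k * quarter t k) = affinity s t"
  unfolding affinity_def using assms quarter_support[of s]
  by (intro sum.mono_neutral_right) auto

lemma affinity_commute: "affinity s t = affinity t s"
proof -
  let ?B = "{\<lfloor>s\<rfloor>, \<lfloor>s\<rfloor> + 1, \<lfloor>t\<rfloor>, \<lfloor>t\<rfloor> + 1}"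
  have "affinity s t = (\<Sum>k\<in>?B. quarter s k * quarter t k)"
    by (rule affinity_eq_sum[symmetric]) auto
  also have "\<dots> = (\<Sum>k\<in>?B. quarter t k * quarter s k)" by (simp add: mult.commute)
  also have "\<dots> = affinity t s" by (rule affinity_eq_sum) auto
  finally show ?thesis .
qed

text \<open>The cases are that \<open>s\<close> and \<open>t\<close> lie in the same interval between consecutive integers, that they
lie in adjacent intervals with common endpoint \<open>k\<close> (then \<open>u = s - k\<close> and \<open>v = t - k\<close>), and that
they lie further apart.\<close>

lemma affinity_cases:
  assumes "s \<le> t"
  obtains "\<bar>s - t\<bar> < 1" "affinity s t = cos (pi / 2 * (s - t))"
  | u v where "-1 \<le> u" "u \<le> 0" "0 \<le> v" "v \<le> 1" "t - s = v - u"
      "affinity s t = cos (pi / 2 * u) * cos (pi / 2 * v)"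
  | "1 \<le> t - s" "affinity s t = 0"
proof -
  define k where "k = \<lfloor>s\<rfloor>"
  have k: "of_int k \<le> s" "s < of_int k + 1" by (simp_all add: k_def)
  have aff: "affinity s t = quarter s k * quarter t k + quarter s (k + 1) * quarter t (k + 1)"
    by (simp add: affinity_def k_def)
  have qs: "quarter s k = cos (pi / 2 * (s - of_int k))"
    using k by (simp add: quarter_def)
  have shift: "cos (pi / 2 * (r - of_int (k + 1))) = sin (pi / 2 * (r - of_int k))" for r
  proof -
    have "pi / 2 * (r - of_int (k + 1)) = pi / 2 * (r - of_int k) - pi / 2"
      by (simp add: algebra_simps)
    then show ?thesis by (simp only: cos_diff cos_pi_half sin_pi_half mult_zero_right mult_1_right add_0_left)
  qed
  have qs1: "quarter s (k + 1) = cos (pi / 2 * (s - of_int (k + 1)))"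
  proof (cases "s = of_int k")
    case True
    then show ?thesis using shift[of s] by (simp add: quarter_def)
  next
    case False
    then show ?thesis using k by (simp add: quarter_def)
  qed
  consider "t < of_int k + 1" | "of_int k + 1 \<le> t" "t < of_int k + 2" | "of_int k + 2 \<le> t"
    by linarith
  then show thesis
  proof cases
    case 1
    have qt: "quarter t k = cos (pi / 2 * (t - of_int k))"
      using k assms 1 by (simp add: quarter_def)
    have qt1: "quarter t (k + 1) = cos (pi / 2 * (t - of_int (k + 1)))"
    proof (cases "t = of_int k")
      case True
      then show ?thesis using shift[of t] by (simp add: quarter_def)
    next
      case False
      then show ?thesis using k assms 1 by (simp add: quarter_def)
    qed
    have "affinity s t = cos (pi / 2 * (s - of_int k) - pi / 2 * (t - of_int k))"
      unfolding aff qs qt qs1 qt1 shift cos_diff ..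
    also have "pi / 2 * (s - of_int k) - pi / 2 * (t - of_int k) = pi / 2 * (s - t)"
      unfolding right_diff_distrib[symmetric] by simp
    finally show ?thesis using that(1) 1 assms k by simp
  next
    case 2
    have "quarter t k = 0" using 2 by (simp add: quarter_def)
    moreover have "quarter t (k + 1) = cos (pi / 2 * (t - of_int (k + 1)))"
      using 2 by (simp add: quarter_def)
    ultimately have "affinity s t = cos (pi / 2 * (s - of_int (k + 1))) * cos (pi / 2 * (t - of_int (k + 1)))"
      unfolding aff qs1 by simp
    then show ?thesis using k 2 by (intro that(2)[of "s - of_int (k + 1)" "t - of_int (k + 1)"]) auto
  next
    case 3
    then have "quarter t k = 0" "quarter t (k + 1) = 0" by (simp_all add: quarter_def)
    then show ?thesis using aff 3 k by (intro that(3)) auto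
  qed
qed

text \<open>In the first two cases the affinity is at least the cosine of \<open>\<pi> / 2\<close> times the distance; in the
third one the distance is at least \<open>1\<close>, so that the lower bound is negative.\<close>

lemma affinity_lower_aux:
  assumes "s \<le> t"
  shows "1 - 2 * (s - t)\<^sup>2 \<le> affinity s t"
proof -
  have pi: "pi\<^sup>2 \<le> 16"
    using power_mono[of pi 4 2] pi_less_4 by simp
  have cosb: "1 - 2 * d\<^sup>2 \<le> cos (pi / 2 * d)" for d
  proof -
    have "1 - (pi / 2 * d)\<^sup>2 / 2 \<le> cos (pi / 2 * d)" by (rule cos_lower)
    moreover have "(pi / 2 * d)\<^sup>2 / 2 \<le> 2 * d\<^sup>2"
      using mult_right_mono[OF pi, of "d\<^sup>2"] by (simp add: power_mult_distrib power_divide)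
    ultimately show ?thesis by linarith
  qed
  from assms show ?thesis
  proof (cases rule: affinity_cases)
    case 1
    then show ?thesis using cosb[of "s - t"] by simp
  next
    case (2 u v)
    have "0 \<le> sin (pi / 2 * (- u)) * sin (pi / 2 * v)"
    proof (intro mult_nonneg_nonneg sin_ge_zero)
      have "pi / 2 * (- u) \<le> pi / 2 * 1" "pi / 2 * v \<le> pi / 2 * 1"
        using 2 by (intro mult_left_mono; simp)+
      then show "pi / 2 * (- u) \<le> pi" "pi / 2 * v \<le> pi" using pi_ge_zero by linarith+
    qed (use 2 in \<open>auto simp: mult_nonneg_nonpos\<close>)
    then have "cos (pi / 2 * v - pi / 2 * u) \<le> affinity s t"
      unfolding 2 cos_diff by (simp add: mult.commute)
    moreover have "pi / 2 * v - pi / 2 * u = pi / 2 * (t - s)"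
      using 2 by (simp add: right_diff_distrib)
    ultimately have "cos (pi / 2 * (t - s)) \<le> affinity s t" by metis
    then show ?thesis using cosb[of "t - s"] by (metis order_trans power2_commute)
  next
    case 3
    have "1\<^sup>2 \<le> (t - s)\<^sup>2" using 3 by (intro power_mono) auto
    then show ?thesis using 3 by (simp add: power2_commute)
  qed
qed

lemma affinity_lower: "1 - 2 * (s - t)\<^sup>2 \<le> affinity s t"
  using affinity_lower_aux[of s t] affinity_lower_aux[of t s] affinity_commute[of s t]
  by (metis linear power2_commute)

text \<open>The Gaussian shape of the bound matters: multiplied over all coordinates, it gives a function of
the \<open>\<ell>\<^sub>2\<close> distance alone.\<close>

lemma affinity_upper_aux:
  assumes "s \<le> t"
  shows "affinity s t \<le> exp (- (s - t)\<^sup>2 / 8)"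
proof -
  have pi4: "4 \<le> pi\<^sup>2" using power_mono[of 2 pi 2] pi_ge_two by simp
  have cosb: "cos (pi / 2 * d) \<le> exp (- d\<^sup>2 / 4)" if "\<bar>d\<bar> \<le> 1" for d
  proof -
    have "\<bar>pi / 2 * d\<bar> \<le> pi / 2 * 1"
      unfolding abs_mult using that by (intro mult_mono) auto
    then have "\<bar>pi / 2 * d\<bar> \<le> 2" using pi_less_4 by linarith
    then have "cos (pi / 2 * d) \<le> exp (- (pi / 2 * d)\<^sup>2 / 4)" by (rule cos_upper)
    also have "\<dots> \<le> exp (- d\<^sup>2 / 4)"
      using mult_right_mono[OF pi4, of "d\<^sup>2"] by (simp add: power_mult_distrib power_divide)
    finally show ?thesis .
  qed
  from assms show ?thesis
  proof (cases rule: affinity_cases)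
    case 1
    have "affinity s t \<le> exp (- (s - t)\<^sup>2 / 4)" using 1 cosb[of "s - t"] by simp
    also have "\<dots> \<le> exp (- (s - t)\<^sup>2 / 8)" by simp
    finally show ?thesis .
  next
    case (2 u v)
    have "0 \<le> cos (pi / 2 * v)"
    proof (rule cos_ge_zero)
      have "0 \<le> pi / 2 * v" "pi / 2 * v \<le> pi / 2 * 1"
        using 2 by (auto intro!: mult_nonneg_nonneg mult_left_mono)
      then show "- (pi / 2) \<le> pi / 2 * v" "pi / 2 * v \<le> pi / 2" using pi_ge_zero by linarith+
    qed
    then have "affinity s t \<le> exp (- u\<^sup>2 / 4) * exp (- v\<^sup>2 / 4)"
      unfolding 2 using 2 by (intro mult_mono cosb) auto
    also have "\<dots> = exp (- (u\<^sup>2 + v\<^sup>2) / 4)" by (simp add: exp_add[symmetric] field_simps)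
    also have "\<dots> \<le> exp (- (s - t)\<^sup>2 / 8)"
    proof -
      have eq: "s - t = u - v" using 2 by simp
      have "(s - t)\<^sup>2 + (u + v)\<^sup>2 = 2 * (u\<^sup>2 + v\<^sup>2)"
        unfolding eq by (simp add: power2_eq_square algebra_simps)
      moreover have "0 \<le> (u + v)\<^sup>2" by simp
      ultimately have "(s - t)\<^sup>2 / 8 \<le> (u\<^sup>2 + v\<^sup>2) / 4" by linarith
      then show ?thesis by simp
    qed
    finally show ?thesis .
  next
    case 3
    then show ?thesis by simp
  qed
qed

lemma affinity_upper: "affinity s t \<le> exp (- (s - t)\<^sup>2 / 8)"
  using affinity_upper_aux[of s t] affinity_upper_aux[of t s] affinity_commute[of s t]
  by (metis linear power2_commute)

lemma affinity_nonneg: "0 \<le> affinity s t"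
  unfolding affinity_def by (intro sum_nonneg mult_nonneg_nonneg quarter_nonneg)

lemma affinity_self: "affinity s s = 1"
proof (rule antisym)
  show "affinity s s \<le> 1" using affinity_upper[of s s] by simp
  show "1 \<le> affinity s s" using affinity_lower[of s s] by simp
qed

text \<open>The index set of the product measures.  Only finitely supported sequences of integers carry mass
because almost all coordinates of a finitely supported \<open>x\<close> are \<open>0\<close>, where the factor is the point
mass at \<open>0\<close>.\<close>

definition words :: "(nat \<Rightarrow> int) set" where
  "words = {m. finite {i. m i \<noteq> 0}}"

text \<open>The square root of the density of a product measure.  All factors outside the two supports equal
\<open>1\<close>; leaving them out makes the value independent of the dimension in which \<open>x\<close> is regarded to lie.\<close>

definition amp :: "(nat \<Rightarrow> real) \<Rightarrow> (nat \<Rightarrow> int) \<Rightarrow> real" where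
  "amp x m = (\<Prod>i | x i \<noteq> 0 \<or> m i \<noteq> 0. quarter (x i) (m i))"

definition short_words :: "nat \<Rightarrow> int set \<Rightarrow> (nat \<Rightarrow> int) set" where
  "short_words d B = {m. (\<forall>i<d. m i \<in> B) \<and> (\<forall>i\<ge>d. m i = 0)}"

lemma bij_short_words:
  "bij_betw (\<lambda>g i. if i < d then g i else 0) (Pi\<^sub>E {..<d} (\<lambda>_. B)) (short_words d B)"
  by (rule bij_betwI[where g = "\<lambda>m. restrict m {..<d}"])
    (auto simp: short_words_def fun_eq_iff restrict_def PiE_def extensional_def)

lemma finite_short_words: "finite B \<Longrightarrow> finite (short_words d B)"
  using bij_betw_finite[OF bij_short_words[of d B]] by (simp add: finite_PiE)

lemma short_words_subset: "short_words d B \<subseteq> words"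
proof
  fix m assume "m \<in> short_words d B"
  then have "{i. m i \<noteq> 0} \<subseteq> {..<d}"
    by (metis (mono_tags, lifting) lessThan_iff mem_Collect_eq not_less short_words_def subsetI)
  then show "m \<in> words" by (auto simp: words_def intro: finite_subset)
qed

lemma sum_short_words:
  fixes f :: "nat \<Rightarrow> int \<Rightarrow> real"
  assumes "finite B"
  shows "(\<Sum>m\<in>short_words d B. \<Prod>i<d. f i (m i)) = (\<Prod>i<d. \<Sum>k\<in>B. f i k)"
proof -
  have "(\<Sum>m\<in>short_words d B. \<Prod>i<d. f i (m i))
          = (\<Sum>g\<in>Pi\<^sub>E {..<d} (\<lambda>_. B). \<Prod>i<d. f i (if i < d then g i else 0))"
    by (rule sum.reindex_bij_betw[OF bij_short_words, symmetric])
  also have "\<dots> = (\<Sum>g\<in>Pi\<^sub>E {..<d} (\<lambda>_. B). \<Prod>i<d. f i (g i))"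
    by (intro sum.cong prod.cong) auto
  also have "\<dots> = (\<Prod>i<d. \<Sum>k\<in>B. f i k)"
    using assms by (intro prod_sum_PiE[symmetric]) auto
  finally show ?thesis .
qed

lemma countable_words: "countable words"
proof (rule countable_subset)
  show "words \<subseteq> range (\<lambda>(l :: int list) i. if i < length l then l ! i else 0)"
  proof
    fix m assume "m \<in> words"
    then obtain d where d: "\<And>i. m i \<noteq> 0 \<Longrightarrow> i < d"
      unfolding words_def using finite_nat_iff_bounded by auto
    then have "m = (\<lambda>i. if i < length (map m [0..<d]) then map m [0..<d] ! i else 0)"
      by (fastforce simp: fun_eq_iff)
    then show "m \<in> range (\<lambda>(l :: int list) i. if i < length l then l ! i else 0)" by blast
  qed
qed auto

lemma infinite_words: "infinite words"
proof
  assume "finite words"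
  moreover have "range (\<lambda>k i. if i = 0 then k else 0 :: int) \<subseteq> words"
  proof clarify
    fix k :: int
    show "(\<lambda>i. if i = 0 then k else 0) \<in> words"
      unfolding words_def by (auto intro: finite_subset[of _ "{0}"])
  qed
  ultimately have "finite (range (\<lambda>k i. if i = (0::nat) then k else 0 :: int))"
    by (rule rev_finite_subset)
  then have "finite (UNIV :: int set)"
    by (rule finite_imageD) (auto simp: inj_def fun_eq_iff)
  then show False by simp
qed

lemma amp_nonneg: "0 \<le> amp x m"
  unfolding amp_def by (intro prod_nonneg ballI quarter_nonneg)

lemma amp_eq_prod:
  assumes "\<And>i. d \<le> i \<Longrightarrow> x i = 0" "\<And>i. d \<le> i \<Longrightarrow> m i = 0"
  shows "amp x m = (\<Prod>i<d. quarter (x i) (m i))"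
proof -
  have "{i. x i \<noteq> 0 \<or> m i \<noteq> 0} \<subseteq> {..<d}" using assms not_less by blast
  then show ?thesis unfolding amp_def
    by (intro prod.mono_neutral_left) (auto simp: quarter_0)
qed

lemma amp_support:
  assumes x: "\<And>i. d \<le> i \<Longrightarrow> x i = 0" and m: "m \<in> words" and nz: "amp x m \<noteq> 0"
    and B: "0 \<in> B" "\<And>i. i < d \<Longrightarrow> \<lfloor>x i\<rfloor> \<in> B \<and> \<lfloor>x i\<rfloor> + 1 \<in> B"
  shows "m \<in> short_words d B"
proof -
  have "{i. x i \<noteq> 0 \<or> m i \<noteq> 0} \<subseteq> {..<d} \<union> {i. m i \<noteq> 0}"
    using x not_less by blast
  then have fin: "finite {i. x i \<noteq> 0 \<or> m i \<noteq> 0}"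
    using m by (auto simp: words_def intro: finite_subset)
  have quarter: "quarter (x i) (m i) \<noteq> 0" if "x i \<noteq> 0 \<or> m i \<noteq> 0" for i
    using nz that fin unfolding amp_def by (auto simp: prod_zero_iff)
  have "m i = 0" if "d \<le> i" for i
    using quarter[of i] x[OF that] by (auto simp: quarter_0)
  moreover have "m i \<in> B" if "i < d" for i
    using quarter[of i] quarter_support[of "x i" "m i"] B that by fastforce
  ultimately show ?thesis by (simp add: short_words_def)
qed


text \<open>The affinity of two product measures is the product of the affinities of their factors.  The
one-dimensional bounds \<open>1 - 2 * d\<^sup>2\<close> and \<open>exp (- d\<^sup>2 / 8)\<close> multiply, the former by the Weierstrass
product inequality, to bounds that depend only on the sum of the squares \<open>d\<^sup>2\<close>.\<close>

lemma amp_affinity: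
  assumes x: "fin_supp x" and y: "fin_supp y"
  obtains V where "finite V" "V \<subseteq> words" "\<And>m. m \<in> words - V \<Longrightarrow> amp x m = 0 \<and> amp y m = 0"
    "(\<Sum>m\<in>V. (amp x m)\<^sup>2) = 1" "(\<Sum>m\<in>V. (amp y m)\<^sup>2) = 1"
    "1 - 2 * (\<Sum>i | x i \<noteq> 0 \<or> y i \<noteq> 0. (x i - y i)\<^sup>2) \<le> (\<Sum>m\<in>V. amp x m * amp y m)"
    "(\<Sum>m\<in>V. amp x m * amp y m) \<le> exp (- (\<Sum>i | x i \<noteq> 0 \<or> y i \<noteq> 0. (x i - y i)\<^sup>2) / 8)"
proof -
  define S where "S = {i. x i \<noteq> 0 \<or> y i \<noteq> 0}"
  have "finite S"
    unfolding S_def using x y by (rule finite_union_supp)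
  then obtain d where d: "S \<subseteq> {..<d}" using finite_nat_bounded by blast
  have zero: "x i = 0" "y i = 0" if "d \<le> i" for i
    using d that by (auto simp: S_def)
  define D where "D = (\<Sum>i<d. (x i - y i)\<^sup>2)"
  have D: "D = (\<Sum>i | x i \<noteq> 0 \<or> y i \<noteq> 0. (x i - y i)\<^sup>2)"
    unfolding D_def using d by (intro sum.mono_neutral_right) (auto simp: S_def)
  define B where "B = insert 0 (\<Union>i<d. {\<lfloor>x i\<rfloor>, \<lfloor>x i\<rfloor> + 1, \<lfloor>y i\<rfloor>, \<lfloor>y i\<rfloor> + 1})"
  have B: "finite B" by (simp add: B_def)
  have Bx: "\<lfloor>x i\<rfloor> \<in> B \<and> \<lfloor>x i\<rfloor> + 1 \<in> B" and By: "\<lfloor>y i\<rfloor> \<in> B \<and> \<lfloor>y i\<rfloor> + 1 \<in> B" if "i < d" for i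
    using that unfolding B_def by blast+
  define V where "V = short_words d B"
  have prod: "(\<Sum>m\<in>V. amp u m * amp v m) = (\<Prod>i<d. affinity (u i) (v i))"
    if "\<And>i. d \<le> i \<Longrightarrow> u i = 0" "\<And>i. d \<le> i \<Longrightarrow> v i = 0"
      "\<And>i. i < d \<Longrightarrow> \<lfloor>u i\<rfloor> \<in> B \<and> \<lfloor>u i\<rfloor> + 1 \<in> B" for u v
  proof -
    have "(\<Sum>m\<in>V. amp u m * amp v m)
            = (\<Sum>m\<in>V. \<Prod>i<d. quarter (u i) (m i) * quarter (v i) (m i))"
    proof (rule sum.cong[OF refl])
      fix m assume "m \<in> V"
      then have "amp u m = (\<Prod>i<d. quarter (u i) (m i))" "amp v m = (\<Prod>i<d. quarter (v i) (m i))"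
        using that by (auto intro!: amp_eq_prod simp: V_def short_words_def)
      then show "amp u m * amp v m = (\<Prod>i<d. quarter (u i) (m i) * quarter (v i) (m i))"
        by (simp add: prod.distrib)
    qed
    also have "\<dots> = (\<Prod>i<d. \<Sum>k\<in>B. quarter (u i) k * quarter (v i) k)"
      unfolding V_def by (rule sum_short_words[OF B])
    also have "\<dots> = (\<Prod>i<d. affinity (u i) (v i))"
      using that B by (intro prod.cong refl affinity_eq_sum) auto
    finally show ?thesis .
  qed
  have aff: "(\<Sum>m\<in>V. amp x m * amp y m) = (\<Prod>i<d. affinity (x i) (y i))"
    using zero Bx by (intro prod) auto
  show thesis
  proof (rule that[of V, folded D])
    show "finite V" "V \<subseteq> words"
      using finite_short_words[OF B] short_words_subset by (auto simp: V_def)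
    show "amp x m = 0 \<and> amp y m = 0" if "m \<in> words - V" for m
      using that amp_support[of d x m B] amp_support[of d y m B] zero Bx By
      by (auto simp: V_def B_def)
    show "(\<Sum>m\<in>V. (amp x m)\<^sup>2) = 1" "(\<Sum>m\<in>V. (amp y m)\<^sup>2) = 1"
      using prod[of x x] prod[of y y] zero Bx By by (simp_all add: power2_eq_square affinity_self)
    have le1: "affinity s t \<le> 1" for s t
      by (rule order_trans[OF affinity_upper]) simp
    have "1 - 2 * D \<le> 1 - (\<Sum>i<d. 1 - affinity (x i) (y i))"
      unfolding D_def sum_distrib_left using affinity_lower by (intro diff_left_mono sum_mono) (simp add: algebra_simps)
    also have "\<dots> \<le> (\<Prod>i<d. 1 - (1 - affinity (x i) (y i)))"
      by (rule Weierstrass_prod_ineq) (use le1 affinity_nonneg in auto)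
    finally show "1 - 2 * D \<le> (\<Sum>m\<in>V. amp x m * amp y m)" by (simp add: aff)
    have "(\<Prod>i<d. affinity (x i) (y i)) \<le> (\<Prod>i<d. exp (- (x i - y i)\<^sup>2 / 8))"
      by (intro prod_mono conjI affinity_nonneg affinity_upper)
    also have "\<dots> = exp (- D / 8)"
      by (simp add: D_def exp_sum[symmetric] sum_negf sum_divide_distrib)
    finally show "(\<Sum>m\<in>V. amp x m * amp y m) \<le> exp (- D / 8)" by (simp add: aff)
  qed
qed

text \<open>The first bound is the Cauchy-Schwarz inequality for \<open>\<bar>a\<^sup>2 - b\<^sup>2\<bar> = \<bar>a - b\<bar> * \<bar>a + b\<bar>\<close>, the second
one holds because the minimum of two numbers is at most their geometric mean.\<close>

lemma hellinger_bounds: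
  fixes a b :: "'i \<Rightarrow> real"
  assumes a: "\<And>i. 0 \<le> a i" "(\<Sum>i\<in>V. (a i)\<^sup>2) = 1" and b: "\<And>i. 0 \<le> b i" "(\<Sum>i\<in>V. (b i)\<^sup>2) = 1"
  shows "(\<Sum>i\<in>V. \<bar>(a i)\<^sup>2 - (b i)\<^sup>2\<bar>) \<le> 2 * sqrt (2 * (1 - (\<Sum>i\<in>V. a i * b i)))"
    and "(\<Sum>i\<in>V. min ((a i)\<^sup>2) ((b i)\<^sup>2)) \<le> (\<Sum>i\<in>V. a i * b i)"
proof -
  define s where "s = (\<Sum>i\<in>V. a i * b i)"
  have minus: "(\<Sum>i\<in>V. (a i - b i)\<^sup>2) = 2 * (1 - s)" and plus: "(\<Sum>i\<in>V. (a i + b i)\<^sup>2) = 2 * (1 + s)"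
    using a(2) b(2)
    by (simp_all add: power2_diff power2_sum sum.distrib sum_subtractf s_def sum_distrib_left mult.assoc algebra_simps)
  have "0 \<le> 2 * (1 - s)" unfolding minus[symmetric] by (intro sum_nonneg) auto
  then have s1: "2 * (1 + s) \<le> 2\<^sup>2" by (simp add: power2_eq_square)
  have "(\<Sum>i\<in>V. \<bar>(a i)\<^sup>2 - (b i)\<^sup>2\<bar>) = (\<Sum>i\<in>V. \<bar>a i - b i\<bar> * \<bar>a i + b i\<bar>)"
    by (intro sum.cong refl) (simp add: abs_mult[symmetric] power2_eq_square algebra_simps)
  also have "\<dots> \<le> L2_set (\<lambda>i. a i - b i) V * L2_set (\<lambda>i. a i + b i) V"
    by (rule L2_set_mult_ineq)
  also have "\<dots> = sqrt (2 * (1 - s)) * sqrt (2 * (1 + s))"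
    by (simp only: L2_set_def minus plus)
  also have "\<dots> \<le> sqrt (2 * (1 - s)) * 2"
    using s1 \<open>0 \<le> 2 * (1 - s)\<close> by (intro mult_left_mono real_le_lsqrt) auto
  finally show "(\<Sum>i\<in>V. \<bar>(a i)\<^sup>2 - (b i)\<^sup>2\<bar>) \<le> 2 * sqrt (2 * (1 - s))" by simp
  show "(\<Sum>i\<in>V. min ((a i)\<^sup>2) ((b i)\<^sup>2)) \<le> s"
    unfolding s_def
  proof (rule sum_mono)
    fix i
    show "min ((a i)\<^sup>2) ((b i)\<^sup>2) \<le> a i * b i"
      using a(1)[of i] b(1)[of i] mult_left_mono[of "a i" "b i" "a i"] mult_right_mono[of "b i" "a i" "b i"]
      by (cases "a i \<le> b i") (auto simp: power2_eq_square min_le_iff_disj)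
  qed
qed

text \<open>The product measure of \<open>x\<close>, transported to the \<open>l\<close>-th of infinitely many disjoint infinite
subsets of \<open>\<nat>\<close>, namely the set of all codes of pairs with first component \<open>l\<close>.\<close>

definition block_measure :: "nat \<Rightarrow> (nat \<Rightarrow> real) \<Rightarrow> nat \<Rightarrow> real" where
  "block_measure l x n = (if fst (prod_decode n) = l then (amp x (from_nat_into words (snd (prod_decode n))))\<^sup>2 else 0)"

lemma block_measure_bounds:
  assumes x: "fin_supp x" and y: "fin_supp y"
  defines "D \<equiv> (\<Sum>i | x i \<noteq> 0 \<or> y i \<noteq> 0. (x i - y i)\<^sup>2)"
  obtains J where "finite J" "\<And>n. n \<notin> J \<Longrightarrow> block_measure l x n = 0 \<and> block_measure l y n = 0"
    "(\<Sum>n\<in>J. block_measure l x n) = 1" "(\<Sum>n\<in>J. block_measure l y n) = 1"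
    "(\<Sum>n\<in>J. \<bar>block_measure l x n - block_measure l y n\<bar>) \<le> 4 * sqrt D"
    "(\<Sum>n\<in>J. min (block_measure l x n) (block_measure l y n)) \<le> exp (- D / 8)"
proof -
  obtain V where V: "finite V" "V \<subseteq> words" "\<And>m. m \<in> words - V \<Longrightarrow> amp x m = 0 \<and> amp y m = 0"
    "(\<Sum>m\<in>V. (amp x m)\<^sup>2) = 1" "(\<Sum>m\<in>V. (amp y m)\<^sup>2) = 1"
    "1 - 2 * D \<le> (\<Sum>m\<in>V. amp x m * amp y m)"
    "(\<Sum>m\<in>V. amp x m * amp y m) \<le> exp (- D / 8)"
    by (rule amp_affinity[OF x y, folded D_def]) (rule that)
  define cd where "cd m = prod_encode (l, to_nat_on words m)" for m
  have word: "from_nat_into words (snd (prod_decode (cd m))) = m" if "m \<in> V" for m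
    using that V(2) countable_words by (auto simp: cd_def)
  have inj: "inj_on cd V" by (rule inj_on_inverseI) (rule word)
  have g: "block_measure l z (cd m) = (amp z m)\<^sup>2" if "m \<in> V" for z m
    using word[OF that] by (simp add: block_measure_def) (simp add: cd_def)
  have sum: "(\<Sum>n\<in>cd ` V. f (block_measure l x n) (block_measure l y n)) = (\<Sum>m\<in>V. f ((amp x m)\<^sup>2) ((amp y m)\<^sup>2))"
    for f :: "real \<Rightarrow> real \<Rightarrow> real"
    by (simp add: sum.reindex[OF inj] g)
  note hell = hellinger_bounds[OF amp_nonneg V(4) amp_nonneg V(5)]
  show thesis
  proof (rule that[of "cd ` V"])
    show "finite (cd ` V)" using V(1) by simp
    show "block_measure l x n = 0 \<and> block_measure l y n = 0" if "n \<notin> cd ` V" for n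
    proof (cases "fst (prod_decode n) = l")
      case True
      let ?m = "from_nat_into words (snd (prod_decode n))"
      have "cd ?m = n"
        using True countable_words infinite_words
        by (metis cd_def prod.collapse prod_decode_inverse to_nat_on_from_nat_into_infinite)
      then have "?m \<in> words - V"
        using that from_nat_into[of words] infinite_words by (metis Diff_iff finite.emptyI imageI)
      then show ?thesis using V(3) by (simp add: block_measure_def)
    qed (simp add: block_measure_def)
    show "(\<Sum>n\<in>cd ` V. block_measure l x n) = 1" "(\<Sum>n\<in>cd ` V. block_measure l y n) = 1"
      using sum[of "\<lambda>a b. a"] sum[of "\<lambda>a b. b"] V by simp_all
    have "(\<Sum>n\<in>cd ` V. \<bar>block_measure l x n - block_measure l y n\<bar>) \<le> 2 * sqrt (2 * (1 - (\<Sum>m\<in>V. amp x m * amp y m)))"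
      using sum[of "\<lambda>a b. \<bar>a - b\<bar>"] hell(1) by simp
    also have "\<dots> \<le> 2 * sqrt (2\<^sup>2 * D)"
      using V(6) by (intro mult_left_mono real_sqrt_le_mono) (auto simp: power2_eq_square)
    also have "\<dots> = 4 * sqrt D" by (simp add: real_sqrt_mult)
    finally show "(\<Sum>n\<in>cd ` V. \<bar>block_measure l x n - block_measure l y n\<bar>) \<le> 4 * sqrt D" .
    show "(\<Sum>n\<in>cd ` V. min (block_measure l x n) (block_measure l y n)) \<le> exp (- D / 8)"
      using sum[of min] hell(2) V(7) by simp
  qed
qed

lemma ell2_dist_fin_supp:
  assumes "fin_supp x" "fin_supp y"
  shows "ell2_dist x y = sqrt (\<Sum>i | x i \<noteq> 0 \<or> y i \<noteq> 0. (x i - y i)\<^sup>2)"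
proof -
  have fin: "finite {i. x i \<noteq> 0 \<or> y i \<noteq> 0}"
    using assms by (rule finite_union_supp)
  have "(\<Sum>\<^sub>\<infinity>i. (x i - y i)\<^sup>2) = (\<Sum>\<^sub>\<infinity>i\<in>{i. x i \<noteq> 0 \<or> y i \<noteq> 0}. (x i - y i)\<^sup>2)"
    by (rule infsum_cong_neutral) auto
  then show ?thesis using fin by (simp add: ell2_dist_def)
qed

lemma fin_supp_ell2: "fin_supp x \<Longrightarrow> x \<in> ell2"
  unfolding ell2_def fin_supp_def
  by (simp add: summable_on_UNIV_nonneg_real_iff) (rule summable_finite, auto)

text \<open>Moving every point by at most \<open>1\<close> is invisible to coarse geometry, so that it suffices to define
maps at finitely supported sequences.\<close>

lemma ell2_truncation:
  assumes "x \<in> ell2"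
  shows "\<exists>z. fin_supp z \<and> ell2_dist x z \<le> 1"
proof -
  have "summable (\<lambda>i. (x i)\<^sup>2)"
    using assms by (simp add: ell2_def summable_on_UNIV_nonneg_real_iff)
  then obtain n where n: "norm (\<Sum>i. (x (i + n))\<^sup>2) < 1"
    using suminf_exist_split[of 1 "\<lambda>i. (x i)\<^sup>2"] by auto
  define z where "z i = (if i < n then x i else 0)" for i
  have z: "fin_supp z" unfolding fin_supp_def z_def by (rule finite_subset[of _ "{..<n}"]) auto
  have s: "summable (\<lambda>i. (x i - z i)\<^sup>2)"
    using ell2_diff[OF assms fin_supp_ell2[OF z]] .
  have "(\<Sum>\<^sub>\<infinity>i. (x i - z i)\<^sup>2) = (\<Sum>i. (x i - z i)\<^sup>2)"
    using s by (intro sums_unique has_sum_imp_sums has_sum_infsum)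
      (simp add: summable_on_UNIV_nonneg_real_iff)
  also have "\<dots> = (\<Sum>i. (x (i + n) - z (i + n))\<^sup>2) + (\<Sum>i<n. (x i - z i)\<^sup>2)"
    by (rule suminf_split_initial_segment[OF s])
  also have "\<dots> \<le> 1" using n by (simp add: z_def)
  finally have "ell2_dist x z \<le> 1" by (simp add: ell2_dist_def)
  then show ?thesis using z by blast
qed

text \<open>Contracting \<open>\<ell>\<^sub>2\<close> by a small factor \<open>s\<close> before taking product measures makes the measures of points
at distance \<open>R\<close> as close as desired; sufficiently distant points remain distant.\<close>

lemma probability_layer:
  fixes R \<eta> \<tau> :: real
  assumes "0 \<le> R" "0 < \<eta>" "0 < \<tau>"
  obtains h :: "(nat \<Rightarrow> real) \<Rightarrow> nat \<Rightarrow> real" and D :: real where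
    "\<And>x. x \<in> ell2 \<Longrightarrow> fin_supp (h x)" "\<And>x n. 0 \<le> h x n"
    "\<And>x n. h x n \<noteq> 0 \<Longrightarrow> fst (prod_decode n) = l"
    "\<And>x y. x \<in> ell2 \<Longrightarrow> y \<in> ell2 \<Longrightarrow> \<exists>J. finite J \<and> (\<forall>n. n \<notin> J \<longrightarrow> h x n = 0 \<and> h y n = 0) \<and>
       sum (h x) J = 1 \<and> sum (h y) J = 1 \<and>
       (ell2_dist x y \<le> R \<longrightarrow> (\<Sum>n\<in>J. \<bar>h x n - h y n\<bar>) \<le> \<eta>) \<and>
       (D \<le> ell2_dist x y \<longrightarrow> (\<Sum>n\<in>J. min (h x n) (h y n)) \<le> \<tau>)"
proof -
  obtain tr where tr: "\<And>x. x \<in> ell2 \<Longrightarrow> fin_supp (tr x)" "\<And>x. x \<in> ell2 \<Longrightarrow> ell2_dist x (tr x) \<le> 1"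
    using ell2_truncation by metis
  define s where "s = \<eta> / (4 * (R + 2))"
  have s: "s > 0" using assms by (simp add: s_def)
  \<comment> \<open>Truncation changes distances by at most \<open>2\<close>.  The summand \<open>1\<close> makes \<open>s * r \<ge> 1\<close>, so that \<open>s * r\<close> may
    be replaced by its square.\<close>
  define D where "D = 2 + (8 * \<bar>ln \<tau>\<bar> + 1) / s"
  define h where "h x = block_measure l (\<lambda>i. s * tr x i)" for x
  interpret M: Metric_space ell2 ell2_dist by (rule Metric_space_ell2)
  show thesis
  proof (rule that[of h D])
    show "0 \<le> h x n" for x n by (simp add: h_def block_measure_def)
    show "fst (prod_decode n) = l" if "h x n \<noteq> 0" for x n
      using that by (simp add: h_def block_measure_def split: if_splits)
    show pair: "\<exists>J. finite J \<and> (\<forall>n. n \<notin> J \<longrightarrow> h x n = 0 \<and> h y n = 0) \<and>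
       sum (h x) J = 1 \<and> sum (h y) J = 1 \<and>
       (ell2_dist x y \<le> R \<longrightarrow> (\<Sum>n\<in>J. \<bar>h x n - h y n\<bar>) \<le> \<eta>) \<and>
       (D \<le> ell2_dist x y \<longrightarrow> (\<Sum>n\<in>J. min (h x n) (h y n)) \<le> \<tau>)"
      if xy: "x \<in> ell2" "y \<in> ell2" for x y
    proof -
      let ?x = "\<lambda>i. s * tr x i" and ?y = "\<lambda>i. s * tr y i"
      have fs: "fin_supp ?x" "fin_supp ?y" using tr xy by auto
      define r where "r = ell2_dist (tr x) (tr y)"
      define E where "E = (\<Sum>i | ?x i \<noteq> 0 \<or> ?y i \<noteq> 0. (?x i - ?y i)\<^sup>2)"
      have "E = s\<^sup>2 * (\<Sum>i | tr x i \<noteq> 0 \<or> tr y i \<noteq> 0. (tr x i - tr y i)\<^sup>2)"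
        unfolding E_def sum_distrib_left using s
        by (intro sum.cong) (auto simp: power_mult_distrib[symmetric] right_diff_distrib)
      moreover have "(\<Sum>i | tr x i \<noteq> 0 \<or> tr y i \<noteq> 0. (tr x i - tr y i)\<^sup>2) = r\<^sup>2"
        unfolding r_def using xy tr by (subst ell2_dist_fin_supp) (auto simp: sum_nonneg)
      ultimately have E: "E = (s * r)\<^sup>2" by (simp add: power_mult_distrib)
      have r0: "0 \<le> r" by (simp add: r_def)
      have tin: "tr x \<in> ell2" "tr y \<in> ell2" using tr xy fin_supp_ell2 by auto
      have "r \<le> ell2_dist (tr x) x + ell2_dist x (tr y)"
        unfolding r_def using M.triangle tin xy by blast
      moreover have "ell2_dist x (tr y) \<le> ell2_dist x y + ell2_dist y (tr y)"
        using M.triangle tin xy by blast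
      moreover have "ell2_dist x y \<le> ell2_dist x (tr x) + ell2_dist (tr x) y"
        using M.triangle tin xy by blast
      moreover have "ell2_dist (tr x) y \<le> r + ell2_dist (tr y) y"
        unfolding r_def using M.triangle tin xy by blast
      ultimately have r_up: "r \<le> ell2_dist x y + 2" and r_lo: "ell2_dist x y \<le> r + 2"
        using tr(2)[OF xy(1)] tr(2)[OF xy(2)] M.commute[of x "tr x"] M.commute[of y "tr y"] by linarith+
      obtain J where J: "finite J" "\<And>n. n \<notin> J \<Longrightarrow> h x n = 0 \<and> h y n = 0"
        "sum (h x) J = 1" "sum (h y) J = 1"
        "(\<Sum>n\<in>J. \<bar>h x n - h y n\<bar>) \<le> 4 * sqrt E"
        "(\<Sum>n\<in>J. min (h x n) (h y n)) \<le> exp (- E / 8)"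
        by (rule block_measure_bounds[OF fs, of l, folded E_def h_def]) (rule that)
      have near: "4 * sqrt E \<le> \<eta>" if "ell2_dist x y \<le> R"
      proof -
        have "4 * sqrt E = 4 * (s * r)" using s r0 by (simp add: E)
        also have "\<dots> \<le> 4 * (s * (R + 2))" using that r_up s by (intro mult_left_mono) auto
        also have "\<dots> = \<eta>" using assms(1) by (simp add: s_def field_simps)
        finally show ?thesis .
      qed
      have far: "exp (- E / 8) \<le> \<tau>" if "D \<le> ell2_dist x y"
      proof -
        have "(8 * \<bar>ln \<tau>\<bar> + 1) / s \<le> r" using that r_lo by (simp add: D_def)
        then have sr: "8 * \<bar>ln \<tau>\<bar> + 1 \<le> s * r" using s by (simp add: divide_le_eq mult.commute)
        also have "s * r \<le> (s * r) * (s * r)" using sr mult_left_mono[of 1 "s * r" "s * r"] by simp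
        finally have "8 * \<bar>ln \<tau>\<bar> \<le> E" by (simp add: E power2_eq_square)
        then have "- E / 8 \<le> ln \<tau>" by linarith
        then have "exp (- E / 8) \<le> exp (ln \<tau>)" by simp
        then show ?thesis using assms by simp
      qed
      show ?thesis using J near far order_trans by (intro exI[of _ J]) fast
    qed
    show "fin_supp (h x)" if "x \<in> ell2" for x
      using pair[OF that that] unfolding fin_supp_def by (metis (mono_tags, lifting) finite_subset mem_Collect_eq subsetI)
  qed
qed

section \<open>From probability measures to the unit ball of a lattice norm\<close>

definition entropy :: "(nat \<Rightarrow> real) \<Rightarrow> (nat \<Rightarrow> real) \<Rightarrow> real" where
  "entropy h x = (\<Sum>i | h i \<noteq> 0. h i * ln (x i))"

lemma entropy_eq_sum:
  assumes "finite J" "\<And>i. i \<notin> J \<Longrightarrow> h i = 0"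
  shows "entropy h x = (\<Sum>i\<in>J. h i * ln (x i))"
  unfolding entropy_def using assms by (intro sum.mono_neutral_left) auto

text \<open>The logarithms are unbounded, but they enter only through the mass that \<open>a\<close> and \<open>b\<close> do not share.
The common mass \<open>min a b\<close> contributes a nonnegative amount, as \<open>m\<close> is at least the geometric mean
of \<open>s\<close> and \<open>t\<close>; the excess \<open>\<bar>a - b\<bar>\<close> meets a logarithm that is at least \<open>- ln 4\<close>.\<close>

lemma log_mean_lower:
  fixes a b s t m :: real
  assumes a: "0 \<le> a" "0 < s \<longleftrightarrow> 0 < a" and b: "0 \<le> b" "0 < t \<longleftrightarrow> 0 < b" and "0 \<le> s" "0 \<le> t"
    and m: "s / 4 \<le> m" "t / 4 \<le> m" "s * t \<le> m\<^sup>2"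
  shows "- \<bar>a - b\<bar> * ln 4 \<le> a * (ln m - ln s) + b * (ln m - ln t)"
proof -
  have ls: "- ln 4 \<le> ln m - ln s" if "0 < a"
  proof -
    have s: "0 < s" using a that by simp
    then have "ln (s / 4) \<le> ln m" using m by (subst ln_le_cancel_iff) auto
    then show ?thesis using s by (simp add: ln_div)
  qed
  have lt: "- ln 4 \<le> ln m - ln t" if "0 < b"
  proof -
    have t: "0 < t" using b that by simp
    then have "ln (t / 4) \<le> ln m" using m by (subst ln_le_cancel_iff) auto
    then show ?thesis using t by (simp add: ln_div)
  qed
  consider "a = 0" | "b = 0" | "0 < a" "0 < b" using a b by linarith
  then show ?thesis
  proof cases
    case 1
    then show ?thesis using lt b mult_left_mono[of "- ln 4" "ln m - ln t" b] by (cases "b = 0") auto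
  next
    case 2
    then show ?thesis using ls a mult_left_mono[of "- ln 4" "ln m - ln s" a] by (cases "a = 0") auto
  next
    case 3
    then have pos: "0 < s" "0 < t" using a b by auto
    then have mpos: "0 < m" using m by (meson divide_pos_pos less_le_trans zero_less_numeral)
    have "ln (s * t) \<le> ln (m\<^sup>2)" using pos mpos m by (subst ln_le_cancel_iff) auto
    then have sum: "0 \<le> (ln m - ln s) + (ln m - ln t)"
      using pos mpos by (simp add: ln_mult_pos ln_realpow)
    show ?thesis
    proof (cases "a \<le> b")
      case True
      have "- (b - a) * ln 4 \<le> (b - a) * (ln m - ln t)"
        using mult_left_mono[OF lt[OF 3(2)], of "b - a"] True by (simp add: algebra_simps)
      moreover have "0 \<le> a * ((ln m - ln s) + (ln m - ln t))" using a sum by simp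
      ultimately show ?thesis using True by (simp add: algebra_simps)
    next
      case False
      have "- (a - b) * ln 4 \<le> (a - b) * (ln m - ln s)"
        using mult_left_mono[OF ls[OF 3(1)], of "a - b"] False by (simp add: algebra_simps)
      moreover have "0 \<le> b * ((ln m - ln s) + (ln m - ln t))" using b sum by simp
      ultimately show ?thesis using False by (simp add: algebra_simps)
    qed
  qed
qed

context lower_lattice_norm
begin

text \<open>Maximality up to \<open>\<kappa>\<close> is required against all \<open>y\<close>, with the term \<open>ln (Psi y) / q\<close> in place of the
constraint \<open>Psi y \<le> 1\<close>; the two versions agree because \<open>Psi\<close> is \<open>q\<close>-homogeneous and \<open>h\<close> has mass \<open>1\<close>.\<close>

definition near_max :: "real \<Rightarrow> (nat \<Rightarrow> real) \<Rightarrow> (nat \<Rightarrow> real) \<Rightarrow> bool" where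
  "near_max \<kappa> h x \<longleftrightarrow> fin_supp x \<and> (\<forall>i. 0 \<le> x i) \<and> (\<forall>i. 0 < x i \<longleftrightarrow> 0 < h i) \<and> Psi x \<le> 1 \<and>
     (\<forall>y. fin_supp y \<longrightarrow> (\<forall>i. 0 \<le> y i) \<longrightarrow> (\<forall>i. 0 < h i \<longrightarrow> 0 < y i) \<longrightarrow>
        entropy h y \<le> entropy h x + \<kappa> + ln (Psi y) / q)"

lemma near_maxD:
  assumes "near_max \<kappa> h x" "fin_supp y" "\<And>i. 0 \<le> y i" "\<And>i. 0 < h i \<Longrightarrow> 0 < y i"
  shows "entropy h y \<le> entropy h x + \<kappa> + ln (Psi y) / q"
  using assms by (simp add: near_max_def)

lemma Psi_pos:
  assumes "fin_supp x" "x i \<noteq> 0"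
  shows "0 < Psi x"
proof -
  have "0 < \<bar>x i\<bar> * N (\<lambda>j. if j = i then 1 else 0)" using assms unit_pos by simp
  also have "\<dots> \<le> N x" by (rule coord_le[OF assms(1)])
  finally have "0 < N x ^ q" by simp
  then show ?thesis using Psi_lower[OF assms(1)] by simp
qed

lemma N_le_1:
  assumes "fin_supp x" "Psi x \<le> 1"
  shows "N x \<le> 1"
proof -
  have "N x ^ q \<le> 1 ^ q" using Psi_lower[OF assms(1)] assms(2) by simp
  then show ?thesis using q_pos power_mono_iff[of "N x" 1 q] nonneg[OF assms(1)] by simp
qed

text \<open>The entropy is bounded above on the unit ball because the coordinates are.  A vector whose entropy
is close to the supremum keeps its entropy when it is restricted to the support of \<open>h\<close>.\<close>

lemma near_max_exists:
  assumes J: "finite J" "\<And>i. i \<notin> J \<Longrightarrow> h i = 0" and h0: "\<And>i. 0 \<le> h i" and sum1: "sum h J = 1" and \<kappa>: "0 < \<kappa>"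
  shows "\<exists>x. near_max \<kappa> h x"
proof -
  define adm where "adm y \<longleftrightarrow> fin_supp y \<and> (\<forall>i. 0 \<le> y i) \<and> (\<forall>i. 0 < h i \<longrightarrow> 0 < y i)" for y :: "nat \<Rightarrow> real"
  define T where "T = {y. adm y \<and> Psi y \<le> 1}"
  have ent: "entropy h y = (\<Sum>i\<in>J. h i * ln (y i))" for y by (rule entropy_eq_sum[OF J])
  obtain i0 where i0: "0 < h i0"
    using sum1 h0 by (metis less_eq_real_def sum.neutral zero_neq_one)
  have normalise: "\<exists>z\<in>T. entropy h z = entropy h y - ln (Psi y) / q" if y: "adm y" for y
  proof -
    have P: "0 < Psi y" using y i0 Psi_pos[of y i0] by (force simp: adm_def)
    define a where "a = exp (- (ln (Psi y) / q))"
    have a: "0 < a" by (simp add: a_def)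
    have "a ^ q = exp (- ln (Psi y))"
      using q_pos by (simp add: a_def exp_of_nat_mult[symmetric])
    then have aq: "\<bar>a\<bar> ^ q * Psi y = 1" using P a by (simp add: exp_minus)
    let ?z = "\<lambda>i. a * y i"
    have "?z \<in> T"
      using y a Psi_scale_le[of y a] aq by (auto simp: T_def adm_def)
    moreover have "entropy h ?z = entropy h y - ln (Psi y) / q"
    proof -
      have "entropy h ?z = (\<Sum>i\<in>J. h i * ln a + h i * ln (y i))"
        unfolding ent
      proof (rule sum.cong[OF refl])
        fix i assume "i \<in> J"
        show "h i * ln (a * y i) = h i * ln a + h i * ln (y i)"
        proof (cases "h i = 0")
          case False
          then have "0 < y i" using y h0[of i] by (simp add: adm_def)
          then show ?thesis using a by (simp add: ln_mult_pos distrib_left)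
        qed simp
      qed
      also have "\<dots> = ln a + entropy h y"
        by (simp add: sum.distrib sum_distrib_right[symmetric] sum1 ent)
      finally show ?thesis by (simp add: a_def)
    qed
    ultimately show ?thesis by blast
  qed
  have bdd: "bdd_above (entropy h ` T)"
  proof (rule bdd_aboveI2)
    fix y assume y: "y \<in> T"
    have "y i * N (\<lambda>j. if j = i then 1 else 0) \<le> 1" for i
      using coord_le[of y i] N_le_1[of y] y by (force simp: T_def adm_def)
    then have le: "y i \<le> 1 / N (\<lambda>j. if j = i then 1 else 0)" for i
      using unit_pos[of i] by (simp add: le_divide_eq)
    show "entropy h y \<le> (\<Sum>i\<in>J. h i * ln (1 / N (\<lambda>j. if j = i then 1 else 0)))"
      unfolding ent
    proof (rule sum_mono)
      fix i
      show "h i * ln (y i) \<le> h i * ln (1 / N (\<lambda>j. if j = i then 1 else 0))"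
      proof (cases "h i = 0")
        case False
        then have "0 < y i" using y h0[of i] by (simp add: T_def adm_def)
        then have "ln (y i) \<le> ln (1 / N (\<lambda>j. if j = i then 1 else 0))"
          using le[of i] unit_pos[of i] by (subst ln_le_cancel_iff) auto
        then show ?thesis using h0 by (intro mult_left_mono) auto
      qed simp
    qed
  qed
  have "adm (\<lambda>i. if 0 < h i then 1 else 0)"
  proof -
    have "{i. 0 < h i} \<subseteq> J" using J(2) by (metis less_irrefl mem_Collect_eq subsetI)
    then show ?thesis unfolding adm_def fin_supp_def using J(1) finite_subset by auto
  qed
  then have ne: "T \<noteq> {}" using normalise by blast
  define s where "s = (SUP y\<in>T. entropy h y)"
  have "s - \<kappa> < s" using \<kappa> by simp
  then obtain x where x: "x \<in> T" "s - \<kappa> < entropy h x"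
    using less_cSUP_iff[OF ne bdd] unfolding s_def by auto
  define x' where "x' = restr {i. 0 < h i} x"
  have x': "fin_supp x'" using x by (auto simp: x'_def T_def adm_def)
  have ent': "entropy h x' = entropy h x"
    unfolding ent by (intro sum.cong refl) (use h0 in \<open>auto simp: x'_def restr_def less_le\<close>)
  have "Psi x' \<le> Psi x"
    using x by (intro Psi_mono) (auto simp: x'_def restr_def T_def adm_def)
  then have "Psi x' \<le> 1" using x by (simp add: T_def)
  moreover have "entropy h y \<le> entropy h x' + \<kappa> + ln (Psi y) / q"
    if "fin_supp y" "\<forall>i. 0 \<le> y i" "\<forall>i. 0 < h i \<longrightarrow> 0 < y i" for y
  proof -
    have "adm y" using that by (simp add: adm_def)
    from normalise[OF this] obtain z where z: "z \<in> T" "entropy h z = entropy h y - ln (Psi y) / q" by blast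
    have "entropy h z \<le> s" unfolding s_def by (rule cSUP_upper[OF z(1) bdd])
    then show ?thesis using z x ent' by linarith
  qed
  ultimately have "near_max \<kappa> h x'"
    unfolding near_max_def using x x' by (auto simp: x'_def restr_def T_def adm_def)
  then show ?thesis by blast
qed

text \<open>Uniform continuity of the entropy map.  If \<open>x1\<close> and \<open>x2\<close> are far apart, then some vector \<open>m\<close> is at
least their geometric mean and has \<open>Psi m\<close> well below \<open>1\<close>.  Replacing \<open>x1\<close> and \<open>x2\<close> by \<open>m\<close>
changes the sum of the two entropies by at least \<open>- ln 4 * (\<Sum>i\<in>J. \<bar>h1 i - h2 i\<bar>)\<close>, by
\<open>log_mean_lower\<close>, whereas maximality allows a change of at most \<open>2 * \<kappa> + 2 * ln (Psi m) / q\<close>.\<close>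

lemma near_max_close:
  assumes J: "finite J" "\<And>i. i \<notin> J \<Longrightarrow> h1 i = 0 \<and> h2 i = 0"
    and h: "\<And>i. 0 \<le> h1 i" "\<And>i. 0 \<le> h2 i" "sum h1 J = 1"
    and x1: "near_max \<kappa> h1 x1" and x2: "near_max \<kappa> h2 x2"
    and \<epsilon>: "0 < \<epsilon>" "\<epsilon> \<le> 1" "\<epsilon> \<le> N (\<lambda>i. x1 i - x2 i)"
  shows "2 * ((\<epsilon> / 4)\<^sup>2 / 8 * (\<epsilon> / 4) ^ q) / q \<le> ln 4 * (\<Sum>i\<in>J. \<bar>h1 i - h2 i\<bar>) + 2 * \<kappa>"
proof -
  have fx: "fin_supp x1" "fin_supp x2" and x0: "\<And>i. 0 \<le> x1 i" "\<And>i. 0 \<le> x2 i"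
    and Px: "Psi x1 \<le> 1" "Psi x2 \<le> 1" and iff: "\<And>i. 0 < x1 i \<longleftrightarrow> 0 < h1 i" "\<And>i. 0 < x2 i \<longleftrightarrow> 0 < h2 i"
    using x1 x2 by (auto simp: near_max_def)
  \<comment> \<open>The arithmetic mean \<open>u\<close> may be lowered by the factor \<open>1 - c\<close> wherever \<open>x1\<close> and \<open>x2\<close> differ by at
    least \<open>\<eta> * u\<close>, and still exceeds the geometric mean, as \<open>(1 - c)\<^sup>2 \<ge> 1 - \<eta>\<^sup>2 / 4\<close>.\<close>
  define \<eta> where "\<eta> = \<epsilon> / 4"
  define c where "c = \<eta>\<^sup>2 / 8"
  have \<eta>: "0 < \<eta>" "\<eta> \<le> 1" using \<epsilon> by (auto simp: \<eta>_def)
  have "\<eta>\<^sup>2 \<le> 1" using \<eta> by (simp add: power_le_one)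
  then have c: "0 < c" "c \<le> 1 / 2" using \<eta> by (auto simp: c_def)
  define u where "u i = (1 - 1/2) * x1 i + 1/2 * x2 i" for i
  define A where "A = {i. \<eta> * u i \<le> \<bar>x1 i - x2 i\<bar>}"
  define m where "m i = (1 - c) * u i + c * restr (- A) u i" for i
  have fu: "fin_supp u" unfolding u_def by (intro fin_supp_add fin_supp_scale fx)
  have u0: "0 \<le> u i" for i using x0[of i] by (simp add: u_def)
  have fm: "fin_supp m" unfolding m_def by (intro fin_supp_add fin_supp_scale fin_supp_restr fu)
  have m_lower: "(1 - c) * u i \<le> m i" for i using u0 c by (simp add: m_def restr_def)
  have "Psi u \<le> (1 - 1/2) * Psi x1 + 1/2 * Psi x2"
    unfolding u_def by (rule Psi_convex) (use fx in auto)
  then have Pu: "Psi u \<le> 1" using Px by simp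
  have "Psi m \<le> (1 - c) * Psi u + c * Psi (restr (- A) u)"
    unfolding m_def by (rule Psi_convex) (use fu c in auto)
  also have "\<dots> \<le> (1 - c) * Psi u + c * (Psi u - Psi (restr A u))"
    using c Psi_superadditive[OF fu, of A] by (intro add_left_mono mult_left_mono) auto
  also have "\<dots> = Psi u - c * Psi (restr A u)" by (simp add: algebra_simps)
  \<comment> \<open>Off \<open>A\<close>, the difference of \<open>x1\<close> and \<open>x2\<close> has norm at most \<open>\<eta> = \<epsilon> / 4\<close>; hence \<open>u\<close> is large on \<open>A\<close>.\<close>
  also have "\<dots> \<le> 1 - c * \<eta> ^ q"
  proof -
    let ?d = "\<lambda>i. x1 i - x2 i"
    have fd: "fin_supp ?d" using fx by auto
    have "?d = (\<lambda>i. restr A ?d i + restr (- A) ?d i)" by (auto simp: restr_def)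
    then have "N ?d \<le> N (restr A ?d) + N (restr (- A) ?d)"
      using triangle[of "restr A ?d" "restr (- A) ?d"] fd by auto
    also have "N (restr A ?d) \<le> N (\<lambda>i. 2 * restr A u i)"
    proof (rule mono)
      show "fin_supp (\<lambda>i. 2 * restr A u i)" using fu by (intro fin_supp_scale fin_supp_restr)
      show "\<bar>restr A ?d i\<bar> \<le> \<bar>2 * restr A u i\<bar>" for i
        using x0[of i] by (auto simp: restr_def u_def abs_le_iff)
    qed
    also have "\<dots> = 2 * N (restr A u)" using fu by (simp add: scale fin_supp_restr)
    also have "N (restr (- A) ?d) \<le> N (\<lambda>i. \<eta> * u i)"
      using fu u0 \<eta> by (intro mono) (auto simp: restr_def A_def)
    also have "\<dots> \<le> \<eta>" using scale[OF fu, of \<eta>] \<eta> N_le_1[OF fu Pu] by simp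
    finally have "\<epsilon> \<le> 2 * N (restr A u) + \<eta>" using \<epsilon> by simp
    then have "\<eta> \<le> N (restr A u)" using \<epsilon> by (simp add: \<eta>_def)
    then have "\<eta> ^ q \<le> N (restr A u) ^ q" using \<eta> by (intro power_mono) auto
    also have "\<dots> \<le> Psi (restr A u)" using fu by (intro Psi_lower) auto
    finally show ?thesis using Pu c mult_left_mono[of "\<eta> ^ q" "Psi (restr A u)" c] by linarith
  qed
  finally have Pm: "Psi m \<le> 1 - c * \<eta> ^ q" .
  have mpos: "0 < m i" if "0 < x1 i \<or> 0 < x2 i" for i
  proof -
    have "0 < u i" using that x0[of i] by (auto simp: u_def)
    then have "0 < (1 - c) * u i" using c by simp
    then show ?thesis using m_lower[of i] by linarith
  qed
  have m0: "0 \<le> m i" for i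
    using m_lower[of i] mult_nonneg_nonneg[of "1 - c" "u i"] u0[of i] c by linarith
  obtain i0 where "0 < h1 i0"
    using h by (metis less_eq_real_def sum.neutral zero_neq_one)
  then have "m i0 \<noteq> 0" using mpos[of i0] iff by auto
  then have "0 < Psi m" by (rule Psi_pos[OF fm])
  then have "ln (Psi m) \<le> - (c * \<eta> ^ q)" using ln_le_minus_one[of "Psi m"] Pm by linarith
  then have lnP: "ln (Psi m) / q \<le> - (c * \<eta> ^ q) / q" by (intro divide_right_mono) auto
  have e1: "entropy h1 m \<le> entropy h1 x1 + \<kappa> + ln (Psi m) / q"
    and e2: "entropy h2 m \<le> entropy h2 x2 + \<kappa> + ln (Psi m) / q"
    using mpos iff by (auto intro!: near_maxD[OF x1 fm m0] near_maxD[OF x2 fm m0])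
  have ent: "entropy h1 y = (\<Sum>i\<in>J. h1 i * ln (y i))" "entropy h2 y = (\<Sum>i\<in>J. h2 i * ln (y i))" for y
    by (rule entropy_eq_sum[OF J(1)]; use J(2) in blast)+
  have "- (\<Sum>i\<in>J. \<bar>h1 i - h2 i\<bar>) * ln 4 = (\<Sum>i\<in>J. - \<bar>h1 i - h2 i\<bar> * ln 4)"
    by (simp add: sum_distrib_right sum_negf)
  also have "\<dots> \<le> (\<Sum>i\<in>J. h1 i * (ln (m i) - ln (x1 i)) + h2 i * (ln (m i) - ln (x2 i)))"
  proof (intro sum_mono log_mean_lower h iff x0)
    fix i
    have half: "u i / 2 \<le> m i"
      using m_lower[of i] mult_right_mono[of "1/2" "1 - c" "u i"] c u0[of i] by linarith
    show "x1 i / 4 \<le> m i" "x2 i / 4 \<le> m i" using half x0[of i] by (auto simp: u_def)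
    have uu: "(u i)\<^sup>2 = x1 i * x2 i + (x1 i - x2 i)\<^sup>2 / 4"
      by (simp add: u_def power2_eq_square field_simps)
    show "x1 i * x2 i \<le> (m i)\<^sup>2"
    proof (cases "i \<in> A")
      case False
      then have "m i = u i" by (simp add: m_def restr_def algebra_simps)
      then show ?thesis using uu by simp
    next
      case True
      then have m_eq: "m i = (1 - c) * u i" by (simp add: m_def restr_def)
      have "(m i)\<^sup>2 = (u i)\<^sup>2 - 2 * c * (u i)\<^sup>2 + (c * u i)\<^sup>2"
        unfolding m_eq by (simp add: power2_eq_square algebra_simps)
      then have 1: "(u i)\<^sup>2 - 2 * c * (u i)\<^sup>2 \<le> (m i)\<^sup>2" by simp
      have "(\<eta> * u i)\<^sup>2 \<le> \<bar>x1 i - x2 i\<bar>\<^sup>2"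
        using True \<eta> u0[of i] by (intro power_mono) (auto simp: A_def)
      then have "2 * c * (u i)\<^sup>2 \<le> (x1 i - x2 i)\<^sup>2 / 4" by (simp add: c_def power_mult_distrib)
      then show ?thesis using 1 uu by linarith
    qed
  qed
  also have "\<dots> = (entropy h1 m - entropy h1 x1) + (entropy h2 m - entropy h2 x2)"
    unfolding ent by (simp add: sum.distrib sum_subtractf right_diff_distrib)
  also have "\<dots> \<le> 2 * \<kappa> + 2 * (- (c * \<eta> ^ q) / q)" using e1 e2 lnP by linarith
  finally show ?thesis by (simp add: c_def \<eta>_def mult.commute)
qed

text \<open>If \<open>h\<close> has little mass outside \<open>A\<close>, then shrinking \<open>x\<close> outside \<open>A\<close> by the factor \<open>s\<close> costs hardly
any entropy.  By maximality it cannot lower \<open>Psi\<close> by much, so that \<open>Psi\<close> is concentrated on \<open>A\<close>.\<close>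

lemma near_max_concentrated:
  assumes J: "finite J" "\<And>i. i \<notin> J \<Longrightarrow> h i = 0" and h0: "\<And>i. 0 \<le> h i" and sum1: "sum h J = 1"
    and x: "near_max \<kappa> h x" and s: "0 < s" "s \<le> 1"
    and small: "(\<Sum>i\<in>J - A. h i) \<le> \<tau>" and par: "q * (\<kappa> + \<tau> * ln (1 / s)) \<le> s"
  shows "1 - 2 * s \<le> Psi (restr A x)"
proof -
  have fx: "fin_supp x" and x0: "\<And>i. 0 \<le> x i" and iff: "\<And>i. 0 < x i \<longleftrightarrow> 0 < h i" and Px: "Psi x \<le> 1"
    using x by (auto simp: near_max_def)
  define y where "y i = (1 - s) * restr A x i + s * x i" for i
  have fy: "fin_supp y" unfolding y_def by (intro fin_supp_add fin_supp_scale fin_supp_restr fx)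
  have y_eq: "y i = (if i \<in> A then x i else s * x i)" for i
    by (simp add: y_def restr_def algebra_simps)
  have ypos: "0 < y i" if "0 < h i" for i using that iff s by (simp add: y_eq)
  have y0: "0 \<le> y i" for i using x0 s by (simp add: y_eq)
  obtain i0 where "0 < h i0"
    using h0 sum1 by (metis less_eq_real_def sum.neutral zero_neq_one)
  then have "y i0 \<noteq> 0" using ypos[of i0] by simp
  then have Py: "0 < Psi y" by (rule Psi_pos[OF fy])
  have ent: "entropy h z = (\<Sum>i\<in>J. h i * ln (z i))" for z by (rule entropy_eq_sum[OF J])
  have "entropy h y = (\<Sum>i\<in>J. h i * ln (x i) + (if i \<in> A then 0 else h i * ln s))"
    unfolding ent
  proof (rule sum.cong[OF refl])
    fix i assume "i \<in> J"
    show "h i * ln (y i) = h i * ln (x i) + (if i \<in> A then 0 else h i * ln s)"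
    proof (cases "h i = 0")
      case False
      then have "0 < x i" using iff h0[of i] by simp
      then show ?thesis using s by (simp add: y_eq ln_mult_pos distrib_left)
    qed simp
  qed
  also have "\<dots> = entropy h x + (\<Sum>i\<in>J - A. h i * ln s)"
    using J(1) by (simp add: sum.distrib ent sum.If_cases set_diff_eq Int_def conj_commute)
  also have "\<dots> = entropy h x - (\<Sum>i\<in>J - A. h i) * ln (1 / s)"
    using s by (simp add: sum_distrib_right ln_div sum_negf)
  finally have "entropy h x - (\<Sum>i\<in>J - A. h i) * ln (1 / s) = entropy h y" by simp
  moreover have "(\<Sum>i\<in>J - A. h i) * ln (1 / s) \<le> \<tau> * ln (1 / s)"
    using small s by (intro mult_right_mono) auto
  moreover have "entropy h y \<le> entropy h x + \<kappa> + ln (Psi y) / q"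
    by (rule near_maxD[OF x fy y0 ypos])
  ultimately have "- (\<kappa> + \<tau> * ln (1 / s)) \<le> ln (Psi y) / q" by linarith
  then have "- (q * (\<kappa> + \<tau> * ln (1 / s))) \<le> ln (Psi y)"
    using q_pos pos_le_divide_eq[of "real q" "- (\<kappa> + \<tau> * ln (1 / s))" "ln (Psi y)"]
    by (simp only: of_nat_0_less_iff mult_minus_left mult.commute[of _ "real q"])
  then have "- s \<le> ln (Psi y)" using par by linarith
  then have "- s \<le> Psi y - 1" using ln_le_minus_one[OF Py] by linarith
  moreover have "Psi y \<le> (1 - s) * Psi (restr A x) + s * Psi x"
    unfolding y_def by (rule Psi_convex) (use fx s in auto)
  moreover have "(1 - s) * Psi (restr A x) \<le> 1 * Psi (restr A x)"
    using s Psi_nonneg[OF fin_supp_restr[OF fx]] by (intro mult_right_mono) auto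
  moreover have "s * Psi x \<le> s * 1" using s Px by (intro mult_left_mono) auto
  ultimately show ?thesis by simp
qed

text \<open>Nearly disjoint measures are concentrated on complementary sets \<open>A\<close> and \<open>- A\<close>.  Hence \<open>Psi\<close> of the
restriction to \<open>- A\<close> is near \<open>1\<close> for \<open>x2\<close>, but near \<open>0\<close> for \<open>x1\<close> by superadditivity.\<close>

lemma near_max_far:
  assumes J: "finite J" "\<And>i. i \<notin> J \<Longrightarrow> h1 i = 0 \<and> h2 i = 0"
    and h: "\<And>i. 0 \<le> h1 i" "\<And>i. 0 \<le> h2 i" "sum h1 J = 1" "sum h2 J = 1"
    and x1: "near_max \<kappa> h1 x1" and x2: "near_max \<kappa> h2 x2"
    and s: "s = (1/2) ^ (q + 3)"
    and small: "(\<Sum>i\<in>J. min (h1 i) (h2 i)) \<le> \<tau>" and par: "q * (\<kappa> + \<tau> * ln (1 / s)) \<le> s"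
  shows "1 \<le> 2 ^ q * C * N (\<lambda>i. x1 i - x2 i) ^ q"
proof -
  have fx: "fin_supp x1" "fin_supp x2" and Px: "Psi x1 \<le> 1" and x0: "\<And>i. 0 \<le> x1 i" "\<And>i. 0 \<le> x2 i"
    using x1 x2 by (auto simp: near_max_def)
  have s01: "0 < s" "s \<le> 1" unfolding s by (auto intro: power_le_one)
  have s8: "2 ^ q * s = 1 / 8" by (simp add: s power_add power_one_over)
  have "(1::real) \<le> 2 ^ q" by simp
  then have "1 * s \<le> 2 ^ q * s" using s01 by (intro mult_right_mono) auto
  then have s_le: "s \<le> 1 / 8" using s8 by simp
  define A where "A = {i. h2 i \<le> h1 i}"
  have "(\<Sum>i\<in>J - A. h1 i) = (\<Sum>i\<in>J - A. min (h1 i) (h2 i))"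
    by (intro sum.cong) (auto simp: A_def)
  also have "\<dots> \<le> (\<Sum>i\<in>J. min (h1 i) (h2 i))"
    using J h by (intro sum_mono2) auto
  finally have c1: "1 - 2 * s \<le> Psi (restr A x1)"
    using small s01 h J x1 par by (intro near_max_concentrated[where h = h1 and \<kappa> = \<kappa> and \<tau> = \<tau> and J = J]) auto
  have "(\<Sum>i\<in>J - - A. h2 i) = (\<Sum>i\<in>J - - A. min (h1 i) (h2 i))"
    by (intro sum.cong) (auto simp: A_def)
  also have "\<dots> \<le> (\<Sum>i\<in>J. min (h1 i) (h2 i))"
    using J h by (intro sum_mono2) auto
  finally have c2: "1 - 2 * s \<le> Psi (restr (- A) x2)"
    using small s01 h J x2 par by (intro near_max_concentrated[where h = h2 and \<kappa> = \<kappa> and \<tau> = \<tau> and J = J]) auto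
  have le: "Psi (restr (- A) x1) \<le> 2 * s"
    using c1 Px Psi_superadditive[OF fx(1), of A] by linarith
  let ?f = "\<lambda>i. \<bar>x1 i - x2 i\<bar>"
  have fd: "fin_supp (\<lambda>i. x1 i - x2 i)" using fx by auto
  then have ff: "fin_supp ?f" by (rule fin_supp_mono) auto
  \<comment> \<open>Off \<open>A\<close>, \<open>x2\<close> is at most the sum of \<open>x1\<close> and \<open>?f\<close>; writing this sum as a mean of doubled vectors costs a
    factor \<open>2 ^ q\<close>, which the choice of \<open>s\<close> absorbs.\<close>
  let ?g = "\<lambda>i. (1 - 1/2) * (2 * restr (- A) x1 i) + 1/2 * (2 * ?f i)"
  have "Psi (restr (- A) x2) \<le> Psi ?g"
  proof (rule Psi_mono)
    show "fin_supp ?g" by (intro fin_supp_add fin_supp_scale fin_supp_restr fx ff)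
    show "\<bar>restr (- A) x2 i\<bar> \<le> \<bar>?g i\<bar>" for i using x0[of i] by (auto simp: restr_def)
  qed
  also have "\<dots> \<le> (1 - 1/2) * Psi (\<lambda>i. 2 * restr (- A) x1 i) + 1/2 * Psi (\<lambda>i. 2 * ?f i)"
    by (rule Psi_convex) (intro fin_supp_scale fin_supp_restr fx ff | simp)+
  also have "Psi (\<lambda>i. 2 * restr (- A) x1 i) \<le> 2 ^ q * Psi (restr (- A) x1)"
    using Psi_scale_le[OF fin_supp_restr[OF fx(1)], of 2] by simp
  also have "2 ^ q * Psi (restr (- A) x1) \<le> 2 ^ q * (2 * s)"
    using le by (intro mult_left_mono) auto
  also have "2 ^ q * (2 * s) = 1 / 4" using s8 by simp
  also have "Psi (\<lambda>i. 2 * ?f i) \<le> 2 ^ q * Psi ?f"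
    using Psi_scale_le[OF ff, of 2] by simp
  also have "2 ^ q * Psi ?f \<le> 2 ^ q * (C * N (\<lambda>i. x1 i - x2 i) ^ q)"
  proof (rule mult_left_mono)
    have "Psi ?f \<le> C * N ?f ^ q" by (rule Psi_upper[OF ff])
    also have "\<dots> \<le> C * N (\<lambda>i. x1 i - x2 i) ^ q"
      using C_pos nonneg[OF ff] by (intro mult_left_mono power_mono mono[OF fd]) auto
    finally show "Psi ?f \<le> C * N (\<lambda>i. x1 i - x2 i) ^ q" .
  qed auto
  finally have "1 - 2 * s \<le> 1 / 8 + (2 ^ q * (C * N (\<lambda>i. x1 i - x2 i) ^ q)) / 2"
    using c2 by simp
  then show ?thesis using s_le by (simp add: mult.assoc)
qed

text \<open>The entropy map after the map into probability measures.  The separation \<open>\<delta>\<^sub>0\<close> must not depend on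
the layer \<open>l\<close> or on the precision \<open>\<epsilon>\<close>; it depends only on \<open>q\<close> and \<open>C\<close>.\<close>

lemma sphere_layers:
  obtains \<delta>\<^sub>0 where "0 < \<delta>\<^sub>0"
    "\<And>l R \<epsilon>. 0 \<le> R \<Longrightarrow> 0 < \<epsilon> \<Longrightarrow> \<epsilon> \<le> 1 \<Longrightarrow> \<exists>F D.
       (\<forall>x\<in>ell2. fin_supp (F x) \<and> N (F x) \<le> 1 \<and> (\<forall>n. F x n \<noteq> 0 \<longrightarrow> fst (prod_decode n) = l)) \<and>
       (\<forall>x\<in>ell2. \<forall>y\<in>ell2. (ell2_dist x y \<le> R \<longrightarrow> N (\<lambda>n. F x n - F y n) \<le> \<epsilon>) \<and>
                           (D \<le> ell2_dist x y \<longrightarrow> \<delta>\<^sub>0 \<le> N (\<lambda>n. F x n - F y n)))"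
proof -
  define \<delta>\<^sub>0 where "\<delta>\<^sub>0 = min 1 (1 / (2 * (2 ^ q * C)))"
  have CC: "0 < 2 ^ q * C" using C_pos by simp
  define s :: real where "s = (1/2) ^ (q + 3)"
  have "s \<le> (1/2) ^ 1" unfolding s_def by (rule power_decreasing) auto
  then have s: "0 < s" "s < 1" by (auto simp: s_def)
  define \<Lambda> where "\<Lambda> = ln (1 / s)"
  have \<Lambda>: "0 < \<Lambda>" using s by (simp add: \<Lambda>_def)
  have q: "0 < real q" using q_pos by simp
  define \<tau> where "\<tau> = s / (2 * q * \<Lambda>)"
  have \<tau>: "0 < \<tau>" using s \<Lambda> q by (simp add: \<tau>_def)
  show thesis
  proof (rule that[of \<delta>\<^sub>0])
    show "0 < \<delta>\<^sub>0" using CC by (simp add: \<delta>\<^sub>0_def)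
    fix l :: nat and R \<epsilon> :: real assume R: "0 \<le> R" and \<epsilon>: "0 < \<epsilon>" "\<epsilon> \<le> 1"
    define \<delta> where "\<delta> = (\<epsilon> / 4)\<^sup>2 / 8 * (\<epsilon> / 4) ^ q"
    have \<delta>: "0 < \<delta>" using \<epsilon> by (simp add: \<delta>_def)
    \<comment> \<open>The first bound on \<open>\<kappa>\<close> serves the separation of distant points, the second one, together with \<open>\<eta>\<close>,
      the closeness of near points: \<open>ln 4 * \<eta> + 2 * \<kappa> < 2 * \<delta> / q\<close>, since \<open>ln 4 \<le> 3\<close>.\<close>
    define \<kappa> where "\<kappa> = min (s / (2 * q)) (\<delta> / (4 * q))"
    have \<kappa>: "0 < \<kappa>" using s \<delta> q by (simp add: \<kappa>_def)
    define \<eta> where "\<eta> = \<delta> / (4 * q)"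
    have \<eta>: "0 < \<eta>" using \<delta> q by (simp add: \<eta>_def)
    obtain h :: "(nat \<Rightarrow> real) \<Rightarrow> nat \<Rightarrow> real" and D :: real where
      h: "\<And>x. x \<in> ell2 \<Longrightarrow> fin_supp (h x)" "\<And>x n. 0 \<le> h x n"
        "\<And>x n. h x n \<noteq> 0 \<Longrightarrow> fst (prod_decode n) = l"
      and pair: "\<And>x y. x \<in> ell2 \<Longrightarrow> y \<in> ell2 \<Longrightarrow> \<exists>J. finite J \<and> (\<forall>n. n \<notin> J \<longrightarrow> h x n = 0 \<and> h y n = 0) \<and>
         sum (h x) J = 1 \<and> sum (h y) J = 1 \<and>
         (ell2_dist x y \<le> R \<longrightarrow> (\<Sum>n\<in>J. \<bar>h x n - h y n\<bar>) \<le> \<eta>) \<and>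
         (D \<le> ell2_dist x y \<longrightarrow> (\<Sum>n\<in>J. min (h x n) (h y n)) \<le> \<tau>)"
      by (rule probability_layer[OF R \<eta> \<tau>, of l]) (rule that)
    have "\<exists>z. near_max \<kappa> (h x) z" if x: "x \<in> ell2" for x
    proof -
      obtain J where "finite J" "\<forall>n. n \<notin> J \<longrightarrow> h x n = 0" "sum (h x) J = 1"
        using pair[OF x x] by blast
      then show ?thesis using near_max_exists[of J "h x" \<kappa>] h(2) \<kappa> by blast
    qed
    then obtain F where F: "\<And>x. x \<in> ell2 \<Longrightarrow> near_max \<kappa> (h x) (F x)" by metis
    show "\<exists>F D.
       (\<forall>x\<in>ell2. fin_supp (F x) \<and> N (F x) \<le> 1 \<and> (\<forall>n. F x n \<noteq> 0 \<longrightarrow> fst (prod_decode n) = l)) \<and>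
       (\<forall>x\<in>ell2. \<forall>y\<in>ell2. (ell2_dist x y \<le> R \<longrightarrow> N (\<lambda>n. F x n - F y n) \<le> \<epsilon>) \<and>
                           (D \<le> ell2_dist x y \<longrightarrow> \<delta>\<^sub>0 \<le> N (\<lambda>n. F x n - F y n)))"
    proof (intro exI[of _ F] exI[of _ D] conjI ballI impI allI)
      fix x assume x: "x \<in> ell2"
      show fs: "fin_supp (F x)" using F[OF x] by (simp add: near_max_def)
      show "N (F x) \<le> 1" by (rule N_le_1[OF fs]) (use F[OF x] in \<open>simp add: near_max_def\<close>)
      fix n assume "F x n \<noteq> 0"
      then have "h x n \<noteq> 0" using F[OF x] by (metis near_max_def less_le)
      then show "fst (prod_decode n) = l" by (rule h(3))
    next
      fix x y assume x: "x \<in> ell2" and y: "y \<in> ell2" and close: "ell2_dist x y \<le> R"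
      obtain J where J: "finite J" "\<And>n. n \<notin> J \<Longrightarrow> h x n = 0 \<and> h y n = 0" "sum (h x) J = 1"
        "(\<Sum>n\<in>J. \<bar>h x n - h y n\<bar>) \<le> \<eta>" using pair[OF x y] close by blast
      show "N (\<lambda>n. F x n - F y n) \<le> \<epsilon>"
      proof (rule ccontr)
        assume "\<not> ?thesis"
        then have "\<epsilon> \<le> N (\<lambda>n. F x n - F y n)" by simp
        from near_max_close[OF J(1,2) h(2) h(2) J(3) F[OF x] F[OF y] \<epsilon> this]
        have "2 * \<delta> / q \<le> ln 4 * (\<Sum>n\<in>J. \<bar>h x n - h y n\<bar>) + 2 * \<kappa>" by (simp add: \<delta>_def)
        also have "\<dots> \<le> 3 * \<eta> + 2 * (\<delta> / (4 * q))"
          using J(4) ln_le_minus_one[of 4] by (intro add_mono mult_mono sum_nonneg) (use \<kappa> in \<open>auto simp: \<kappa>_def\<close>)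
        also have "\<dots> = (5 / 4) * (\<delta> / q)" by (simp add: \<eta>_def)
        finally show False using \<delta> q divide_pos_pos[OF \<delta> q] by simp
      qed
    next
      fix x y assume x: "x \<in> ell2" and y: "y \<in> ell2" and far: "D \<le> ell2_dist x y"
      obtain J where J: "finite J" "\<And>n. n \<notin> J \<Longrightarrow> h x n = 0 \<and> h y n = 0" "sum (h x) J = 1" "sum (h y) J = 1"
        "(\<Sum>n\<in>J. min (h x n) (h y n)) \<le> \<tau>" using pair[OF x y] far by blast
      have "\<kappa> \<le> s / (2 * q)" "\<tau> * \<Lambda> = s / (2 * q)" using \<Lambda> by (auto simp: \<kappa>_def \<tau>_def)
      then have "q * (\<kappa> + \<tau> * \<Lambda>) \<le> q * (s / (2 * q) + s / (2 * q))" by (intro mult_left_mono) auto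
      also have "\<dots> = s" using q by simp
      finally have par: "q * (\<kappa> + \<tau> * ln (1 / s)) \<le> s" by (simp add: \<Lambda>_def)
      have big: "1 \<le> 2 ^ q * C * N (\<lambda>n. F x n - F y n) ^ q"
        by (rule near_max_far[OF J(1,2) h(2) h(2) J(3,4) F[OF x] F[OF y] s_def J(5) par])
      show "\<delta>\<^sub>0 \<le> N (\<lambda>n. F x n - F y n)"
      proof (rule ccontr)
        let ?n = "N (\<lambda>n. F x n - F y n)"
        assume "\<not> ?thesis"
        then have lt: "?n \<le> 1" "?n \<le> 1 / (2 * (2 ^ q * C))" by (auto simp: \<delta>\<^sub>0_def)
        have "0 \<le> ?n" using F x y by (intro nonneg) (auto simp: near_max_def)
        then have "?n ^ q \<le> ?n ^ 1" using q_pos lt by (intro power_decreasing) auto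
        then have "?n ^ q \<le> 1 / (2 * (2 ^ q * C))" using lt by simp
        then have "2 ^ q * C * ?n ^ q \<le> 2 ^ q * C * (1 / (2 * (2 ^ q * C)))"
          using CC by (intro mult_left_mono) auto
        also have "\<dots> = 1 / 2" using C_pos by simp
        finally show False using big by simp
      qed
    qed
  qed
qed

end

section \<open>Gluing the layers to a coarse embedding\<close>

text \<open>Coarse embeddings in terms of bounds at each scale.  The lower control function at \<open>r\<close> is the
infimum of all distances of images of points at distance at least \<open>r\<close>; adding \<open>max r 0\<close> to this
set keeps it nonempty in case that there are no such points.\<close>

lemma coarse_embeddingI:
  assumes f: "f \<in> mspace A \<rightarrow> mspace B"
    and upper: "\<And>R. \<exists>S. \<forall>x\<in>mspace A. \<forall>y\<in>mspace A. mdist A x y \<le> R \<longrightarrow> mdist B (f x) (f y) \<le> S"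
    and lower: "\<And>Z. \<exists>D. \<forall>x\<in>mspace A. \<forall>y\<in>mspace A. D \<le> mdist A x y \<longrightarrow> Z \<le> mdist B (f x) (f y)"
  shows "coarse_embedding A B f"
proof -
  obtain S where S: "\<And>R x y. x \<in> mspace A \<Longrightarrow> y \<in> mspace A \<Longrightarrow> mdist A x y \<le> R \<Longrightarrow> mdist B (f x) (f y) \<le> S R"
    using upper by metis
  define V where "V r = insert (max r 0) {mdist B (f x) (f y) | x y. x \<in> mspace A \<and> y \<in> mspace A \<and> r \<le> mdist A x y}" for r
  have V0: "0 \<le> v" if "v \<in> V r" for v r using that by (auto simp: V_def)
  have bdd: "bdd_below (V r)" for r by (rule bdd_belowI) (rule V0)
  have ne: "V r \<noteq> {}" for r by (simp add: V_def)
  have "filterlim (\<lambda>r. Inf (V r)) at_top at_top"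
    unfolding filterlim_at_top
  proof
    fix Z :: real
    obtain D where D: "\<And>x y. x \<in> mspace A \<Longrightarrow> y \<in> mspace A \<Longrightarrow> D \<le> mdist A x y \<Longrightarrow> Z \<le> mdist B (f x) (f y)"
      using lower by blast
    have "Z \<le> Inf (V r)" if "max D Z \<le> r" for r
      using that D by (intro cInf_greatest ne) (auto simp: V_def)
    then show "\<forall>\<^sub>F r in at_top. Z \<le> Inf (V r)"
      unfolding eventually_at_top_linorder by blast
  qed
  moreover have "0 \<le> Inf (V r)" for r by (rule cInf_greatest[OF ne V0])
  moreover have "Inf (V (mdist A x y)) \<le> mdist B (f x) (f y)" if "x \<in> mspace A" "y \<in> mspace A" for x y
    using that by (intro cInf_lower bdd) (auto simp: V_def)
  moreover have "mdist B (f x) (f y) \<le> max 0 (S (mdist A x y))" if "x \<in> mspace A" "y \<in> mspace A" for x y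
    using S[OF that order.refl] by simp
  ultimately show ?thesis
    unfolding coarse_embedding_def using f
    by (intro conjI exI[of _ "\<lambda>r. Inf (V r)"] exI[of _ "\<lambda>r. max 0 (S r)"]) auto
qed

text \<open>The vectors \<open>F l x - F l y\<close> for different \<open>l\<close> have disjoint supports, so that they are the pieces
of their sum with respect to the colouring \<open>fst \<circ> prod_decode\<close>; the lower \<open>q\<close>-estimate
makes the norm of the sum large once many of them have norm at least \<open>\<delta>\<close>.\<close>

lemma (in lower_lattice_norm) coarse_embedding_from_layers:
  fixes e :: "nat \<Rightarrow> 'a::banach"
  assumes up: "\<And>b. fin_supp b \<Longrightarrow> norm (lin e b) \<le> N b"
    and K: "0 < K" and lo: "\<And>b. fin_supp b \<Longrightarrow> N b \<le> K * norm (lin e b)"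
  shows "embeds_coarsely ell2_metric (euclidean_metric :: 'a metric)"
proof -
  obtain \<delta> where \<delta>: "0 < \<delta>" and layers: "\<And>l R \<epsilon>. 0 \<le> R \<Longrightarrow> 0 < \<epsilon> \<Longrightarrow> \<epsilon> \<le> 1 \<Longrightarrow> \<exists>F D.
       (\<forall>x\<in>ell2. fin_supp (F x) \<and> N (F x) \<le> 1 \<and> (\<forall>n. F x n \<noteq> 0 \<longrightarrow> fst (prod_decode n) = l)) \<and>
       (\<forall>x\<in>ell2. \<forall>y\<in>ell2. (ell2_dist x y \<le> R \<longrightarrow> N (\<lambda>n. F x n - F y n) \<le> \<epsilon>) \<and>
                           (D \<le> ell2_dist x y \<longrightarrow> \<delta> \<le> N (\<lambda>n. F x n - F y n)))"
    by (rule sphere_layers) (rule that)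
  define layer where "layer l F D \<longleftrightarrow>
       (\<forall>x\<in>ell2. fin_supp (F x) \<and> N (F x) \<le> 1 \<and> (\<forall>n. F x n \<noteq> 0 \<longrightarrow> fst (prod_decode n) = l)) \<and>
       (\<forall>x\<in>ell2. \<forall>y\<in>ell2. (ell2_dist x y \<le> real l \<longrightarrow> N (\<lambda>n. F x n - F y n) \<le> (1/2) ^ l) \<and>
                           (D \<le> ell2_dist x y \<longrightarrow> \<delta> \<le> N (\<lambda>n. F x n - F y n)))" for l :: nat and F :: "(nat \<Rightarrow> real) \<Rightarrow> nat \<Rightarrow> real" and D :: real
  have "\<exists>F D. layer l F D" for l
    unfolding layer_def by (rule layers) (auto intro: power_le_one)
  then obtain F D where "\<And>l. layer l (F l) (D l)" by metis
  note FD = this[unfolded layer_def]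
  have fs: "fin_supp (F l x)" and N1: "N (F l x) \<le> 1" and supp: "\<And>n. F l x n \<noteq> 0 \<Longrightarrow> fst (prod_decode n) = l"
    if "x \<in> ell2" for l x using FD[of l] that by blast+
  have near: "N (\<lambda>n. F l x n - F l y n) \<le> (1/2) ^ l" if "x \<in> ell2" "y \<in> ell2" "ell2_dist x y \<le> real l" for l x y
    using FD[of l] that by blast
  have far: "\<delta> \<le> N (\<lambda>n. F l x n - F l y n)" if "x \<in> ell2" "y \<in> ell2" "D l \<le> ell2_dist x y" for l x y
    using FD[of l] that by blast
  define w where "w x y l = lin e (\<lambda>n. F l x n - F l y n)" for x y l
  have w_le: "norm (w x y l) \<le> N (\<lambda>n. F l x n - F l y n)" if "x \<in> ell2" "y \<in> ell2" for x y l
    unfolding w_def using that fs by (intro up) auto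
  have N2: "N (\<lambda>n. F l x n - F l y n) \<le> 2" if "x \<in> ell2" "y \<in> ell2" for x y l
  proof -
    have "N (\<lambda>n. F l x n + (- 1) * F l y n) \<le> N (F l x) + N (\<lambda>n. (- 1) * F l y n)"
      using that fs by (intro triangle fin_supp_scale) auto
    also have "N (\<lambda>n. (- 1) * F l y n) = \<bar>- 1\<bar> * N (F l y)" using that fs by (intro scale) auto
    finally show ?thesis using N1[OF that(1), of l] N1[OF that(2), of l] by simp
  qed
  \<comment> \<open>For points at distance at most \<open>m\<close>, the layers below \<open>m\<close> contribute at most \<open>2\<close> each, and the other
    ones form a geometric series.\<close>
  define bnd :: "nat \<Rightarrow> nat \<Rightarrow> real" where "bnd m l = (if l < m then 2 else 0) + (1/2) ^ l" for m l
  have bnd: "summable (bnd m)" for m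
    unfolding bnd_def by (intro summable_add summable_finite[of "{..<m}"] summable_geometric) auto
  have w_bnd: "norm (w x y l) \<le> bnd (nat \<lceil>R\<rceil>) l" if "x \<in> ell2" "y \<in> ell2" "ell2_dist x y \<le> R" for x y l R
  proof (cases "l < nat \<lceil>R\<rceil>")
    case True
    then show ?thesis using w_le[OF that(1,2), of l] N2[OF that(1,2), of l]
      by (simp add: bnd_def) (smt (verit) zero_le_power_eq zero_le_power divide_nonneg_nonneg)
  next
    case False
    then have "R \<le> real l" by linarith
    then have "norm (w x y l) \<le> (1/2) ^ l" using w_le[OF that(1,2), of l] near[OF that(1,2), of l] that(3) by linarith
    then show ?thesis using False by (simp add: bnd_def)
  qed
  have summ: "summable (w x y)" if "x \<in> ell2" "y \<in> ell2" for x y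
    by (rule summable_comparison_test'[OF bnd]) (use w_bnd[OF that order.refl] in auto)
  have zero: "(\<lambda>_. 0) \<in> ell2" by (rule fin_supp_ell2) simp
  define G where "G x = (\<Sum>l. w x (\<lambda>_. 0) l)" for x
  have G_diff: "G x - G y = (\<Sum>l. w x y l)" if "x \<in> ell2" "y \<in> ell2" for x y
  proof -
    have "w x (\<lambda>_. 0) l - w y (\<lambda>_. 0) l = w x y l" for l
      using fs[OF that(1)] fs[OF that(2)] fs[OF zero] by (simp add: w_def lin_diff)
    then show ?thesis
      unfolding G_def using suminf_diff[OF summ[OF that(1) zero] summ[OF that(2) zero]] by simp
  qed
  have "coarse_embedding ell2_metric (euclidean_metric :: 'a metric) G"
  proof (rule coarse_embeddingI)
    show "G \<in> mspace ell2_metric \<rightarrow> mspace euclidean_metric" by simp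
    show "\<exists>S. \<forall>x\<in>mspace ell2_metric. \<forall>y\<in>mspace ell2_metric.
            mdist ell2_metric x y \<le> R \<longrightarrow> mdist euclidean_metric (G x) (G y) \<le> S" for R
    proof (intro exI ballI impI)
      fix x y assume "x \<in> mspace ell2_metric" "y \<in> mspace ell2_metric" "mdist ell2_metric x y \<le> R"
      then have xy: "x \<in> ell2" "y \<in> ell2" "ell2_dist x y \<le> R" by simp_all
      have "norm (\<Sum>l. w x y l) \<le> (\<Sum>l. bnd (nat \<lceil>R\<rceil>) l)"
        using w_bnd[OF xy] bnd by (intro norm_suminf_le) auto
      then show "mdist euclidean_metric (G x) (G y) \<le> (\<Sum>l. bnd (nat \<lceil>R\<rceil>) l)"
        by (simp add: dist_norm G_diff xy)
    qed
    show "\<exists>D'. \<forall>x\<in>mspace ell2_metric. \<forall>y\<in>mspace ell2_metric.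
            D' \<le> mdist ell2_metric x y \<longrightarrow> Z \<le> mdist euclidean_metric (G x) (G y)" for Z
    proof -
      obtain k :: nat where k: "C * (K * max Z 0) ^ q / \<delta> ^ q < real k" using reals_Archimedean2 by blast
      have k: "C * (K * max Z 0) ^ q < real k * \<delta> ^ q"
        using k \<delta> by (simp add: divide_less_eq)
      have "Z \<le> norm (\<Sum>l. w x y l)" if xy: "x \<in> ell2" "y \<in> ell2" and D: "Max (D ` {..k}) \<le> ell2_dist x y" for x y
      proof (rule LIMSEQ_le_const)
        show "(\<lambda>n. norm (\<Sum>l<n. w x y l)) \<longlonglongrightarrow> norm (\<Sum>l. w x y l)"
          by (intro tendsto_norm summable_LIMSEQ summ xy)
        show "\<exists>n0. \<forall>n\<ge>n0. Z \<le> norm (\<Sum>l<n. w x y l)"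
        proof (intro exI allI impI)
          fix n assume n: "k \<le> n"
          define b where "b = (\<lambda>i. \<Sum>l<n. F l x i - F l y i)"
          have fd: "fin_supp (\<lambda>i. F l x i - F l y i)" for l using fs xy by auto
          have fb: "fin_supp b" unfolding b_def by (rule fin_supp_sum) (rule fd)
          have lin_b: "lin e b = (\<Sum>l<n. w x y l)"
            unfolding b_def w_def by (rule lin_sum) (rule fd)
          have piece: "restr {i. fst (prod_decode i) = l} b = (\<lambda>i. F l x i - F l y i)" if "l < n" for l
          proof
            fix i
            let ?l = "fst (prod_decode i)"
            have zero: "F l' x i - F l' y i = 0" if "?l \<noteq> l'" for l'
              using supp[OF xy(1), of l' i] supp[OF xy(2), of l' i] that by (metis diff_self)
            have "b i = (\<Sum>l'<n. if l' = ?l then F ?l x i - F ?l y i else 0)"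
              unfolding b_def by (intro sum.cong refl) (use zero in auto)
            then have "b i = (if ?l < n then F ?l x i - F ?l y i else 0)" by simp
            then show "restr {i. fst (prod_decode i) = l} b i = F l x i - F l y i"
              using \<open>l < n\<close> zero[of l] by (auto simp: restr_def)
          qed
          have "real k * \<delta> ^ q = (\<Sum>l<k. \<delta> ^ q)" by simp
          also have "\<dots> \<le> (\<Sum>l<k. N (restr {i. fst (prod_decode i) = l} b) ^ q)"
          proof (rule sum_mono)
            fix l assume l: "l \<in> {..<k}"
            have "D l \<le> Max (D ` {..k})" using l by (intro Max_ge) auto
            then have "D l \<le> ell2_dist x y" using D by linarith
            then have "\<delta> \<le> N (\<lambda>i. F l x i - F l y i)" by (rule far[OF xy])
            then show "\<delta> ^ q \<le> N (restr {i. fst (prod_decode i) = l} b) ^ q"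
              using piece[of l] l n \<delta> by (simp add: power_mono)
          qed
          also have "\<dots> \<le> C * N b ^ q" by (rule lower_q_estimate[OF fb]) simp
          also have "\<dots> \<le> C * (K * norm (lin e b)) ^ q"
            using C_pos fb by (intro mult_left_mono power_mono lo) auto
          finally have "C * (K * max Z 0) ^ q < C * (K * norm (lin e b)) ^ q" using k by linarith
          then have less: "(K * max Z 0) ^ q < (K * norm (lin e b)) ^ q" using C_pos by simp
          have "K * max Z 0 < K * norm (lin e b)"
            by (rule power_less_imp_less_base[OF less]) (use K in simp)
          then have "max Z 0 < norm (lin e b)" using K by simp
          then show "Z \<le> norm (\<Sum>l<n. w x y l)" using lin_b by simp
        qed
      qed
      then show ?thesis by (intro exI[of _ "Max (D ` {..k})"]) (auto simp: dist_norm G_diff)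
    qed
  qed
  then show ?thesis by (auto simp: embeds_coarsely_def)
qed

section \<open>Boundedness of unconditional expansions\<close>

lemma closure_midpoint:
  fixes B :: "'a::real_normed_vector set"
  assumes conv: "\<And>p p'. p \<in> B \<Longrightarrow> p' \<in> B \<Longrightarrow> (1/2) *\<^sub>R (p - p') \<in> B"
    and "u \<in> closure B" "v \<in> closure B" "0 < \<epsilon>"
  shows "\<exists>p\<in>B. norm ((1/2) *\<^sub>R (u - v) - p) < \<epsilon>"
proof -
  obtain p p' where p: "p \<in> B" "dist p u < \<epsilon>" "p' \<in> B" "dist p' v < \<epsilon>"
    using assms by (meson closure_approachable)
  have "(1/2) *\<^sub>R (u - v) - (1/2) *\<^sub>R (p - p') = (1/2) *\<^sub>R ((u - p) - (v - p'))"
    by (simp add: scaleR_right_diff_distrib)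
  then have "norm ((1/2) *\<^sub>R (u - v) - (1/2) *\<^sub>R (p - p')) = norm ((u - p) - (v - p')) / 2" by simp
  also have "\<dots> \<le> (norm (u - p) + norm (v - p')) / 2" by (intro divide_right_mono norm_triangle_ineq4) auto
  also have "\<dots> < \<epsilon>" using p by (simp add: dist_norm norm_minus_commute)
  finally show ?thesis using conv p by blast
qed

lemma finite_sums_bounded:
  fixes f :: "'i \<Rightarrow> 'a::real_normed_vector"
  assumes "f summable_on UNIV"
  shows "\<exists>m::nat. \<forall>A. finite A \<longrightarrow> norm (sum f A) \<le> real m"
proof -
  obtain s where "(sum f \<longlongrightarrow> s) (finite_subsets_at_top UNIV)"
    using assms unfolding summable_on_def has_sum_def by blast
  then have "\<forall>\<^sub>F X in finite_subsets_at_top UNIV. dist (sum f X) s < 1"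
    by (rule tendstoD) simp
  then obtain X where X: "finite X" "\<And>Y. finite Y \<Longrightarrow> X \<subseteq> Y \<Longrightarrow> dist (sum f Y) s < 1"
    unfolding eventually_finite_subsets_at_top by auto
  have "norm (sum f A) \<le> norm s + 1 + (\<Sum>i\<in>X. norm (f i))" if A: "finite A" for A
  proof -
    have "sum f (A \<union> X) = sum f A + sum f (X - A)"
      using A X(1) by (metis Un_Diff_cancel finite_Diff sum.union_disjoint Diff_disjoint)
    then have "norm (sum f A) \<le> norm (sum f (A \<union> X)) + norm (sum f (X - A))"
      by (metis add_diff_cancel_right' norm_triangle_ineq4)
    moreover have "norm (sum f (A \<union> X)) \<le> norm s + 1"
      using X(2)[of "A \<union> X"] A X(1) norm_triangle_ineq2[of "sum f (A \<union> X)" s] by (simp add: dist_norm)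
    moreover have "norm (sum f (X - A)) \<le> (\<Sum>i\<in>X - A. norm (f i))" by (rule norm_sum)
    moreover have "(\<Sum>i\<in>X - A. norm (f i)) \<le> (\<Sum>i\<in>X. norm (f i))"
      using X(1) by (intro sum_mono2) auto
    ultimately show ?thesis by linarith
  qed
  moreover obtain m :: nat where "norm s + 1 + (\<Sum>i\<in>X. norm (f i)) \<le> real m"
    using real_arch_simple by blast
  ultimately show ?thesis by (meson order_trans)
qed

text \<open>The norm is convex, and the vectors with multipliers \<open>0\<close> and \<open>1\<close> are the corners of the cube of
all vectors in question.\<close>

lemma convex_multiplier_bound:
  fixes v :: "'i \<Rightarrow> 'a::real_normed_vector"
  assumes "finite A" "\<And>B. B \<subseteq> A \<Longrightarrow> norm (w + sum v B) \<le> m" "\<And>i. i \<in> A \<Longrightarrow> 0 \<le> c i \<and> c i \<le> (1::real)"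
  shows "norm (w + (\<Sum>i\<in>A. c i *\<^sub>R v i)) \<le> m"
  using assms
proof (induction A arbitrary: w rule: finite_induct)
  case empty
  then show ?case using empty(1)[of "{}"] by simp
next
  case (insert a A)
  have "norm ((w + c a *\<^sub>R v a) + (\<Sum>i\<in>A. c i *\<^sub>R v i)) \<le> m"
  proof (rule insert.IH)
    fix B assume B: "B \<subseteq> A"
    then have fin: "finite B" "a \<notin> B" using insert finite_subset by auto
    have ca: "0 \<le> c a" "c a \<le> 1" using insert.prems(2)[of a] by auto
    have "w + c a *\<^sub>R v a + sum v B = (1 - c a) *\<^sub>R (w + sum v B) + c a *\<^sub>R (w + sum v (insert a B))"
      using fin by (simp add: scaleR_add_right scaleR_left_diff_distrib)
    also have "norm \<dots> \<le> norm ((1 - c a) *\<^sub>R (w + sum v B)) + norm (c a *\<^sub>R (w + sum v (insert a B)))"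
      by (rule norm_triangle_ineq)
    also have "\<dots> = (1 - c a) * norm (w + sum v B) + c a * norm (w + sum v (insert a B))"
      using ca by simp
    also have "\<dots> \<le> (1 - c a) * m + c a * m"
      using ca B insert.prems(1)[of B] insert.prems(1)[of "insert a B"] by (intro add_mono mult_left_mono) auto
    also have "\<dots> = m" by (simp add: algebra_simps)
    finally show "norm (w + c a *\<^sub>R v a + sum v B) \<le> m" .
  qed (use insert.prems in auto)
  then show ?case using insert by (simp add: add.assoc)
qed

lemma multiplier_bound:
  fixes v :: "'i \<Rightarrow> 'a::real_normed_vector"
  assumes A: "finite A" "\<And>B. B \<subseteq> A \<Longrightarrow> norm (sum v B) \<le> m" and c: "\<And>i. i \<in> A \<Longrightarrow> \<bar>c i\<bar> \<le> (1::real)"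
  shows "norm (\<Sum>i\<in>A. c i *\<^sub>R v i) \<le> 2 * m"
proof -
  have p: "norm (0 + (\<Sum>i\<in>A. max (c i) 0 *\<^sub>R v i)) \<le> m"
    using A c by (intro convex_multiplier_bound) (auto simp: abs_le_iff)
  have n: "norm (0 + (\<Sum>i\<in>A. max (- c i) 0 *\<^sub>R v i)) \<le> m"
    using A c by (intro convex_multiplier_bound) (auto simp: abs_le_iff)
  have "(\<Sum>i\<in>A. c i *\<^sub>R v i) = (\<Sum>i\<in>A. max (c i) 0 *\<^sub>R v i) - (\<Sum>i\<in>A. max (- c i) 0 *\<^sub>R v i)"
    unfolding sum_subtractf[symmetric] scaleR_left_diff_distrib[symmetric]
    by (intro sum.cong refl) (auto simp: max_def)
  then show ?thesis using p n norm_triangle_ineq4[of "\<Sum>i\<in>A. max (c i) 0 *\<^sub>R v i" "\<Sum>i\<in>A. max (- c i) 0 *\<^sub>R v i"]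
    by simp
qed

definition coef :: "(nat \<Rightarrow> 'a::real_normed_vector) \<Rightarrow> 'a \<Rightarrow> nat \<Rightarrow> real" where
  "coef e y = (THE a. (\<lambda>i. a i *\<^sub>R e i) sums y)"

lemma coef_unique:
  assumes "schauder_basis Y e" "y \<in> Y" "(\<lambda>i. a i *\<^sub>R e i) sums y"
  shows "coef e y = a"
proof -
  have "\<exists>!a. (\<lambda>i. a i *\<^sub>R e i) sums y" using assms by (simp add: schauder_basis_def)
  then show ?thesis unfolding coef_def using assms(3) by (intro the1_equality[where P = "\<lambda>a. (\<lambda>i. a i *\<^sub>R e i) sums y"])
qed

lemma coef_sums:
  assumes "schauder_basis Y e" "y \<in> Y"
  shows "(\<lambda>i. coef e y i *\<^sub>R e i) sums y"
proof -
  have "\<exists>!a. (\<lambda>i. a i *\<^sub>R e i) sums y" using assms by (simp add: schauder_basis_def)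
  then show ?thesis unfolding coef_def by (rule theI')
qed

lemma basis_nonzero:
  assumes "schauder_basis Y e" "subspace Y"
  shows "e j \<noteq> 0"
proof
  assume e: "e j = 0"
  have "(\<lambda>i. (0::real) *\<^sub>R e i) sums 0" by simp
  from coef_unique[OF assms(1) subspace_0[OF assms(2)] this] have 1: "coef e 0 = (\<lambda>_. 0)" .
  have "(\<lambda>i. (if i = j then 1 else 0 :: real) *\<^sub>R e i) = (\<lambda>i. 0)" using e by auto
  then have "(\<lambda>i. (if i = j then 1 else 0 :: real) *\<^sub>R e i) sums 0" by simp
  from coef_unique[OF assms(1) subspace_0[OF assms(2)] this] 1
  have "(\<lambda>i. if i = j then 1 else 0 :: real) = (\<lambda>_. 0)" by simp
  then show False by (auto dest: fun_cong[of _ _ j])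
qed

text \<open>The sets \<open>B m\<close> of vectors all of whose finite partial expansions have norm at most \<open>m\<close> cover \<open>Y\<close>.  By
Baire's theorem one of them is dense in some ball of \<open>Y\<close>; being convex and symmetric, it is dense
in a ball around \<open>0\<close>.  The factor \<open>norm y\<close> is obtained by scaling.\<close>

lemma dense_bounded_expansions:
  fixes Y :: "'a::banach set"
  assumes Y: "closed_subspace Y" and basis: "unconditional_basis Y e"
  shows "\<exists>K>0. \<forall>y\<in>Y. \<forall>\<epsilon>>0. \<exists>p\<in>Y.
    (\<forall>A. finite A \<longrightarrow> norm (\<Sum>i\<in>A. coef e p i *\<^sub>R e i) \<le> K * norm y) \<and> norm (y - p) < \<epsilon>"
proof -
  have sub: "subspace Y" and clY: "closed Y" using Y by (auto simp: closed_subspace_def)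
  have sb: "schauder_basis Y e" using basis by (simp add: unconditional_basis_def)
  define B where "B m = {y\<in>Y. \<forall>A. finite A \<longrightarrow> norm (\<Sum>i\<in>A. coef e y i *\<^sub>R e i) \<le> real m}" for m :: nat
  have BY: "B m \<subseteq> Y" for m by (auto simp: B_def)
  have coef_comb: "coef e (r *\<^sub>R (p - p')) i = r * (coef e p i - coef e p' i)" if "p \<in> Y" "p' \<in> Y" for r p p' i
  proof -
    have "(\<lambda>i. r *\<^sub>R (coef e p i *\<^sub>R e i - coef e p' i *\<^sub>R e i)) sums (r *\<^sub>R (p - p'))"
      using that sb by (intro sums_scaleR_right sums_diff coef_sums)
    then have "(\<lambda>i. (r * (coef e p i - coef e p' i)) *\<^sub>R e i) sums (r *\<^sub>R (p - p'))"
      by (simp add: scaleR_left_diff_distrib right_diff_distrib scaleR_right_diff_distrib)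
    moreover have "r *\<^sub>R (p - p') \<in> Y" using sub that by (intro subspace_scale subspace_diff)
    ultimately have "coef e (r *\<^sub>R (p - p')) = (\<lambda>i. r * (coef e p i - coef e p' i))"
      by (intro coef_unique[OF sb])
    then show ?thesis by simp
  qed
  have half: "(1/2) *\<^sub>R (p - p') \<in> B m" if "p \<in> B m" "p' \<in> B m" for p p' m
    unfolding B_def
  proof (intro CollectI conjI allI impI)
    show "(1/2) *\<^sub>R (p - p') \<in> Y" using that BY sub by (intro subspace_scale subspace_diff) auto
    fix A :: "nat set" assume A: "finite A"
    have "(\<Sum>i\<in>A. coef e ((1/2) *\<^sub>R (p - p')) i *\<^sub>R e i)
        = (1/2) *\<^sub>R ((\<Sum>i\<in>A. coef e p i *\<^sub>R e i) - (\<Sum>i\<in>A. coef e p' i *\<^sub>R e i))"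
    proof -
      have "p \<in> Y" "p' \<in> Y" using that BY by auto
      then show ?thesis
        by (simp add: coef_comb scaleR_sum_right sum_subtractf[symmetric] scaleR_left_diff_distrib[symmetric])
    qed
    also have "norm \<dots> \<le> (1/2) * (norm (\<Sum>i\<in>A. coef e p i *\<^sub>R e i) + norm (\<Sum>i\<in>A. coef e p' i *\<^sub>R e i))"
      by (simp add: norm_triangle_ineq4)
    also have "\<dots> \<le> (1/2) * (real m + real m)"
      using that A by (intro mult_left_mono add_mono) (auto simp: B_def)
    finally show "norm (\<Sum>i\<in>A. coef e ((1/2) *\<^sub>R (p - p')) i *\<^sub>R e i) \<le> real m" by simp
  qed
  have cover: "(\<Union>m. closure (B m)) = Y"
  proof
    show "(\<Union>m. closure (B m)) \<subseteq> Y" using closure_minimal[OF BY clY] by blast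
    show "Y \<subseteq> (\<Union>m. closure (B m))"
    proof
      fix y assume y: "y \<in> Y"
      then have "(\<lambda>i. coef e y i *\<^sub>R e i) summable_on UNIV"
        using basis coef_sums[OF sb y] unfolding unconditional_basis_def by blast
      from finite_sums_bounded[OF this] y have "\<exists>m. y \<in> B m" unfolding B_def by blast
      then show "y \<in> (\<Union>m. closure (B m))" using closure_subset by blast
    qed
  qed
  let ?X = "top_of_set Y"
  have "\<exists>m. ?X interior_of (closure (B m)) \<noteq> {}"
  proof (rule ccontr)
    assume "\<not> ?thesis"
    then have empty: "?X interior_of (closure (B m)) = {}" for m by blast
    have "?X interior_of \<Union>(range (\<lambda>m. closure (B m))) = {}"
    proof (rule Baire_category_alt)
      have "completely_metrizable_space ?X"
        using clY by (intro completely_metrizable_space_closedin completely_metrizable_space_euclidean) simp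
      then show "completely_metrizable_space ?X \<or> locally_compact_space ?X \<and> regular_space ?X" by blast
      show "closedin ?X T \<and> ?X interior_of T = {}" if "T \<in> range (\<lambda>m. closure (B m))" for T
      proof -
        obtain m where m: "T = closure (B m)" using \<open>T \<in> range _\<close> by blast
        then show ?thesis using empty closed_subset[OF closure_minimal[OF BY clY] closed_closure] by simp
      qed
    qed auto
    moreover have "?X interior_of Y = Y" by (metis interior_of_topspace topspace_euclidean_subtopology)
    ultimately have "Y = {}" using cover by simp
    then show False using subspace_0[OF sub] by simp
  qed
  then obtain m y0 where "y0 \<in> ?X interior_of (closure (B m))" by blast
  then obtain U where U: "openin ?X U" "y0 \<in> U" "U \<subseteq> closure (B m)" by (auto simp: interior_of_def)
  then obtain r where r: "0 < r" "\<And>y. y \<in> Y \<Longrightarrow> dist y y0 < r \<Longrightarrow> y \<in> closure (B m)" and y0: "y0 \<in> Y"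
    unfolding openin_euclidean_subtopology_iff by (meson subset_iff)
  have approx: "\<exists>p\<in>B m. norm (y - p) < \<epsilon>" if "y \<in> Y" "norm y < r" "0 < \<epsilon>" for y \<epsilon>
  proof -
    have "y0 + y \<in> closure (B m)" "y0 - y \<in> closure (B m)"
      using that y0 sub by (auto intro!: r subspace_add subspace_diff simp: dist_norm)
    from closure_midpoint[OF half this that(3)] show ?thesis
      by (simp add: scaleR_2[symmetric])
  qed
  define K where "K = 2 * real (Suc m) / r"
  have K: "0 < K" using r by (simp add: K_def)
  show ?thesis
  proof (intro exI[of _ K] conjI ballI allI impI)
    show "0 < K" by (rule K)
    fix y and \<epsilon> :: real assume y: "y \<in> Y" and \<epsilon>: "0 < \<epsilon>"
    show "\<exists>p\<in>Y. (\<forall>A. finite A \<longrightarrow> norm (\<Sum>i\<in>A. coef e p i *\<^sub>R e i) \<le> K * norm y) \<and> norm (y - p) < \<epsilon>"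
    proof (cases "y = 0")
      case True
      have "(\<lambda>i. (0::real) *\<^sub>R e i) sums 0" by simp
      from coef_unique[OF sb subspace_0[OF sub] this] show ?thesis
        using True \<epsilon> sub subspace_0 by (intro bexI[of _ 0]) auto
    next
      case False
      define t where "t = r / (2 * norm y)"
      have t: "0 < t" using r False by (simp add: t_def)
      have "t *\<^sub>R y \<in> Y" "norm (t *\<^sub>R y) < r"
        using y sub r False by (auto simp: subspace_scale t_def)
      then obtain p where p: "p \<in> B m" "norm (t *\<^sub>R y - p) < t * \<epsilon>"
        using approx[of "t *\<^sub>R y" "t * \<epsilon>"] t \<epsilon> by auto
      define p' where "p' = (1 / t) *\<^sub>R (p - 0)"
      have pY: "p \<in> Y" "0 \<in> Y" using p BY sub subspace_0 by auto
      have "(\<lambda>i. (0::real) *\<^sub>R e i) sums 0" by simp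
      from coef_unique[OF sb pY(2) this] have coef0: "coef e 0 i = 0" for i by simp
      have cp': "coef e p' i = (1 / t) * coef e p i" for i
        unfolding p'_def using coef_comb[OF pY] coef0 by simp
      show ?thesis
      proof (intro bexI[of _ p'] conjI allI impI)
        show "p' \<in> Y" unfolding p'_def using pY sub by (intro subspace_scale subspace_diff)
        have "t *\<^sub>R (y - p') = t *\<^sub>R y - p" using t by (simp add: p'_def scaleR_right_diff_distrib)
        then have "t * norm (y - p') < t * \<epsilon>" using p(2) t by (metis abs_of_pos norm_scaleR)
        then show "norm (y - p') < \<epsilon>" using t by simp
        fix A :: "nat set" assume A: "finite A"
        have "(\<Sum>i\<in>A. coef e p' i *\<^sub>R e i) = (1 / t) *\<^sub>R (\<Sum>i\<in>A. coef e p i *\<^sub>R e i)"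
          by (simp add: cp' scaleR_sum_right)
        then have "norm (\<Sum>i\<in>A. coef e p' i *\<^sub>R e i) = (1 / t) * norm (\<Sum>i\<in>A. coef e p i *\<^sub>R e i)"
          using t by simp
        also have "\<dots> \<le> (1 / t) * real (Suc m)"
          using p A t by (intro mult_left_mono) (auto simp: B_def intro: order_trans)
        also have "\<dots> = K * norm y" using r False by (simp add: t_def K_def)
        finally show "norm (\<Sum>i\<in>A. coef e p' i *\<^sub>R e i) \<le> K * norm y" .
      qed
    qed
  qed
qed

text \<open>The successive approximation argument of the open mapping theorem: \<open>y\<close> is a series of vectors \<open>p k\<close>
whose partial expansions have norm at most \<open>K * norm y * 2\<^sup>-\<^sup>k\<close>.  The coefficients of the \<open>p k\<close> can
be summed over \<open>k\<close>, and exchanging the two limits shows that these sums are the coefficients of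
\<open>y\<close>.  The exchange is necessary because continuity of the coefficients is not part of the
definition of a basis; it is a consequence of this lemma.\<close>

lemma expansions_bounded:
  fixes Y :: "'a::banach set"
  assumes Y: "closed_subspace Y" and basis: "unconditional_basis Y e"
  shows "\<exists>K>0. \<forall>y\<in>Y. \<forall>A. finite A \<longrightarrow> norm (\<Sum>i\<in>A. coef e y i *\<^sub>R e i) \<le> K * norm y"
proof -
  have sub: "subspace Y" using Y by (auto simp: closed_subspace_def)
  have sb: "schauder_basis Y e" using basis by (simp add: unconditional_basis_def)
  obtain K where K: "0 < K" and dense: "\<And>y \<epsilon>. y \<in> Y \<Longrightarrow> 0 < \<epsilon> \<Longrightarrow> \<exists>p\<in>Y.
    (\<forall>A. finite A \<longrightarrow> norm (\<Sum>i\<in>A. coef e p i *\<^sub>R e i) \<le> K * norm y) \<and> norm (y - p) < \<epsilon>"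
    using dense_bounded_expansions[OF assms] by blast
  have "norm (\<Sum>i\<in>A. coef e y i *\<^sub>R e i) \<le> (2 * K) * norm y" if y: "y \<in> Y" and A: "finite A" for y A
  proof (cases "y = 0")
    case True
    have "(\<lambda>i. (0::real) *\<^sub>R e i) sums 0" by simp
    from coef_unique[OF sb subspace_0[OF sub] this] show ?thesis using True by simp
  next
    case False
    define \<nu> where "\<nu> = norm y"
    have \<nu>: "0 < \<nu>" using False by (simp add: \<nu>_def)
    have "\<exists>p. z \<in> Y \<and> 0 < \<epsilon> \<longrightarrow> p \<in> Y \<and> (\<forall>A. finite A \<longrightarrow> norm (\<Sum>i\<in>A. coef e p i *\<^sub>R e i) \<le> K * norm z) \<and> norm (z - p) < \<epsilon>"
      for z and \<epsilon> :: real using dense[of z \<epsilon>] by blast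
    then obtain ap where ap: "\<And>z \<epsilon>. z \<in> Y \<Longrightarrow> 0 < \<epsilon> \<Longrightarrow> ap z \<epsilon> \<in> Y"
      "\<And>z \<epsilon> A. z \<in> Y \<Longrightarrow> 0 < \<epsilon> \<Longrightarrow> finite A \<Longrightarrow> norm (\<Sum>i\<in>A. coef e (ap z \<epsilon>) i *\<^sub>R e i) \<le> K * norm z"
      "\<And>z \<epsilon>. z \<in> Y \<Longrightarrow> 0 < \<epsilon> \<Longrightarrow> norm (z - ap z \<epsilon>) < \<epsilon>" by metis
    \<comment> \<open>\<open>z k\<close> is what remains of \<open>y\<close> after \<open>k\<close> approximations.\<close>
    define z where "z = rec_nat y (\<lambda>k z. z - ap z (\<nu> * (1/2) ^ Suc k))"
    have z0: "z 0 = y" and zS: "z (Suc k) = z k - ap (z k) (\<nu> * (1/2) ^ Suc k)" for k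
      by (simp_all add: z_def)
    have z: "z k \<in> Y \<and> norm (z k) \<le> \<nu> * (1/2) ^ k" for k
    proof (induction k)
      case 0
      then show ?case using y by (simp add: z0 \<nu>_def)
    next
      case (Suc k)
      have "0 < \<nu> * (1/2) ^ Suc k" using \<nu> by simp
      then show ?case using ap(1,3)[of "z k" "\<nu> * (1/2) ^ Suc k"] Suc sub unfolding zS
        by (auto intro: subspace_diff less_imp_le)
    qed
    define p where "p k = z k - z (Suc k)" for k
    have pY: "p k \<in> Y" for k unfolding p_def using z sub by (intro subspace_diff) auto
    define g where "g k = K * \<nu> * (1/2) ^ k" for k :: nat
    have g: "summable g" unfolding g_def by (intro summable_mult summable_geometric) auto
    have "(\<Sum>k. g k) = K * \<nu> * (\<Sum>k. (1/2) ^ k)"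
      unfolding g_def by (intro suminf_mult summable_geometric) auto
    also have "(\<Sum>k. (1/2::real) ^ k) = 2" by (simp add: suminf_geometric)
    finally have g_sum: "(\<Sum>k. g k) = 2 * K * \<nu>" by simp
    define P where "P A k = (\<Sum>i\<in>A. coef e (p k) i *\<^sub>R e i)" for A k
    have P_le: "norm (P A k) \<le> g k" if "finite A" for A k
    proof -
      have "p k = ap (z k) (\<nu> * (1/2) ^ Suc k)" by (simp add: p_def zS)
      then have "norm (P A k) \<le> K * norm (z k)"
        using ap(2)[of "z k" "\<nu> * (1/2) ^ Suc k" A] that z \<nu> by (simp add: P_def)
      also have "\<dots> \<le> K * (\<nu> * (1/2) ^ k)" using z K by (intro mult_left_mono) auto
      finally show ?thesis by (simp add: g_def)
    qed
    have P_lim: "(\<lambda>n. P {..<n} k) \<longlonglongrightarrow> p k" for k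
      using coef_sums[OF sb pY] by (simp add: sums_def P_def)
    have p_sums: "p sums y"
    proof -
      have "(\<lambda>k. z k) \<longlonglongrightarrow> 0"
      proof (rule Lim_null_comparison)
        show "\<forall>\<^sub>F k in sequentially. norm (z k) \<le> \<nu> * (1/2) ^ k" using z by simp
        show "(\<lambda>k. \<nu> * (1/2) ^ k) \<longlonglongrightarrow> 0"
          by (intro tendsto_mult_right_zero LIMSEQ_power_zero) simp
      qed
      then have "(\<lambda>k. z k - z (Suc k)) sums (z 0 - 0)" by (rule telescope_sums')
      then show ?thesis by (simp add: p_def[abs_def] z0)
    qed
    have coef_summable: "summable (\<lambda>k. coef e (p k) i)" for i
    proof (rule summable_comparison_test')
      show "summable (\<lambda>k. g k / norm (e i))" using g by (rule summable_divide)
      fix k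
      have "norm (P {i} k) \<le> g k" by (rule P_le) simp
      then show "norm (coef e (p k) i) \<le> g k / norm (e i)"
        using basis_nonzero[OF sb sub, of i] by (simp add: P_def pos_le_divide_eq)
    qed
    define b where "b i = (\<Sum>k. coef e (p k) i)" for i
    have b_sum: "(\<Sum>i\<in>A. b i *\<^sub>R e i) = (\<Sum>k. P A k)" for A
    proof -
      have "(\<Sum>i\<in>A. b i *\<^sub>R e i) = (\<Sum>i\<in>A. \<Sum>k. coef e (p k) i *\<^sub>R e i)"
        unfolding b_def using coef_summable by (intro sum.cong refl suminf_scaleR_left)
      also have "\<dots> = (\<Sum>k. P A k)"
        unfolding P_def using coef_summable
        by (intro suminf_sum[symmetric] bounded_linear.summable[OF bounded_linear_scaleR_left])
      finally show ?thesis .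
    qed
    have P_summable: "summable (P A)" if "finite A" for A
      by (rule summable_comparison_test'[OF g]) (rule P_le[OF that])
    have "uniform_limit UNIV (\<lambda>m n. \<Sum>k<m. P {..<n} k) (\<lambda>n. \<Sum>k. P {..<n} k) sequentially"
      by (rule Weierstrass_m_test[OF _ g]) (use P_le in auto)
    \<comment> \<open>Exchange of the sum over \<open>k\<close> with the limit of partial expansions, by uniform convergence.\<close>
    then have "(\<lambda>n. \<Sum>k. P {..<n} k) \<longlonglongrightarrow> y"
    proof (rule swap_uniform_limit'[rotated 2])
      show "\<forall>\<^sub>F m in sequentially. ((\<lambda>n. \<Sum>k<m. P {..<n} k) \<longlongrightarrow> (\<Sum>k<m. p k)) sequentially"
        by (intro always_eventually allI tendsto_sum P_lim)
      show "(\<lambda>m. \<Sum>k<m. p k) \<longlonglongrightarrow> y" using p_sums by (simp add: sums_def)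
    qed auto
    then have "(\<lambda>i. b i *\<^sub>R e i) sums y" by (simp add: sums_def b_sum)
    then have "coef e y = b" by (rule coef_unique[OF sb y])
    then have "norm (\<Sum>i\<in>A. coef e y i *\<^sub>R e i) = norm (\<Sum>k. P A k)" by (simp add: b_sum)
    also have "\<dots> \<le> (\<Sum>k. g k)" by (rule norm_suminf_le[OF P_le[OF A] g])
    finally show ?thesis by (simp add: g_sum \<nu>_def)
  qed
  then show ?thesis using K by (intro exI[of _ "2 * K"]) auto
qed

section \<open>The lattice norm of an unconditional basis\<close>

text \<open>The lattice norm generated by the norm of the space: the supremum of the norms of all
combinations that arise from \<open>x\<close> by changing signs and decreasing absolute values of coefficients.\<close>

definition lat :: "(nat \<Rightarrow> 'a::real_normed_vector) \<Rightarrow> (nat \<Rightarrow> real) \<Rightarrow> real" where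
  "lat e x = (SUP b\<in>{b. \<forall>i. \<bar>b i\<bar> \<le> \<bar>x i\<bar>}. norm (lin e b))"

lemma lin_in_subspace: "subspace Y \<Longrightarrow> range e \<subseteq> Y \<Longrightarrow> lin e b \<in> Y"
  unfolding lin_def by (intro subspace_sum subspace_scale) auto

lemma unconditional_domination:
  fixes Y :: "'a::banach set"
  assumes Y: "closed_subspace Y" and basis: "unconditional_basis Y e"
  shows "\<exists>K>0. \<forall>x b. fin_supp x \<longrightarrow> (\<forall>i. \<bar>b i\<bar> \<le> \<bar>x i\<bar>) \<longrightarrow> norm (lin e b) \<le> K * norm (lin e x)"
proof -
  have sb: "schauder_basis Y e" using basis by (simp add: unconditional_basis_def)
  obtain K where K: "0 < K" "\<And>y A. y \<in> Y \<Longrightarrow> finite A \<Longrightarrow> norm (\<Sum>i\<in>A. coef e y i *\<^sub>R e i) \<le> K * norm y"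
    using expansions_bounded[OF assms] by blast
  have "norm (lin e b) \<le> (2 * K) * norm (lin e x)" if x: "fin_supp x" and le: "\<And>i. \<bar>b i\<bar> \<le> \<bar>x i\<bar>" for x b
  proof -
    let ?S = "{i. x i \<noteq> 0}"
    have fin: "finite ?S" using x by (simp add: fin_supp_def)
    have y: "lin e x \<in> Y"
      using Y sb by (intro lin_in_subspace) (auto simp: closed_subspace_def schauder_basis_def)
    have "(\<lambda>i. x i *\<^sub>R e i) sums (\<Sum>i\<in>?S. x i *\<^sub>R e i)" by (rule sums_finite[OF fin]) auto
    then have coef: "coef e (lin e x) = x" unfolding lin_def[symmetric] by (rule coef_unique[OF sb y])
    have b_eq: "b i = (b i / x i) * x i" for i using le[of i] by (cases "x i = 0") auto
    have "lin e b = (\<Sum>i\<in>?S. b i *\<^sub>R e i)"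
      by (rule lin_eq_sum[OF fin]) (use le in \<open>metis (mono_tags) abs_le_zero_iff abs_zero mem_Collect_eq\<close>)
    also have "\<dots> = (\<Sum>i\<in>?S. (b i / x i) *\<^sub>R (x i *\<^sub>R e i))"
      using b_eq by (intro sum.cong refl) (metis scaleR_scaleR)
    also have "norm \<dots> \<le> 2 * (K * norm (lin e x))"
    proof (rule multiplier_bound[OF fin])
      show "norm (\<Sum>i\<in>B. x i *\<^sub>R e i) \<le> K * norm (lin e x)" if "B \<subseteq> ?S" for B
        using K(2)[OF y, of B] finite_subset[OF that fin] by (simp add: coef)
      show "\<bar>b i / x i\<bar> \<le> 1" for i using le[of i] by (simp add: abs_divide divide_le_eq_1)
    qed
    finally show ?thesis by simp
  qed
  then show ?thesis using K(1) by (intro exI[of _ "2 * K"]) auto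
qed

context
  fixes e :: "nat \<Rightarrow> 'a::real_normed_vector" and K :: real
  assumes K: "0 < K"
    and dom: "\<And>x b. fin_supp x \<Longrightarrow> (\<And>i. \<bar>b i\<bar> \<le> \<bar>x i\<bar>) \<Longrightarrow> norm (lin e b) \<le> K * norm (lin e x)"
begin

lemma lat_upper: "fin_supp x \<Longrightarrow> (\<And>i. \<bar>b i\<bar> \<le> \<bar>x i\<bar>) \<Longrightarrow> norm (lin e b) \<le> lat e x"
  unfolding lat_def by (intro cSUP_upper bdd_aboveI2[of _ _ "K * norm (lin e x)"]) (auto intro: dom)

lemma lat_least: "(\<And>b. (\<And>i. \<bar>b i\<bar> \<le> \<bar>x i\<bar>) \<Longrightarrow> norm (lin e b) \<le> B) \<Longrightarrow> lat e x \<le> B"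
  unfolding lat_def by (intro cSUP_least) auto

lemma norm_le_lat: "fin_supp x \<Longrightarrow> norm (lin e x) \<le> lat e x"
  by (rule lat_upper) auto

lemma lat_le_norm: "fin_supp x \<Longrightarrow> lat e x \<le> K * norm (lin e x)"
  by (intro lat_least dom)

lemma fin_supp_dominated: "fin_supp x \<Longrightarrow> (\<And>i. \<bar>b i\<bar> \<le> \<bar>x i\<bar>) \<Longrightarrow> fin_supp b"
  by (erule fin_supp_mono) (metis abs_le_zero_iff abs_zero)

lemma lattice_norm_lat:
  assumes nz: "\<And>i. e i \<noteq> 0"
  shows "lattice_norm (lat e)"
proof
  fix x y :: "nat \<Rightarrow> real" assume x: "fin_supp x" and y: "fin_supp y"
  show "lat e (\<lambda>i. x i + y i) \<le> lat e x + lat e y"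
  proof (rule lat_least)
    fix b assume b: "\<And>i. \<bar>b i\<bar> \<le> \<bar>x i + y i\<bar>"
    \<comment> \<open>Riesz decomposition: \<open>b\<close> is the sum of its truncation to \<open>x\<close> and a remainder dominated by \<open>y\<close>.\<close>
    define c where "c i = max (- \<bar>x i\<bar>) (min \<bar>x i\<bar> (b i))" for i
    have c: "\<bar>c i\<bar> \<le> \<bar>x i\<bar>" "\<bar>b i - c i\<bar> \<le> \<bar>y i\<bar>" for i
      using b[of i] by (auto simp: c_def min_def max_def)
    have fc: "fin_supp c" "fin_supp (\<lambda>i. b i - c i)"
      using fin_supp_dominated[OF x c(1)] fin_supp_dominated[OF y c(2)] by auto
    have "lin e b = lin e c + lin e (\<lambda>i. b i - c i)" using lin_add[OF fc, of e] by simp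
    also have "norm \<dots> \<le> norm (lin e c) + norm (lin e (\<lambda>i. b i - c i))" by (rule norm_triangle_ineq)
    also have "\<dots> \<le> lat e x + lat e y" by (intro add_mono lat_upper x y c)
    finally show "norm (lin e b) \<le> lat e x + lat e y" .
  qed
next
  have le: "lat e (\<lambda>i. r * x i) \<le> \<bar>r\<bar> * lat e x" if x: "fin_supp x" for x r
  proof (rule lat_least)
    fix b assume b: "\<And>i. \<bar>b i\<bar> \<le> \<bar>r * x i\<bar>"
    show "norm (lin e b) \<le> \<bar>r\<bar> * lat e x"
    proof (cases "r = 0")
      case True
      then have "b = (\<lambda>i. 0)" using b by auto
      then show ?thesis using True by (simp add: lin_def)
    next
      case False
      then have "\<bar>(1 / r) * b i\<bar> \<le> \<bar>x i\<bar>" for i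
        using b[of i] by (simp add: abs_mult field_simps)
      then have "norm (lin e (\<lambda>i. (1 / r) * b i)) \<le> lat e x" by (intro lat_upper x)
      then show ?thesis using False unfolding lin_scale by (simp add: field_simps)
    qed
  qed
  fix x :: "nat \<Rightarrow> real" and r :: real assume x: "fin_supp x"
  show "lat e (\<lambda>i. r * x i) = \<bar>r\<bar> * lat e x"
  proof (cases "r = 0")
    case True
    have "0 \<le> norm (lin e (\<lambda>i. 0))" by simp
    also have "\<dots> \<le> lat e (\<lambda>i. 0)" by (rule norm_le_lat) simp
    finally show ?thesis using le[OF x, of 0] True by simp
  next
    case False
    have "lat e x \<le> \<bar>1 / r\<bar> * lat e (\<lambda>i. r * x i)"
      using le[of "\<lambda>i. r * x i" "1 / r"] x False by auto
    then show ?thesis using le[OF x, of r] False by (simp add: field_simps)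
  qed
next
  fix x y :: "nat \<Rightarrow> real" assume y: "fin_supp y" and le: "\<And>i. \<bar>x i\<bar> \<le> \<bar>y i\<bar>"
  show "lat e x \<le> lat e y"
    by (intro lat_least lat_upper y) (use le order_trans in blast)
next
  fix i
  have "lin e (\<lambda>j. if j = i then 1 else 0) = (\<Sum>j\<in>{i}. (if j = i then 1 else 0) *\<^sub>R e j)"
    by (rule lin_eq_sum) auto
  then have "0 < norm (lin e (\<lambda>j. if j = i then 1 else 0))" using nz by simp
  also have "\<dots> \<le> lat e (\<lambda>j. if j = i then 1 else 0)"
    by (rule norm_le_lat) (simp add: fin_supp_def)
  finally show "0 < lat e (\<lambda>j. if j = i then 1 else 0)" .
qed

end

section \<open>Spaces without uniform copies of finite-dimensional sup-norm spaces\<close>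

lemma bcontfun_nat:
  assumes "\<And>i. n \<le> i \<Longrightarrow> a i = (0::real)"
  obtains g where "g \<in> ell_inf n" "\<And>i. apply_bcontfun g i = a i"
proof -
  have "range a \<subseteq> insert 0 (a ` {..<n})" using assms not_less by blast
  then have "a \<in> bcontfun"
    unfolding bcontfun_def by (auto intro!: finite_imp_bounded intro: finite_subset)
  then have "apply_bcontfun (Bcontfun a) = a" by (rule Bcontfun_inverse)
  then show thesis using assms by (intro that[of "Bcontfun a"]) (auto simp: ell_inf_def)
qed

lemma subspace_ell_inf: "subspace (ell_inf n)"
  by (auto simp: subspace_def ell_inf_def)

lemma complete_ell_inf: "complete (ell_inf n)"
  unfolding complete_def
proof (intro allI impI, elim conjE)
  fix f :: "nat \<Rightarrow> nat \<Rightarrow>\<^sub>C real" assume f: "\<forall>m. f m \<in> ell_inf n" and "Cauchy f"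
  have coord: "Cauchy (\<lambda>m. apply_bcontfun (f m) i)" for i
    unfolding Cauchy_def
  proof (intro allI impI)
    fix \<epsilon> :: real assume "0 < \<epsilon>"
    with \<open>Cauchy f\<close> obtain M where M: "\<forall>m\<ge>M. \<forall>k\<ge>M. dist (f m) (f k) < \<epsilon>" unfolding Cauchy_def by blast
    have "dist (apply_bcontfun (f m) i) (apply_bcontfun (f k) i) < \<epsilon>" if "M \<le> m" "M \<le> k" for m k
      using dist_bounded[of "f m" i "f k"] M that by (meson le_less_trans)
    then show "\<exists>M. \<forall>m\<ge>M. \<forall>k\<ge>M. dist (apply_bcontfun (f m) i) (apply_bcontfun (f k) i) < \<epsilon>" by blast
  qed
  define a where "a i = lim (\<lambda>m. apply_bcontfun (f m) i)" for i
  have lim: "(\<lambda>m. apply_bcontfun (f m) i) \<longlonglongrightarrow> a i" for i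
    unfolding a_def using coord Cauchy_convergent convergent_LIMSEQ_iff by blast
  have a0: "a i = 0" if "n \<le> i" for i
    using f that by (simp add: a_def ell_inf_def)
  obtain g where g: "g \<in> ell_inf n" "\<And>i. apply_bcontfun g i = a i"
    using bcontfun_nat[of n a] a0 by blast
  have "f \<longlonglongrightarrow> g"
  proof (rule LIM_zero_cancel, rule Lim_null_comparison)
    show "(\<lambda>m. \<Sum>i<n. \<bar>apply_bcontfun (f m) i - a i\<bar>) \<longlonglongrightarrow> 0"
      using lim by (intro tendsto_null_sum tendsto_rabs_zero LIM_zero)
    have "norm (f m - g) \<le> (\<Sum>i<n. \<bar>apply_bcontfun (f m) i - a i\<bar>)" for m
    proof (rule norm_bound)
      fix i
      show "norm (apply_bcontfun (f m - g) i) \<le> (\<Sum>i<n. \<bar>apply_bcontfun (f m) i - a i\<bar>)"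
      proof (cases "i < n")
        case True
        then show ?thesis
          using member_le_sum[of i "{..<n}" "\<lambda>i. \<bar>apply_bcontfun (f m) i - a i\<bar>"] by (simp add: g)
      next
        case False
        then have "apply_bcontfun (f m - g) i = 0" using f g(1) by (simp add: ell_inf_def)
        then show ?thesis by (simp add: sum_nonneg)
      qed
    qed
    then show "\<forall>\<^sub>F m in sequentially. norm (f m - g) \<le> (\<Sum>i<n. \<bar>apply_bcontfun (f m) i - a i\<bar>)" by simp
  qed
  then show "\<exists>l\<in>ell_inf n. f \<longlonglongrightarrow> l" using g(1) by blast
qed

text \<open>Two-sided estimates of linear combinations by the largest coefficient make \<open>g \<mapsto> (\<Sum>i<n. g i *\<^sub>R v i)\<close>
an isomorphism of \<open>ell_inf n\<close> onto the span of the vectors \<open>v i\<close>, which is closed as an image of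
a complete space under a map that is bounded below.\<close>

lemma ell_inf_span:
  fixes v :: "nat \<Rightarrow> 'a::banach"
  assumes Y: "subspace Y" "\<And>i. v i \<in> Y" and L: "0 < L" and U: "0 \<le> U"
    and lower: "\<And>g. g \<in> ell_inf n \<Longrightarrow> norm g \<le> L * norm (\<Sum>i<n. apply_bcontfun g i *\<^sub>R v i)"
    and upper: "\<And>g. g \<in> ell_inf n \<Longrightarrow> norm (\<Sum>i<n. apply_bcontfun g i *\<^sub>R v i) \<le> U * norm g"
  shows "\<exists>E T. closed_subspace E \<and> E \<subseteq> Y \<and> dim E = n \<and> linear_iso_betw T E (ell_inf n) \<and>
    onorm_on E T * onorm_on (ell_inf n) (inv_into E T) \<le> L * U"
proof -
  define f where "f g = (\<Sum>i<n. apply_bcontfun g i *\<^sub>R v i)" for g :: "nat \<Rightarrow>\<^sub>C real"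
  have f_add: "f (g + h) = f g + f h" for g h
    by (simp add: f_def scaleR_left_distrib sum.distrib)
  have f_scale: "f (r *\<^sub>R g) = r *\<^sub>R f g" for r g
    by (simp add: f_def scaleR_sum_right)
  have "linear f" by (rule linearI) (rule f_add f_scale)+
  have bl: "bounded_linear f"
  proof (rule bounded_linear_intro[OF f_add f_scale])
    fix g
    have "norm (f g) \<le> (\<Sum>i<n. norm (apply_bcontfun g i *\<^sub>R v i))" unfolding f_def by (rule norm_sum)
    also have "\<dots> \<le> (\<Sum>i<n. norm g * norm (v i))"
      using norm_bounded[of g] by (intro sum_mono) (simp add: mult_right_mono)
    finally show "norm (f g) \<le> norm g * (\<Sum>i<n. norm (v i))" by (simp add: sum_distrib_left)
  qed
  define E where "E = f ` ell_inf n"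
  have inj: "inj_on f (ell_inf n)"
  proof (rule inj_onI)
    fix g h assume gh: "g \<in> ell_inf n" "h \<in> ell_inf n" "f g = f h"
    have "g - h \<in> ell_inf n" using gh subspace_ell_inf by (intro subspace_diff)
    then have "norm (g - h) \<le> L * norm (f (g - h))" unfolding f_def by (rule lower)
    also have "f (g - h) = 0" using gh \<open>linear f\<close> by (simp add: linear_diff)
    finally show "g = h" by simp
  qed
  define T where "T = inv_into (ell_inf n) f"
  have Tf: "T (f g) = g" if "g \<in> ell_inf n" for g using inj that by (simp add: T_def)
  have bij: "bij_betw T E (ell_inf n)"
    unfolding T_def E_def by (intro bij_betw_inv_into bij_betw_imageI inj) simp
  have inv_T: "inv_into E T g = f g" if "g \<in> ell_inf n" for g
    using that Tf bij by (intro inv_into_f_eq) (auto simp: bij_betw_def E_def)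
  have sE: "subspace E" unfolding E_def using \<open>linear f\<close> subspace_ell_inf by (rule linear_subspace_image)
  have "complete E" unfolding E_def
  proof (rule complete_isometric_image[OF _ subspace_ell_inf bl _ complete_ell_inf])
    show "0 < 1 / L" using L by simp
    show "\<forall>g\<in>ell_inf n. 1 / L * norm g \<le> norm (f g)"
      using lower L by (simp add: f_def divide_le_eq mult.commute)
  qed
  then have "closed E" by (rule complete_imp_closed)
  moreover have "E \<subseteq> Y"
    unfolding E_def f_def using Y by (auto intro!: subspace_sum subspace_scale)
  moreover have "dim E = n"
  proof -
    have zero: "a i = 0" if "(\<Sum>i<n. a i *\<^sub>R v i) = 0" "i < n" for a :: "nat \<Rightarrow> real" and i
    proof -
      obtain g where g: "g \<in> ell_inf n" "\<And>i. apply_bcontfun g i = (if i < n then a i else 0)"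
        by (rule bcontfun_nat[of n "\<lambda>i. if i < n then a i else 0"]) auto
      have "f g = (\<Sum>i<n. a i *\<^sub>R v i)" by (simp add: f_def g)
      then have "norm g \<le> 0" using lower[OF g(1)] that by (simp add: f_def)
      then show ?thesis using g(2)[of i] that(2) by simp
    qed
    have inj_v: "inj_on v {..<n}"
    proof (rule inj_onI, rule ccontr)
      fix i j assume ij: "i \<in> {..<n}" "j \<in> {..<n}" "v i = v j" "i \<noteq> j"
      let ?a = "\<lambda>k. (if k = i then 1 else 0) - (if k = j then 1 else 0) :: real"
      have "(\<Sum>k<n. ?a k *\<^sub>R v k) = (\<Sum>k<n. if k = i then v k else 0) - (\<Sum>k<n. if k = j then v k else 0)"
        unfolding sum_subtractf[symmetric] by (intro sum.cong) auto
      also have "\<dots> = 0" using ij by simp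
      finally have "?a i = 0" by (rule zero) (use ij in simp)
      then show False using ij by simp
    qed
    have "independent (v ` {..<n})"
    proof (rule independent_if_scalars_zero)
      fix c x assume s: "(\<Sum>x\<in>v ` {..<n}. c x *\<^sub>R x) = 0" and x: "x \<in> v ` {..<n}"
      have "(\<Sum>i<n. c (v i) *\<^sub>R v i) = 0" using s by (simp add: sum.reindex[OF inj_v])
      then show "c x = 0" using zero[of "\<lambda>i. c (v i)"] x by auto
    qed simp
    moreover have "span (v ` {..<n}) = E"
    proof
      show "span (v ` {..<n}) \<subseteq> E"
      proof (rule span_minimal[OF _ sE], clarify)
        fix j assume j: "j < n"
        obtain g where g: "g \<in> ell_inf n" "\<And>i. apply_bcontfun g i = (if i = j then 1 else 0)"
          by (rule bcontfun_nat[of n "\<lambda>i. if i = j then 1 else 0"]) (use j in auto)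
        have "f g = (\<Sum>i<n. if i = j then v i else 0)" unfolding f_def by (intro sum.cong) (auto simp: g)
        then have "f g = v j" using j by simp
        then show "v j \<in> E" using g(1) unfolding E_def by (metis imageI)
      qed
      show "E \<subseteq> span (v ` {..<n})"
      proof
        fix y assume "y \<in> E"
        then obtain g where "y = f g" by (auto simp: E_def)
        then show "y \<in> span (v ` {..<n})" unfolding f_def by (auto intro: span_sum span_scale span_base)
      qed
    qed
    ultimately show ?thesis
      using dim_span_eq_card_independent[of "v ` {..<n}"] card_image[OF inj_v] by simp
  qed
  moreover have "linear_iso_betw T E (ell_inf n)"
    unfolding linear_iso_betw_def
  proof (intro conjI ballI allI bij)
    fix y z assume "y \<in> E" "z \<in> E"
    then obtain g h where gh: "g \<in> ell_inf n" "h \<in> ell_inf n" "y = f g" "z = f h" by (auto simp: E_def)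
    show "T (y + z) = T y + T z"
      using gh subspace_add[OF subspace_ell_inf gh(1,2)] by (simp add: Tf f_add[symmetric])
  next
    fix r y assume "y \<in> E"
    then obtain g where g: "g \<in> ell_inf n" "y = f g" by (auto simp: E_def)
    show "T (r *\<^sub>R y) = r *\<^sub>R T y"
      using g subspace_scale[OF subspace_ell_inf g(1), of r] by (simp add: Tf f_scale[symmetric])
  qed
  moreover have "onorm_on E T * onorm_on (ell_inf n) (inv_into E T) \<le> L * U"
  proof (rule mult_mono)
    have "norm (T y) / norm y \<le> L" if y: "y \<in> E" for y
    proof -
      obtain g where g: "g \<in> ell_inf n" "y = f g" using y by (auto simp: E_def)
      have "norm g \<le> L * norm (f g)" unfolding f_def by (rule lower[OF g(1)])
      then show ?thesis using g L by (simp add: Tf divide_le_eq)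
    qed
    then show "onorm_on E T \<le> L"
      unfolding onorm_on_def using subspace_0[OF sE] by (intro cSUP_least) auto
    have le: "norm (inv_into E T g) / norm g \<le> U" if "g \<in> ell_inf n" for g
      using that upper U inv_T by (auto simp: f_def divide_le_eq)
    then show "onorm_on (ell_inf n) (inv_into E T) \<le> U"
      unfolding onorm_on_def using subspace_0[OF subspace_ell_inf] by (intro cSUP_least) auto
    have "norm (inv_into E T 0) / norm (0 :: nat \<Rightarrow>\<^sub>C real) \<le> onorm_on (ell_inf n) (inv_into E T)"
      unfolding onorm_on_def using subspace_0[OF subspace_ell_inf] le
      by (intro cSUP_upper bdd_aboveI2[of _ _ U]) auto
    then show "0 \<le> onorm_on (ell_inf n) (inv_into E T)" by simp
  qed (use L in simp)
  ultimately show ?thesis using sE unfolding closed_subspace_def by blast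
qed

text \<open>If the pieces of \<open>x\<close> have norm at least \<open>t\<close> and \<open>x\<close> has norm below \<open>2 * t\<close>, then the pieces divided
by \<open>t\<close> span a copy of \<open>\<ell>\<^sub>\<infinity>\<^sup>n\<close> with constant \<open>2 * K\<close>: a combination with coefficients bounded by
\<open>r\<close> is dominated by \<open>r\<close> times \<open>x / t\<close>, and it dominates each of its terms.\<close>

lemma (in lattice_norm) doubling_of_not_ell_inf:
  fixes e :: "nat \<Rightarrow> 'a::banach"
  assumes Y: "subspace Y" "range e \<subseteq> Y" and no: "\<not> contains_ell_inf_uniformly Y"
    and K: "0 < K" and up: "\<And>b. fin_supp b \<Longrightarrow> norm (lin e b) \<le> N b"
    and lo: "\<And>b. fin_supp b \<Longrightarrow> N b \<le> K * norm (lin e b)"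
  shows "\<exists>n. lower_lattice_norm N n"
proof -
  obtain n where n: "\<not> (\<exists>E T. closed_subspace E \<and> E \<subseteq> Y \<and> dim E = n \<and> linear_iso_betw T E (ell_inf n) \<and>
      onorm_on E T * onorm_on (ell_inf n) (inv_into E T) \<le> K * 2)"
    using no unfolding contains_ell_inf_uniformly_def by blast
  have doubling: "2 * t \<le> N x" if x: "fin_supp x" and "0 \<le> t" and big: "\<And>k. k < n \<Longrightarrow> t \<le> N (restr {i. c i = k} x)"
    for x t and c :: "nat \<Rightarrow> nat"
  proof (rule ccontr)
    assume less: "\<not> 2 * t \<le> N x"
    have t: "0 < t" using less nonneg[OF x] \<open>0 \<le> t\<close> by (cases "t = 0") auto
    define u where "u k = (\<lambda>i. (1 / t) * restr {i. c i = k} x i)" for k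
    have fu: "fin_supp (u k)" for k unfolding u_def by (intro fin_supp_scale fin_supp_restr x)
    have Nu: "1 \<le> N (u k)" if "k < n" for k
      unfolding u_def using scale[OF fin_supp_restr[OF x], of "1 / t"] big[OF that] t by simp
    define w where "w g = (\<lambda>i. \<Sum>k<n. apply_bcontfun g k * u k i)" for g :: "nat \<Rightarrow>\<^sub>C real"
    have fw: "fin_supp (w g)" for g unfolding w_def by (intro fin_supp_sum fin_supp_scale fu)
    have w_eq: "w g i = (if c i < n then apply_bcontfun g (c i) * (x i / t) else 0)" for g i
    proof -
      have "w g i = (\<Sum>k<n. if k = c i then apply_bcontfun g (c i) * (x i / t) else 0)"
        unfolding w_def by (intro sum.cong refl) (auto simp: u_def restr_def)
      then show ?thesis by simp
    qed
    have lin_w: "(\<Sum>k<n. apply_bcontfun g k *\<^sub>R lin e (u k)) = lin e (w g)" for g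
      unfolding w_def by (subst lin_sum) (auto simp: lin_scale intro: fu)
    have "\<exists>E T. closed_subspace E \<and> E \<subseteq> Y \<and> dim E = n \<and> linear_iso_betw T E (ell_inf n) \<and>
      onorm_on E T * onorm_on (ell_inf n) (inv_into E T) \<le> K * 2"
    proof (rule ell_inf_span[where v = "\<lambda>k. lin e (u k)"])
      show "lin e (u k) \<in> Y" for k by (rule lin_in_subspace[OF Y])
      fix g :: "nat \<Rightarrow>\<^sub>C real" assume g: "g \<in> ell_inf n"
      show "norm g \<le> K * norm (\<Sum>k<n. apply_bcontfun g k *\<^sub>R lin e (u k))"
        unfolding lin_w
      proof (rule norm_bound)
        fix k
        show "norm (apply_bcontfun g k) \<le> K * norm (lin e (w g))"
        proof (cases "k < n")
          case True
          have "norm (apply_bcontfun g k) \<le> \<bar>apply_bcontfun g k\<bar> * N (u k)"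
            using mult_left_mono[OF Nu[OF True], of "\<bar>apply_bcontfun g k\<bar>"] by simp
          also have "\<dots> = N (\<lambda>i. apply_bcontfun g k * u k i)" by (rule scale[OF fu, symmetric])
          also have "\<dots> \<le> N (w g)" by (rule mono[OF fw]) (auto simp: w_eq u_def restr_def True)
          also have "\<dots> \<le> K * norm (lin e (w g))" by (rule lo[OF fw])
          finally show ?thesis .
        next
          case False
          then show ?thesis using g K by (simp add: ell_inf_def)
        qed
      qed
      have "norm (lin e (w g)) \<le> N (w g)" by (rule up[OF fw])
      also have "\<dots> \<le> N (\<lambda>i. (norm g / t) * x i)"
      proof (rule mono)
        show "fin_supp (\<lambda>i. (norm g / t) * x i)" using x by (rule fin_supp_scale)
        fix i
        have "\<bar>apply_bcontfun g (c i)\<bar> \<le> norm g" using norm_bounded[of g "c i"] by simp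
        then have "\<bar>apply_bcontfun g (c i)\<bar> * \<bar>x i / t\<bar> \<le> norm g * \<bar>x i / t\<bar>" by (intro mult_right_mono) auto
        then show "\<bar>w g i\<bar> \<le> \<bar>(norm g / t) * x i\<bar>" using t by (simp add: w_eq abs_mult)
      qed
      also have "\<dots> = norm g * (N x / t)" using scale[OF x, of "norm g / t"] t by simp
      also have "\<dots> \<le> norm g * 2" using less t by (intro mult_left_mono) (auto simp: divide_le_eq)
      finally show "norm (\<Sum>k<n. apply_bcontfun g k *\<^sub>R lin e (u k)) \<le> 2 * norm g"
        unfolding lin_w by simp
    qed (use Y K in auto)
    then show False using n by blast
  qed
  have "lower_lattice_norm N n"
  proof unfold_locales
    fix x t and c :: "nat \<Rightarrow> nat"
    assume "fin_supp x" "0 \<le> t" "\<And>k. k < n \<Longrightarrow> t \<le> N (restr {i. c i = k} x)"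
    then show "2 * t \<le> N x" by (rule doubling)
  qed
  then show ?thesis by blast
qed

section \<open>Coarse embedding of Hilbert space\<close>

theorem theorem5p1:
  fixes Y :: "'a::banach set"
  assumes "closed_subspace Y"
    and "\<exists>e. unconditional_basis Y e"
    and "\<not> contains_ell_inf_uniformly Y"
  shows "embeds_coarsely ell2_metric (euclidean_metric :: 'a metric)"
proof -
  obtain e where e: "unconditional_basis Y e" using assms(2) by blast
  have sb: "schauder_basis Y e" using e by (simp add: unconditional_basis_def)
  have sub: "subspace Y" using assms(1) by (simp add: closed_subspace_def)
  obtain K where K: "0 < K"
    and dom: "\<And>x b. fin_supp x \<Longrightarrow> (\<And>i. \<bar>b i\<bar> \<le> \<bar>x i\<bar>) \<Longrightarrow> norm (lin e b) \<le> K * norm (lin e x)"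
    using unconditional_domination[OF assms(1) e] by blast
  interpret lattice_norm "lat e"
    using K dom basis_nonzero[OF sb sub] by (rule lattice_norm_lat)
  have up: "norm (lin e b) \<le> lat e b" if "fin_supp b" for b
    using K dom that by (rule norm_le_lat)
  have lo: "lat e b \<le> K * norm (lin e b)" if "fin_supp b" for b
    using K dom that by (rule lat_le_norm)
  have "range e \<subseteq> Y" using sb by (simp add: schauder_basis_def)
  then obtain n where "lower_lattice_norm (lat e) n"
    using doubling_of_not_ell_inf[OF sub _ assms(3) K up lo] by blast
  then interpret lower_lattice_norm "lat e" n .
  show ?thesis by (rule coarse_embedding_from_layers[OF up K lo])
qed

end
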